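(* Let $(M,\varphi,\eta,\xi,g)$ be a $K$-contact manifold of dimension $2m+1>3$ with Weyl tensor $W$. (1) $M$ satisfies the doubly weakly conformally flat condition $W(X,\xi,\xi)=0$ for all vector fields $X$ on $M$ if and only if $M$ is $\eta$-Einstein. (2) If $M$ satisfies the weakly conformally flat condition $W(X,Y)\xi=0$ for all vector fields $X,Y$ on $M$, then $M$ is Sasakian and $\eta$-Einstein (i.e. quasi-Einstein with distinguished unit vector field $U=\xi$).
   Context: Curvature conventions: $R(X,Y)Z=\nabla_X\nabla_YZ-\nabla_Y\nabla_XZ-\nabla_{[X,Y]}Z$; $Ric(Y,Z)$ is the trace of $X\mapsto R(X,Y)Z$; $Q$ is the Ricci operator, $g(QX,Y)=Ric(X,Y)$; $r$ is the scalar curvature. The Weyl tensor of type $(1,3)$ in dimension $n$ is $$W(X,Y,Z)=W(X,Y)Z=R(X,Y)Z+\tfrac{1}{n-2}\big[Ric(X,Z)Y-Ric(Y,Z)X+g(X,Z)QY-g(Y,Z)QX\big]-\tfrac{r}{(n-1)(n-2)}\big[g(X,Z)Y-g(Y,Z)X\big].$$ Contact Riemannian manifold: a $(2m+1)$-dimensional smooth manifold $M$ with a 1-form $\eta$ such that $\eta\wedge(d\eta)^m\neq0$ everywhere, the Reeb vector field $\xi$ determined by $\eta(\xi)=1$, $d\eta(\xi,\cdot)=0$, and a Riemannian metric $g$ and $(1,1)$-tensor field $\varphi$ with $$d\eta(X,Y)=g(X,\varphi Y),\quad \eta(X)=g(\xi,X),\quad \varphi^2=-I+\eta\otimes\xi,$$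 where $d\eta(X,Y)=\frac12\big(X\eta(Y)-Y\eta(X)-\eta([X,Y])\big)$. Put $h=\frac12\mathcal{L}_\xi\varphi$, with $\mathcal{L}$ the Lie derivative. $K$-contact: a contact Riemannian manifold for which $\xi$ is Killing; equivalently $h=0$; equivalently $R(X,\xi)\xi=X-\eta(X)\xi$ for all $X$. Sasakian: a contact Riemannian manifold $M$ for which the almost Kähler structure induced on the cone $C(M)$ over $M$ with metric $dr^2+r^2g$ is integrable (Kähler); equivalently $R(X,Y)\xi=\eta(Y)X-\eta(X)Y$ for all $X,Y$. $\eta$-Einstein: there exist smooth functions $a,b$ on $M$ with $Ric=a\,g+b\,\eta\otimes\eta$. (Quasi-Einstein means $Ric=a\,g+b\,u\otimes u$ with $a,b$ smooth functions and $u$ the 1-form metrically equivalent to a unit vector field $U$.) *)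

theory Defs
  imports "HOL-Analysis.Analysis" "HOL-Combinatorics.Permutations"
begin

section \<open>Smooth manifolds\<close>

text \<open>For open \<open>S\<close>, \<open>Ck_on k S f\<close> says that \<open>f\<close> is of class \<open>C^k\<close> on \<open>S\<close>.\<close>

primrec Ck_on :: "nat \<Rightarrow> 'a::euclidean_space set \<Rightarrow> ('a \<Rightarrow> 'b::real_normed_vector) \<Rightarrow> bool" where
  "Ck_on 0 S f = continuous_on S f"
| "Ck_on (Suc k) S f =
    ((\<forall>x\<in>S. f differentiable (at x)) \<and> (\<forall>v. Ck_on k S (\<lambda>x. frechet_derivative f (at x) v)))"

definition smooth_on :: "'a::euclidean_space set \<Rightarrow> ('a \<Rightarrow> 'b::real_normed_vector) \<Rightarrow> bool" where
  "smooth_on S f \<longleftrightarrow> (\<forall>k. Ck_on k S f)"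

text \<open>A chart is a pair of its domain and its coordinate map; the values of the coordinate map
  outside the domain are irrelevant. The underlying set of the manifold given by an atlas is the
  union of the chart domains; the atlas need not be maximal.\<close>

type_synonym ('p, 'e) chart = "'p set \<times> ('p \<Rightarrow> 'e)"

definition chart_inv :: "('p, 'e) chart \<Rightarrow> 'e \<Rightarrow> 'p" where
  "chart_inv c = inv_into (fst c) (snd c)"

definition is_chart :: "('p::topological_space, 'e::euclidean_space) chart \<Rightarrow> bool" where
  "is_chart c \<longleftrightarrow> open (fst c) \<and> open (snd c ` fst c) \<and>
     homeomorphism (fst c) (snd c ` fst c) (snd c) (chart_inv c)"

definition smooth_atlas ::
    "('p::{t2_space,second_countable_topology}, 'e::euclidean_space) chart set \<Rightarrow> bool" where
  "smooth_atlas A \<longleftrightarrow> (\<forall>c\<in>A. is_chart c) \<and>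
     (\<forall>c\<in>A. \<forall>d\<in>A. smooth_on (snd c ` (fst c \<inter> fst d)) (snd d \<circ> chart_inv c))"

definition chart_smooth ::
    "('p, 'e::euclidean_space) chart \<Rightarrow> ('p \<Rightarrow> 'b::real_normed_vector) \<Rightarrow> bool" where
  "chart_smooth c F \<longleftrightarrow> smooth_on (snd c ` fst c) (F \<circ> chart_inv c)"

definition smooth_fun :: "('p, 'e::euclidean_space) chart set \<Rightarrow> ('p \<Rightarrow> real) \<Rightarrow> bool" where
  "smooth_fun A f \<longleftrightarrow> (\<forall>c\<in>A. chart_smooth c f)"

text \<open>\<open>pd c F p u\<close> is the derivative at \<open>p\<close>, in the chart \<open>c\<close>, of \<open>F\<close> in the direction with
  coordinate vector \<open>u\<close>. In particular \<open>pd c (snd d) p\<close> is the Jacobian at \<open>p\<close> of the change of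
  coordinates from \<open>c\<close> to \<open>d\<close>.\<close>

definition pd ::
    "('p, 'e::euclidean_space) chart \<Rightarrow> ('p \<Rightarrow> 'b::real_normed_vector) \<Rightarrow> 'p \<Rightarrow> 'e \<Rightarrow> 'b" where
  "pd c F p u = frechet_derivative (F \<circ> chart_inv c) (at (snd c p)) u"


section \<open>Tensor fields\<close>

text \<open>A tensor field is the family of its representations in the charts, subject to the
  transformation law. All operations below are computed chartwise, so they also apply to
  families that represent a field in a single chart only; \<open>coord_field u\<close> is used in this way, as
  the field with constant components \<open>u\<close>. Evaluating a tensorial expression on coordinate fields
  gives its value on tangent vectors.\<close>

type_synonym ('p, 'e) vfield = "('p, 'e) chart \<Rightarrow> 'p \<Rightarrow> 'e"
type_synonym ('p, 'e) oneform = "('p, 'e) chart \<Rightarrow> 'p \<Rightarrow> 'e \<Rightarrow> real"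
type_synonym ('p, 'e) bform = "('p, 'e) chart \<Rightarrow> 'p \<Rightarrow> 'e \<Rightarrow> 'e \<Rightarrow> real"
type_synonym ('p, 'e) endo = "('p, 'e) chart \<Rightarrow> 'p \<Rightarrow> 'e \<Rightarrow> 'e"

definition vector_field ::
    "('p, 'e::euclidean_space) chart set \<Rightarrow> ('p, 'e) vfield \<Rightarrow> bool" where
  "vector_field A X \<longleftrightarrow> (\<forall>c\<in>A. chart_smooth c (X c)) \<and>
     (\<forall>c\<in>A. \<forall>d\<in>A. \<forall>p\<in>fst c \<inter> fst d. X d p = pd c (snd d) p (X c p))"

definition one_form ::
    "('p, 'e::euclidean_space) chart set \<Rightarrow> ('p, 'e) oneform \<Rightarrow> bool" where
  "one_form A \<eta> \<longleftrightarrow> (\<forall>c\<in>A. \<forall>u. chart_smooth c (\<lambda>p. \<eta> c p u)) \<and>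
     (\<forall>c\<in>A. \<forall>p\<in>fst c. linear (\<eta> c p)) \<and>
     (\<forall>c\<in>A. \<forall>d\<in>A. \<forall>p\<in>fst c \<inter> fst d. \<forall>u. \<eta> d p (pd c (snd d) p u) = \<eta> c p u)"

definition endo_field ::
    "('p, 'e::euclidean_space) chart set \<Rightarrow> ('p, 'e) endo \<Rightarrow> bool" where
  "endo_field A \<phi> \<longleftrightarrow> (\<forall>c\<in>A. \<forall>u. chart_smooth c (\<lambda>p. \<phi> c p u)) \<and>
     (\<forall>c\<in>A. \<forall>p\<in>fst c. linear (\<phi> c p)) \<and>
     (\<forall>c\<in>A. \<forall>d\<in>A. \<forall>p\<in>fst c \<inter> fst d. \<forall>u.
        \<phi> d p (pd c (snd d) p u) = pd c (snd d) p (\<phi> c p u))"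

definition riemannian_metric ::
    "('p, 'e::euclidean_space) chart set \<Rightarrow> ('p, 'e) bform \<Rightarrow> bool" where
  "riemannian_metric A g \<longleftrightarrow> (\<forall>c\<in>A. \<forall>u v. chart_smooth c (\<lambda>p. g c p u v)) \<and>
     (\<forall>c\<in>A. \<forall>p\<in>fst c. bilinear (g c p) \<and> (\<forall>u v. g c p u v = g c p v u) \<and>
        (\<forall>u. u \<noteq> 0 \<longrightarrow> g c p u u > 0)) \<and>
     (\<forall>c\<in>A. \<forall>d\<in>A. \<forall>p\<in>fst c \<inter> fst d. \<forall>u v.
        g d p (pd c (snd d) p u) (pd c (snd d) p v) = g c p u v)"

definition coord_field :: "'e \<Rightarrow> ('p, 'e) vfield" where
  "coord_field u = (\<lambda>c p. u)"

definition vanishes :: "('p, 'e) chart set \<Rightarrow> ('p, 'e::zero) vfield \<Rightarrow> bool" where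
  "vanishes A X \<longleftrightarrow> (\<forall>c\<in>A. \<forall>p\<in>fst c. X c p = 0)"

definition endo_app :: "('p, 'e) endo \<Rightarrow> ('p, 'e) vfield \<Rightarrow> ('p, 'e) vfield" where
  "endo_app \<phi> X = (\<lambda>c p. \<phi> c p (X c p))"

definition bracket ::
    "('p, 'e::euclidean_space) vfield \<Rightarrow> ('p, 'e) vfield \<Rightarrow> ('p, 'e) vfield" where
  "bracket X Y = (\<lambda>c p. pd c (Y c) p (X c p) - pd c (X c) p (Y c p))"

text \<open>The exterior derivatives of a 1-form and of a 2-form use the convention with the factors
  \<open>1/2\<close> and \<open>1/3\<close>.\<close>

definition ext_d :: "('p, 'e::euclidean_space) oneform \<Rightarrow>
    ('p, 'e) vfield \<Rightarrow> ('p, 'e) vfield \<Rightarrow> ('p, 'e) chart \<Rightarrow> 'p \<Rightarrow> real" where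
  "ext_d \<eta> X Y c p = 1/2 * (pd c (\<lambda>q. \<eta> c q (Y c q)) p (X c p)
      - pd c (\<lambda>q. \<eta> c q (X c q)) p (Y c p) - \<eta> c p (bracket X Y c p))"

definition ext_d2 :: "('p, 'e::euclidean_space) bform \<Rightarrow>
    ('p, 'e) vfield \<Rightarrow> ('p, 'e) vfield \<Rightarrow> ('p, 'e) vfield \<Rightarrow> ('p, 'e) chart \<Rightarrow> 'p \<Rightarrow> real" where
  "ext_d2 \<omega> X Y Z c p = 1/3 *
     (pd c (\<lambda>q. \<omega> c q (Y c q) (Z c q)) p (X c p)
    + pd c (\<lambda>q. \<omega> c q (Z c q) (X c q)) p (Y c p)
    + pd c (\<lambda>q. \<omega> c q (X c q) (Y c q)) p (Z c p)
    - \<omega> c p (bracket X Y c p) (Z c p)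
    - \<omega> c p (bracket Y Z c p) (X c p)
    - \<omega> c p (bracket Z X c p) (Y c p))"

text \<open>Alternating \<open>k\<close>-forms on a vector space are functions of \<open>v 0, \<dots>, v (k - 1)\<close>. The factor
  \<open>1 / (k + l)!\<close> belongs to the same convention as the factor \<open>1/2\<close> above.\<close>

definition wedge :: "nat \<Rightarrow> nat \<Rightarrow> ((nat \<Rightarrow> 'e) \<Rightarrow> real) \<Rightarrow> ((nat \<Rightarrow> 'e) \<Rightarrow> real) \<Rightarrow> (nat \<Rightarrow> 'e) \<Rightarrow> real"
  where
  "wedge k l \<alpha> \<beta> v = 1 / fact (k + l) *
     (\<Sum>s | s permutes {..<k + l}. of_int (sign s) * \<alpha> (\<lambda>i. v (s i)) * \<beta> (\<lambda>i. v (s (k + i))))"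

primrec two_form_power :: "((nat \<Rightarrow> 'e) \<Rightarrow> real) \<Rightarrow> nat \<Rightarrow> (nat \<Rightarrow> 'e) \<Rightarrow> real" where
  "two_form_power \<beta> 0 = (\<lambda>v. 1)"
| "two_form_power \<beta> (Suc m) = wedge 2 (2 * m) \<beta> (two_form_power \<beta> m)"


section \<open>Riemannian geometry\<close>

text \<open>Trace of a linear endomorphism; \<open>Basis\<close> is the standard orthonormal basis of the model
  space, but the trace does not depend on the basis.\<close>

definition endo_trace :: "('e::euclidean_space \<Rightarrow> 'e) \<Rightarrow> real" where
  "endo_trace f = (\<Sum>b\<in>Basis. f b \<bullet> b)"

text \<open>The Christoffel symbols in the chart \<open>c\<close>, as a bilinear map: the first condition says that
  the Levi-Civita connection is torsion-free, the second one that it is metric. Existence and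
  uniqueness are shown in \<open>christoffel_ex1\<close> below.\<close>

definition christoffel ::
    "('p, 'e::euclidean_space) bform \<Rightarrow> ('p, 'e) chart \<Rightarrow> 'p \<Rightarrow> 'e \<Rightarrow> 'e \<Rightarrow> 'e" where
  "christoffel g c p = (THE G. (\<forall>u v. G u v = G v u) \<and>
     (\<forall>u v w. pd c (\<lambda>q. g c q v w) p u = g c p (G u v) w + g c p v (G u w)))"

definition cov :: "('p, 'e::euclidean_space) bform \<Rightarrow>
    ('p, 'e) vfield \<Rightarrow> ('p, 'e) vfield \<Rightarrow> ('p, 'e) vfield" where
  "cov g X Y = (\<lambda>c p. pd c (Y c) p (X c p) + christoffel g c p (X c p) (Y c p))"

definition riem :: "('p, 'e::euclidean_space) bform \<Rightarrow>
    ('p, 'e) vfield \<Rightarrow> ('p, 'e) vfield \<Rightarrow> ('p, 'e) vfield \<Rightarrow> ('p, 'e) vfield" where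
  "riem g X Y Z = (\<lambda>c p. cov g X (cov g Y Z) c p - cov g Y (cov g X Z) c p
     - cov g (bracket X Y) Z c p)"

definition ric :: "('p, 'e::euclidean_space) bform \<Rightarrow>
    ('p, 'e) vfield \<Rightarrow> ('p, 'e) vfield \<Rightarrow> ('p, 'e) chart \<Rightarrow> 'p \<Rightarrow> real" where
  "ric g Y Z c p = endo_trace (\<lambda>u. riem g (coord_field u) Y Z c p)"

definition ricci_op :: "('p, 'e::euclidean_space) bform \<Rightarrow> ('p, 'e) vfield \<Rightarrow> ('p, 'e) vfield" where
  "ricci_op g X = (\<lambda>c p. THE w. \<forall>v. g c p w v = ric g X (coord_field v) c p)"

definition scal :: "('p, 'e::euclidean_space) bform \<Rightarrow> ('p, 'e) chart \<Rightarrow> 'p \<Rightarrow> real" where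
  "scal g c p = endo_trace (\<lambda>u. ricci_op g (coord_field u) c p)"

definition weyl :: "('p, 'e::euclidean_space) bform \<Rightarrow>
    ('p, 'e) vfield \<Rightarrow> ('p, 'e) vfield \<Rightarrow> ('p, 'e) vfield \<Rightarrow> ('p, 'e) vfield" where
  "weyl g X Y Z = (\<lambda>c p. let n = real DIM('e) in
     riem g X Y Z c p
     + (1 / (n - 2)) *\<^sub>R (ric g X Z c p *\<^sub>R Y c p - ric g Y Z c p *\<^sub>R X c p
         + g c p (X c p) (Z c p) *\<^sub>R ricci_op g Y c p - g c p (Y c p) (Z c p) *\<^sub>R ricci_op g X c p)
     - (scal g c p / ((n - 1) * (n - 2))) *\<^sub>R
         (g c p (X c p) (Z c p) *\<^sub>R Y c p - g c p (Y c p) (Z c p) *\<^sub>R X c p))"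

definition killing ::
    "('p, 'e::euclidean_space) chart set \<Rightarrow> ('p, 'e) bform \<Rightarrow> ('p, 'e) vfield \<Rightarrow> bool" where
  "killing A g V \<longleftrightarrow> vector_field A V \<and>
     (\<forall>X Y. vector_field A X \<longrightarrow> vector_field A Y \<longrightarrow> (\<forall>c\<in>A. \<forall>p\<in>fst c.
        pd c (\<lambda>q. g c q (X c q) (Y c q)) p (V c p)
        - g c p (bracket V X c p) (Y c p) - g c p (X c p) (bracket V Y c p) = 0))"

definition quasi_einstein ::
    "('p, 'e::euclidean_space) chart set \<Rightarrow> ('p, 'e) bform \<Rightarrow> ('p, 'e) vfield \<Rightarrow> bool" where
  "quasi_einstein A g U \<longleftrightarrow> vector_field A U \<and>
     (\<forall>c\<in>A. \<forall>p\<in>fst c. g c p (U c p) (U c p) = 1) \<and>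
     (\<exists>a b. smooth_fun A a \<and> smooth_fun A b \<and>
       (\<forall>X Y. vector_field A X \<longrightarrow> vector_field A Y \<longrightarrow> (\<forall>c\<in>A. \<forall>p\<in>fst c.
          ric g X Y c p = a p * g c p (X c p) (Y c p)
            + b p * g c p (U c p) (X c p) * g c p (U c p) (Y c p))))"


section \<open>Almost complex and Kaehler structures\<close>

definition nijenhuis :: "('p, 'e::euclidean_space) endo \<Rightarrow>
    ('p, 'e) vfield \<Rightarrow> ('p, 'e) vfield \<Rightarrow> ('p, 'e) vfield" where
  "nijenhuis J X Y = (\<lambda>c p. bracket (endo_app J X) (endo_app J Y) c p - bracket X Y c p
     - J c p (bracket (endo_app J X) Y c p) - J c p (bracket X (endo_app J Y) c p))"

text \<open>Integrability of an almost complex structure is meant in the sense of a vanishing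
  Nijenhuis tensor.\<close>

definition integrable_acs ::
    "('p, 'e::euclidean_space) chart set \<Rightarrow> ('p, 'e) endo \<Rightarrow> bool" where
  "integrable_acs A J \<longleftrightarrow>
     (\<forall>X Y. vector_field A X \<longrightarrow> vector_field A Y \<longrightarrow> vanishes A (nijenhuis J X Y))"

definition almost_kaehler ::
    "('p::{t2_space,second_countable_topology}, 'e::euclidean_space) chart set \<Rightarrow>
     ('p, 'e) bform \<Rightarrow> ('p, 'e) endo \<Rightarrow> bool" where
  "almost_kaehler A g J \<longleftrightarrow> smooth_atlas A \<and> riemannian_metric A g \<and> endo_field A J \<and>
     (\<forall>c\<in>A. \<forall>p\<in>fst c. \<forall>u v. J c p (J c p u) = - u \<and> g c p (J c p u) (J c p v) = g c p u v) \<and>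
     (\<forall>X Y Z. vector_field A X \<longrightarrow> vector_field A Y \<longrightarrow> vector_field A Z \<longrightarrow>
        (\<forall>c\<in>A. \<forall>p\<in>fst c. ext_d2 (\<lambda>c p u v. g c p u (J c p v)) X Y Z c p = 0))"

definition kaehler ::
    "('p::{t2_space,second_countable_topology}, 'e::euclidean_space) chart set \<Rightarrow>
     ('p, 'e) bform \<Rightarrow> ('p, 'e) endo \<Rightarrow> bool" where
  "kaehler A g J \<longleftrightarrow> almost_kaehler A g J \<and> integrable_acs A J"


section \<open>Contact Riemannian manifolds\<close>

definition contact_form ::
    "('p, 'e::euclidean_space) chart set \<Rightarrow> nat \<Rightarrow> ('p, 'e) oneform \<Rightarrow> bool" where
  "contact_form A m \<eta> \<longleftrightarrow> one_form A \<eta> \<and> (\<forall>c\<in>A. \<forall>p\<in>fst c. \<exists>v.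
     wedge 1 (2 * m) (\<lambda>w. \<eta> c p (w 0))
       (two_form_power (\<lambda>w. ext_d \<eta> (coord_field (w 0)) (coord_field (w 1)) c p) m) v \<noteq> 0)"

definition contact_riemannian ::
    "('p::{t2_space,second_countable_topology}, 'e::euclidean_space) chart set \<Rightarrow> nat \<Rightarrow>
     ('p, 'e) endo \<Rightarrow> ('p, 'e) oneform \<Rightarrow> ('p, 'e) vfield \<Rightarrow> ('p, 'e) bform \<Rightarrow> bool" where
  "contact_riemannian A m \<phi> \<eta> \<xi> g \<longleftrightarrow>
     smooth_atlas A \<and> DIM('e) = 2 * m + 1 \<and> contact_form A m \<eta> \<and>
     vector_field A \<xi> \<and> riemannian_metric A g \<and> endo_field A \<phi> \<and>
     (\<forall>c\<in>A. \<forall>p\<in>fst c. \<eta> c p (\<xi> c p) = 1) \<and>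
     (\<forall>X. vector_field A X \<longrightarrow> (\<forall>c\<in>A. \<forall>p\<in>fst c.
        ext_d \<eta> \<xi> X c p = 0 \<and>
        \<eta> c p (X c p) = g c p (\<xi> c p) (X c p) \<and>
        \<phi> c p (\<phi> c p (X c p)) = - X c p + \<eta> c p (X c p) *\<^sub>R \<xi> c p)) \<and>
     (\<forall>X Y. vector_field A X \<longrightarrow> vector_field A Y \<longrightarrow> (\<forall>c\<in>A. \<forall>p\<in>fst c.
        ext_d \<eta> X Y c p = g c p (X c p) (\<phi> c p (Y c p))))"

definition k_contact ::
    "('p::{t2_space,second_countable_topology}, 'e::euclidean_space) chart set \<Rightarrow> nat \<Rightarrow>
     ('p, 'e) endo \<Rightarrow> ('p, 'e) oneform \<Rightarrow> ('p, 'e) vfield \<Rightarrow> ('p, 'e) bform \<Rightarrow> bool" where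
  "k_contact A m \<phi> \<eta> \<xi> g \<longleftrightarrow> contact_riemannian A m \<phi> \<eta> \<xi> g \<and> killing A g \<xi>"

definition eta_einstein ::
    "('p, 'e::euclidean_space) chart set \<Rightarrow> ('p, 'e) bform \<Rightarrow> ('p, 'e) oneform \<Rightarrow> bool" where
  "eta_einstein A g \<eta> \<longleftrightarrow> (\<exists>a b. smooth_fun A a \<and> smooth_fun A b \<and>
     (\<forall>X Y. vector_field A X \<longrightarrow> vector_field A Y \<longrightarrow> (\<forall>c\<in>A. \<forall>p\<in>fst c.
        ric g X Y c p = a p * g c p (X c p) (Y c p) + b p * \<eta> c p (X c p) * \<eta> c p (Y c p))))"

text \<open>The cone over \<open>M\<close> is \<open>M \<times> (0, \<infinity>)\<close> with the product charts. A tangent vector with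
  components \<open>(u, s)\<close> is \<open>u + s \<partial>\<^sub>r\<close>. A field on the cone is given by its components in the
  cone charts; \<open>base_chart\<close> recovers the chart of \<open>M\<close> from which a cone chart was built.\<close>

definition cone_chart :: "('p, 'e) chart \<Rightarrow> ('p \<times> real, 'e \<times> real) chart" where
  "cone_chart c = (fst c \<times> {0<..}, \<lambda>(p, r). (snd c p, r))"

definition cone_atlas :: "('p, 'e) chart set \<Rightarrow> ('p \<times> real, 'e \<times> real) chart set" where
  "cone_atlas A = cone_chart ` A"

definition base_chart :: "('p \<times> real, 'e \<times> real) chart \<Rightarrow> ('p, 'e) chart" where
  "base_chart C = (fst ` fst C, \<lambda>p. fst (snd C (p, 1)))"

lemma base_chart_cone_chart: "base_chart (cone_chart c) = c"
proof -
  have "{0::real<..} \<noteq> {}"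
    using zero_less_one by blast
  then show ?thesis
    by (simp add: base_chart_def cone_chart_def)
qed

definition cone_metric :: "('p, 'e) bform \<Rightarrow> ('p \<times> real, 'e \<times> real) bform" where
  "cone_metric g C = (\<lambda>(p, r) (u, s) (v, t). s * t + r\<^sup>2 * g (base_chart C) p u v)"

text \<open>The almost complex structure of the cone is the one with fundamental 2-form
  \<open>d(r\<^sup>2 \<eta>)\<close>, that is, \<open>J X = \<phi> X + \<eta>(X) r \<partial>\<^sub>r\<close> for \<open>X\<close> tangent to \<open>M\<close>, and
  \<open>J (r \<partial>\<^sub>r) = - \<xi>\<close>.\<close>

definition cone_J :: "('p, 'e::real_vector) endo \<Rightarrow> ('p, 'e) oneform \<Rightarrow> ('p, 'e) vfield \<Rightarrow>
    ('p \<times> real, 'e \<times> real) endo" where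
  "cone_J \<phi> \<eta> \<xi> C = (\<lambda>(p, r) (u, s).
     (\<phi> (base_chart C) p u - (s / r) *\<^sub>R \<xi> (base_chart C) p, r * \<eta> (base_chart C) p u))"

definition sasakian ::
    "('p::{t2_space,second_countable_topology}, 'e::euclidean_space) chart set \<Rightarrow> nat \<Rightarrow>
     ('p, 'e) endo \<Rightarrow> ('p, 'e) oneform \<Rightarrow> ('p, 'e) vfield \<Rightarrow> ('p, 'e) bform \<Rightarrow> bool" where
  "sasakian A m \<phi> \<eta> \<xi> g \<longleftrightarrow> contact_riemannian A m \<phi> \<eta> \<xi> g \<and>
     kaehler (cone_atlas A) (cone_metric g) (cone_J \<phi> \<eta> \<xi>)"


section \<open>The Levi-Civita connection is well defined\<close>

lemma pos_form_represents:
  fixes B :: "'e::euclidean_space \<Rightarrow> 'e \<Rightarrow> real"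
  assumes B: "bilinear B" and pos: "\<And>u. u \<noteq> 0 \<Longrightarrow> B u u > 0" and f: "linear f"
  shows "\<exists>!w. \<forall>z. B w z = f z"
proof -
  define T where "T w = (\<Sum>b\<in>Basis. B w b *\<^sub>R b)" for w
  have BT: "B w z = T w \<bullet> z" for w z
  proof -
    have l: "linear (B w)" using B by (simp add: bilinear_def)
    have "B w z = B w (\<Sum>b\<in>Basis. (z \<bullet> b) *\<^sub>R b)" by (simp add: euclidean_representation)
    also have "\<dots> = (\<Sum>b\<in>Basis. (z \<bullet> b) * B w b)"
      using l by (simp add: linear_sum linear_cmul)
    also have "\<dots> = T w \<bullet> z"
      by (simp add: T_def inner_sum_left inner_commute [of z] mult.commute)
    finally show ?thesis .
  qed
  have linT: "linear T"
    by (rule linearI)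
      (simp_all add: T_def bilinear_ladd [OF B] bilinear_lmul [OF B] scaleR_add_left sum.distrib
        scaleR_sum_right)
  have "w = 0" if "T w = 0" for w
    using BT [of w w] pos [of w] that by force
  then have "inj T"
    unfolding linear_injective_0 [OF linT] by blast
  then have "bij T"
    using linear_injective_imp_surjective [OF linT] by (simp add: bij_def)
  define y where "y = (\<Sum>b\<in>Basis. f b *\<^sub>R b)"
  have fy: "f z = y \<bullet> z" for z
  proof -
    have "f z = f (\<Sum>b\<in>Basis. (z \<bullet> b) *\<^sub>R b)" by (simp add: euclidean_representation)
    also have "\<dots> = (\<Sum>b\<in>Basis. (z \<bullet> b) * f b)"
      using f by (simp add: linear_sum linear_cmul)
    also have "\<dots> = y \<bullet> z"
      by (simp add: y_def inner_sum_left inner_commute [of z] mult.commute)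
    finally show ?thesis .
  qed
  have "(\<forall>z. B w z = f z) \<longleftrightarrow> T w = y" for w
    unfolding BT fy by (rule vector_eq_rdot)
  then show ?thesis
    using \<open>bij T\<close> by (simp add: bij_iff)
qed

lemma chart_smooth_differentiable:
  assumes "chart_smooth c F" "p \<in> fst c"
  shows "(F \<circ> chart_inv c) differentiable (at (snd c p))"
proof -
  have "Ck_on (Suc 0) (snd c ` fst c) (F \<circ> chart_inv c)"
    using assms(1) unfolding chart_smooth_def smooth_on_def by blast
  then show ?thesis using assms(2) by simp
qed

lemma christoffel_ex1:
  assumes "riemannian_metric A g" "smooth_atlas A" "c \<in> A" "p \<in> fst c"
  shows "\<exists>!G. (\<forall>u v. G u v = G v u) \<and>
     (\<forall>u v w. pd c (\<lambda>q. g c q v w) p u = g c p (G u v) w + g c p v (G u w))"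
proof -
  let ?x = "snd c p" and ?S = "snd c ` fst c"
  have B: "bilinear (g c p)" and sym: "\<And>u v. g c p u v = g c p v u"
    and pos: "\<And>u. u \<noteq> 0 \<Longrightarrow> g c p u u > 0"
    using assms unfolding riemannian_metric_def by auto
  have diff: "((\<lambda>q. g c q u v) \<circ> chart_inv c) differentiable (at ?x)" for u v
    using assms chart_smooth_differentiable [of c _ p] unfolding riemannian_metric_def by blast
  have S: "open ?S" "?x \<in> ?S"
    using assms unfolding smooth_atlas_def is_chart_def by auto
  have inS: "chart_inv c x \<in> fst c" if "x \<in> ?S" for x
    using that unfolding chart_inv_def by (rule inv_into_into)
  define D where "D u v w = pd c (\<lambda>q. g c q v w) p u" for u v w
  have D1: "linear (\<lambda>u. D u v w)" for v w
    unfolding D_def pd_def by (rule linear_frechet_derivative [OF diff])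
  have D_sym: "D u v w = D u w v" for u v w
  proof -
    have "((\<lambda>q. g c q v w) \<circ> chart_inv c has_derivative
        frechet_derivative ((\<lambda>q. g c q w v) \<circ> chart_inv c) (at ?x)) (at ?x)"
      by (rule has_derivative_transform_within_open
          [OF diff [of w v, unfolded frechet_derivative_works] S])
        (use inS assms in \<open>auto simp: riemannian_metric_def\<close>)
    from frechet_derivative_at [OF this] show ?thesis
      unfolding D_def pd_def by simp
  qed
  have bil: "bilinear (g c q)" if "q \<in> fst c" for q
    using assms that unfolding riemannian_metric_def by auto
  have D3: "linear (\<lambda>w. D u v w)" for u v
  proof (rule linearI)
    fix w w'
    have "((\<lambda>q. g c q v (w + w')) \<circ> chart_inv c has_derivative
        (\<lambda>u. frechet_derivative ((\<lambda>q. g c q v w) \<circ> chart_inv c) (at ?x) u +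
             frechet_derivative ((\<lambda>q. g c q v w') \<circ> chart_inv c) (at ?x) u)) (at ?x)"
      by (rule has_derivative_transform_within_open
          [OF has_derivative_add [OF diff [of v w, unfolded frechet_derivative_works]
            diff [of v w', unfolded frechet_derivative_works]] S])
        (simp add: inS bilinear_radd [OF bil])
    from frechet_derivative_at [OF this, symmetric] show "D u v (w + w') = D u v w + D u v w'"
      unfolding D_def pd_def by simp
  next
    fix r :: real and w
    have "((\<lambda>q. g c q v (r *\<^sub>R w)) \<circ> chart_inv c has_derivative
        (\<lambda>u. r *\<^sub>R frechet_derivative ((\<lambda>q. g c q v w) \<circ> chart_inv c) (at ?x) u)) (at ?x)"
      by (rule has_derivative_transform_within_open
          [OF has_derivative_scaleR_right [OF diff [of v w, unfolded frechet_derivative_works]] S])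
        (simp add: inS bilinear_rmul [OF bil])
    from frechet_derivative_at [OF this, symmetric] show "D u v (r *\<^sub>R w) = r *\<^sub>R D u v w"
      unfolding D_def pd_def by simp
  qed
  have lin: "linear (\<lambda>z. (D u v z + D v u z - D z u v) / 2)" for u v
    by (rule linearI)
      (simp_all add: linear_add [OF D3] linear_cmul [OF D3] linear_add [OF D1] linear_cmul [OF D1]
        field_simps)
  define G where "G u v = (THE w. \<forall>z. g c p w z = (D u v z + D v u z - D z u v) / 2)" for u v
  have G: "g c p (G u v) z = (D u v z + D v u z - D z u v) / 2" for u v z
    using theI' [OF pos_form_represents [OF B pos lin [of u v]]] unfolding G_def by blast
  have nondeg: "x = y" if "\<And>z. g c p x z = g c p y z" for x y
  proof -
    have "g c p (x - y) (x - y) = 0"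
      by (simp add: bilinear_lsub [OF B] that)
    then show ?thesis using pos [of "x - y"] by force
  qed
  show ?thesis
    unfolding D_def [symmetric]
  proof (rule ex1I [of _ G], intro conjI allI)
    fix u v w
    show "G u v = G v u"
      by (rule nondeg) (simp add: G D_sym [of _ u v])
    show "D u v w = g c p (G u v) w + g c p v (G u w)"
      by (simp add: sym [of v] G D_sym [of u w v] D_sym [of v w u] D_sym [of w v u])
        (simp add: field_simps)
  next
    fix H
    assume H: "(\<forall>u v. H u v = H v u) \<and> (\<forall>u v w. D u v w = g c p (H u v) w + g c p v (H u w))"
    show "H = G"
    proof (intro ext nondeg)
      fix u v z
      have s: "H v u = H u v" "H z u = H u z" "H z v = H v z"
        and c: "D u v z = g c p (H u v) z + g c p v (H u z)"
           "D v u z = g c p (H v u) z + g c p u (H v z)"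
           "D z u v = g c p (H z u) v + g c p u (H z v)"
        using H by blast+
      show "g c p (H u v) z = g c p (G u v) z"
        unfolding G c s using sym [of v "H u z"] by simp
    qed
  qed
qed

end

theory Submission
  imports Defs
begin

text \<open>On a K-contact manifold \<open>\<nabla>\<^sub>X \<xi> = - \<phi> X\<close>, whence \<open>R(X, \<xi>)\<xi> = X - \<eta>(X)\<xi>\<close> and \<open>Q \<xi> = 2m \<xi>\<close>.
  Substituting this into the Weyl tensor gives \<open>(2m - 1) W(X, \<xi>)\<xi> = a X + b \<eta>(X)\<xi> - Q X\<close> with
  \<open>a = r/2m - 1\<close> and \<open>b = 2m + 1 - r/2m\<close>; conversely, a trace shows that no other coefficients can
  occur in an \<open>\<eta>\<close>-Einstein metric. Once \<open>Q\<close> has this form, \<open>W(X, Y)\<xi> = 0\<close> reduces to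
  \<open>R(X, Y)\<xi> = \<eta>(Y)X - \<eta>(X)Y\<close>. Since \<open>g((\<nabla>\<^sub>X \<phi>)Y, Z) = g(R(Y, Z)\<xi>, X)\<close>, this yields
  \<open>(\<nabla>\<^sub>X \<phi>)Y = g(X, Y)\<xi> - \<eta>(Y)X\<close>, which makes the Nijenhuis tensor of the cone vanish.\<close>

section \<open>Calculus of smooth functions\<close>

text \<open>The definitions give a tensor by its components in each chart and quantify the
  hypotheses over global vector fields, whereas the geometry is linear algebra in one tangent space.
  Bridging this takes most of the length: a bump function makes every tangent vector the value of a
  global field, and the curvature of fields is shown to depend only on their values at the point.
  The functions a and b of an \<eta>-Einstein metric live on the manifold, so r has to be
  independent of the chart; this is obtained by evaluating \<open>riem\<close> on global fields
  instead of transforming derivatives of Christoffel symbols. Smoothness is given for components on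
  fixed vectors, and indices are raised with a smooth orthogonal frame instead of an inverse matrix.

  The identity \<nabla>\<xi> = - \<phi> holds because the Killing condition makes \<nabla>\<xi> skew
  while d\<eta> is its skew part. Differentiating the algebraic relations between \<phi>, \<xi> and
  g then yields all identities for \<nabla>\<phi>. On the cone the fundamental form is closed for
  every K-contact structure; the Sasakian curvature condition acts on the Nijenhuis tensor
  alone.\<close>

lemma Ck_on_cong:
  assumes "open S" "\<And>x. x \<in> S \<Longrightarrow> f x = g x"
  shows "Ck_on k S f \<longleftrightarrow> Ck_on k S g"
  using assms(2)
proof (induction k arbitrary: f g)
  case 0
  then show ?case by (auto cong: continuous_on_cong)
next
  case (Suc k)
  have *: "f differentiable (at x) \<longleftrightarrow> g differentiable (at x)" if "x \<in> S" for x
    using has_derivative_transform_within_open[OF _ \<open>open S\<close> that] Suc.prems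
    unfolding differentiable_def by metis
  show ?case
  proof (cases "\<forall>x\<in>S. f differentiable (at x)")
    case True
    have "frechet_derivative f (at x) v = frechet_derivative g (at x) v" if "x \<in> S" for x v
      using frechet_derivative_transform_within_open[of f x S g] True that Suc.prems \<open>open S\<close> by auto
    then have "Ck_on k S (\<lambda>x. frechet_derivative f (at x) v) \<longleftrightarrow>
        Ck_on k S (\<lambda>x. frechet_derivative g (at x) v)" for v
      by (rule Suc.IH)
    then show ?thesis using * by simp
  qed (use * in auto)
qed

lemma Ck_on_SucD: "Ck_on (Suc k) S f \<Longrightarrow> Ck_on k S f"
proof (induction k arbitrary: f)
  case 0
  then show ?case
    by (auto intro!: continuous_at_imp_continuous_on differentiable_imp_continuous_within)
next
  case (Suc k)
  then show ?case by (metis Ck_on.simps(2))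
qed

lemma Ck_on_subset: "Ck_on k S f \<Longrightarrow> T \<subseteq> S \<Longrightarrow> Ck_on k T f"
  by (induction k arbitrary: f) (auto intro: continuous_on_subset)

text \<open>In \<open>Ck_on\<close> every derivative is taken with respect to the whole space, so
  neighbourhoods of the single points suffice. This glues fields that are given by different
  formulas on different open sets.\<close>

lemma Ck_on_local:
  assumes "\<And>x. x \<in> S \<Longrightarrow> \<exists>U. open U \<and> x \<in> U \<and> Ck_on k U f"
  shows "Ck_on k S f"
  using assms
proof (induction k arbitrary: f)
  case 0
  show ?case
    unfolding Ck_on.simps continuous_on_eq_continuous_within
    using 0 by (metis Ck_on.simps(1) continuous_on_eq_continuous_at continuous_at_imp_continuous_at_within)
next
  case (Suc k)
  have "f differentiable (at x)" if "x \<in> S" for x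
    using Suc.prems[OF that] by auto
  moreover have "Ck_on k S (\<lambda>x. frechet_derivative f (at x) v)" for v
    by (rule Suc.IH) (use Suc.prems in fastforce)
  ultimately show ?case by simp
qed

text \<open>The inductions on k run through this rule: an explicit formula f' may replace
  \<open>frechet_derivative\<close> because derivatives at a point are unique.\<close>

lemma Ck_on_SucI:
  assumes "open S" "\<And>x. x \<in> S \<Longrightarrow> (f has_derivative f' x) (at x)"
    "\<And>v. Ck_on k S (\<lambda>x. f' x v)"
  shows "Ck_on (Suc k) S f"
proof -
  have "frechet_derivative f (at x) v = f' x v" if "x \<in> S" for x v
    using frechet_derivative_at[OF assms(2)[OF that]] by simp
  then have "Ck_on k S (\<lambda>x. frechet_derivative f (at x) v)" for v
    using Ck_on_cong[OF assms(1), of "\<lambda>x. frechet_derivative f (at x) v" "\<lambda>x. f' x v"] assms(3) by simp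
  moreover have "\<forall>x\<in>S. f differentiable (at x)"
    using assms(2) unfolding differentiable_def by blast
  ultimately show ?thesis by simp
qed

lemma Ck_on_SucE:
  assumes "Ck_on (Suc k) S f"
  shows "\<And>x. x \<in> S \<Longrightarrow> (f has_derivative frechet_derivative f (at x)) (at x)"
    and "\<And>v. Ck_on k S (\<lambda>x. frechet_derivative f (at x) v)"
  using assms by (auto simp: frechet_derivative_works)

lemma Ck_on_const: "open S \<Longrightarrow> Ck_on k S (\<lambda>x. c)"
  by (induction k arbitrary: c) auto

lemma Ck_on_add:
  assumes S: "open S"
  shows "Ck_on k S f \<Longrightarrow> Ck_on k S g \<Longrightarrow> Ck_on k S (\<lambda>x. f x + g x)"
proof (induction k arbitrary: f g)
  case (Suc k)
  show ?case
    by (rule Ck_on_SucI[OF S has_derivative_add])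
      (use Ck_on_SucE[OF Suc.prems(1)] Ck_on_SucE[OF Suc.prems(2)] in \<open>auto intro!: Suc.IH\<close>)
qed (simp add: continuous_on_add)

lemma Ck_on_sum:
  assumes S: "open S" and "\<And>i. i \<in> I \<Longrightarrow> Ck_on k S (f i)"
  shows "Ck_on k S (\<lambda>x. \<Sum>i\<in>I. f i x)"
  using assms(2)
  by (induction I rule: infinite_finite_induct) (simp_all add: Ck_on_const[OF S] Ck_on_add[OF S])

lemma Ck_on_bounded_linear:
  assumes S: "open S" and L: "bounded_linear L"
  shows "Ck_on k S f \<Longrightarrow> Ck_on k S (\<lambda>x. L (f x))"
proof (induction k arbitrary: f)
  case 0
  then show ?case by (simp add: bounded_linear.continuous_on[OF L])
next
  case (Suc k)
  show ?case
    by (rule Ck_on_SucI[OF S bounded_linear.has_derivative[OF L]])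
      (use Ck_on_SucE[OF Suc.prems(1)] in \<open>auto intro!: Suc.IH\<close>)
qed

text \<open>The product rule leaves one factor undifferentiated in each term;
  \<open>Ck_on_SucD\<close> lowers its class so that the induction hypothesis applies to both
  terms.\<close>

lemma Ck_on_bounded_bilinear:
  assumes S: "open S" and B: "bounded_bilinear B"
  shows "Ck_on k S f \<Longrightarrow> Ck_on k S g \<Longrightarrow> Ck_on k S (\<lambda>x. B (f x) (g x))"
proof (induction k arbitrary: f g)
  case 0
  then show ?case by (simp add: bounded_bilinear.continuous_on[OF B])
next
  case (Suc k)
  show ?case
    by (rule Ck_on_SucI[OF S bounded_bilinear.FDERIV[OF B]])
      (use Ck_on_SucE[OF Suc.prems(1)] Ck_on_SucE[OF Suc.prems(2)] Suc.prems[THEN Ck_on_SucD]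
        in \<open>auto intro!: Suc.IH Ck_on_add[OF S]\<close>)
qed

text \<open>\<open>Ck_on\<close> controls derivatives in fixed directions only. Expanding in
  \<open>Basis\<close> moves a varying argument of a linear map into scalar coefficients, which the
  product rule can handle.\<close>

lemma linear_basis_expansion:
  fixes f :: "'a::euclidean_space \<Rightarrow> 'b::real_vector"
  assumes "linear f"
  shows "f x = (\<Sum>b\<in>Basis. (x \<bullet> b) *\<^sub>R f b)"
proof -
  have "f x = f (\<Sum>b\<in>Basis. (x \<bullet> b) *\<^sub>R b)" by (simp add: euclidean_representation)
  then show ?thesis by (simp add: linear_sum[OF assms] linear_cmul[OF assms])
qed

text \<open>By the chain rule f is differentiated in a direction that varies with x. The basis
  expansion reduces this to fixed directions, where the induction hypothesis for the derivatives of
  f applies.\<close>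

lemma Ck_on_compose:
  fixes f :: "'b::euclidean_space \<Rightarrow> 'c::real_normed_vector" and g :: "'a::euclidean_space \<Rightarrow> 'b"
  assumes S: "open S" and "open T" and gST: "\<And>x. x \<in> S \<Longrightarrow> g x \<in> T"
  shows "Ck_on k T f \<Longrightarrow> Ck_on k S g \<Longrightarrow> Ck_on k S (\<lambda>x. f (g x))"
proof (induction k arbitrary: f)
  case 0
  then show ?case using gST by (auto intro: continuous_on_compose2)
next
  case (Suc k)
  note f = Ck_on_SucE[OF Suc.prems(1)] and g = Ck_on_SucE[OF Suc.prems(2)]
  let ?f' = "\<lambda>x. frechet_derivative f (at x)" and ?g' = "\<lambda>x. frechet_derivative g (at x)"
  have lin: "linear (?f' y)" if "y \<in> T" for y
    using f(1)[OF that] has_derivative_linear by blast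
  have eq: "?f' (g x) (?g' x v) = (\<Sum>b\<in>Basis. (?g' x v \<bullet> b) *\<^sub>R ?f' (g x) b)" if "x \<in> S" for x v
    by (rule linear_basis_expansion[OF lin[OF gST[OF that]]])
  show ?case
  proof (rule Ck_on_SucI[OF S])
    show "((\<lambda>x. f (g x)) has_derivative (\<lambda>v. ?f' (g x) (?g' x v))) (at x)" if "x \<in> S" for x
      using diff_chain_at[OF g(1)[OF that] f(1)[OF gST[OF that]]] by (simp add: o_def)
    fix v
    have "Ck_on k S (\<lambda>x. \<Sum>b\<in>Basis. (?g' x v \<bullet> b) *\<^sub>R ?f' (g x) b)"
      by (intro Ck_on_sum[OF S] Ck_on_bounded_bilinear[OF S bounded_bilinear_scaleR]
          Ck_on_bounded_linear[OF S bounded_linear_inner_left] g Suc.IH f Ck_on_SucD[OF Suc.prems(2)])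
    then show "Ck_on k S (\<lambda>x. ?f' (g x) (?g' x v))"
      by (subst Ck_on_cong[OF S]) (use eq in auto)
  qed
qed

section \<open>Smooth functions on open sets\<close>

lemma smooth_on_cong:
  "open S \<Longrightarrow> (\<And>x. x \<in> S \<Longrightarrow> f x = g x) \<Longrightarrow> smooth_on S f \<longleftrightarrow> smooth_on S g"
  unfolding smooth_on_def by (simp add: Ck_on_cong[of S f g])

lemma smooth_on_subset: "smooth_on S f \<Longrightarrow> T \<subseteq> S \<Longrightarrow> smooth_on T f"
  unfolding smooth_on_def by (auto intro: Ck_on_subset[of _ S])

lemma smooth_on_local:
  assumes "\<And>x. x \<in> S \<Longrightarrow> \<exists>U. open U \<and> x \<in> U \<and> smooth_on U f"
  shows "smooth_on S f"
  unfolding smooth_on_def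
proof (intro allI Ck_on_local)
  fix k x assume "x \<in> S"
  then obtain U where "open U" "x \<in> U" "smooth_on U f" using assms by blast
  then show "\<exists>U. open U \<and> x \<in> U \<and> Ck_on k U f" by (auto simp: smooth_on_def)
qed

lemma smooth_on_const: "open S \<Longrightarrow> smooth_on S (\<lambda>x. c)"
  unfolding smooth_on_def by (simp add: Ck_on_const)

lemma smooth_on_add: "open S \<Longrightarrow> smooth_on S f \<Longrightarrow> smooth_on S g \<Longrightarrow> smooth_on S (\<lambda>x. f x + g x)"
  unfolding smooth_on_def by (simp add: Ck_on_add)

lemma smooth_on_sum:
  "open S \<Longrightarrow> (\<And>i. i \<in> I \<Longrightarrow> smooth_on S (f i)) \<Longrightarrow> smooth_on S (\<lambda>x. \<Sum>i\<in>I. f i x)"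
  unfolding smooth_on_def by (simp add: Ck_on_sum)

lemma smooth_on_bounded_linear:
  "open S \<Longrightarrow> bounded_linear L \<Longrightarrow> smooth_on S f \<Longrightarrow> smooth_on S (\<lambda>x. L (f x))"
  unfolding smooth_on_def by (rule allI, rule Ck_on_bounded_linear[of S L]) auto

lemma smooth_on_bounded_bilinear:
  "open S \<Longrightarrow> bounded_bilinear B \<Longrightarrow> smooth_on S f \<Longrightarrow> smooth_on S g \<Longrightarrow>
    smooth_on S (\<lambda>x. B (f x) (g x))"
  unfolding smooth_on_def by (rule allI, rule Ck_on_bounded_bilinear[of S B]) auto

lemma smooth_on_compose:
  fixes f :: "'b::euclidean_space \<Rightarrow> 'c::real_normed_vector" and g :: "'a::euclidean_space \<Rightarrow> 'b"
  shows "open S \<Longrightarrow> open T \<Longrightarrow> (\<And>x. x \<in> S \<Longrightarrow> g x \<in> T) \<Longrightarrow> smooth_on T f \<Longrightarrow> smooth_on S g \<Longrightarrow>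
    smooth_on S (\<lambda>x. f (g x))"
  unfolding smooth_on_def by (rule allI, rule Ck_on_compose[of S T g]) auto

lemma smooth_on_differentiable: "smooth_on S f \<Longrightarrow> x \<in> S \<Longrightarrow> f differentiable (at x)"
  unfolding smooth_on_def by (drule spec[of _ "Suc 0"]) simp

lemma smooth_on_derivative: "smooth_on S f \<Longrightarrow> smooth_on S (\<lambda>x. frechet_derivative f (at x) v)"
  unfolding smooth_on_def
proof
  fix k assume "\<forall>k. Ck_on k S f"
  then have "Ck_on (Suc k) S f" ..
  then show "Ck_on k S (\<lambda>x. frechet_derivative f (at x) v)" by simp
qed

lemma smooth_on_continuous: "smooth_on S f \<Longrightarrow> continuous_on S f"
  unfolding smooth_on_def by (drule spec[of _ 0]) simp

lemma smooth_on_ident: "open S \<Longrightarrow> smooth_on S (\<lambda>x. x)"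
  unfolding smooth_on_def
proof
  fix k assume S: "open S"
  show "Ck_on k S (\<lambda>x. x)"
  proof (cases k)
    case (Suc j)
    show ?thesis unfolding Suc
      by (rule Ck_on_SucI[OF S has_derivative_ident Ck_on_const[OF S]])
  qed auto
qed

lemma smooth_on_linear_fun: "open S \<Longrightarrow> bounded_linear L \<Longrightarrow> smooth_on S L"
  by (rule smooth_on_bounded_linear[OF _ _ smooth_on_ident])

lemma smooth_on_Pair:
  assumes S: "open S" and "smooth_on S f" "smooth_on S g"
  shows "smooth_on S (\<lambda>x. (f x, g x))"
proof -
  have "bounded_linear (\<lambda>a. (a, 0))" "bounded_linear (\<lambda>b. (0, b))"
    by (auto intro!: bounded_linear_intro[where K=1] simp: norm_Pair)
  from smooth_on_add[OF S smooth_on_bounded_linear[OF S this(1) assms(2)]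
      smooth_on_bounded_linear[OF S this(2) assms(3)]]
  have "smooth_on S (\<lambda>x. (f x, 0) + (0, g x))" .
  then show ?thesis by simp
qed

text \<open>The derivative is a polynomial in the function itself, so the induction hypothesis
  covers it.\<close>

lemma smooth_on_inverse_real: "smooth_on {x::real. x \<noteq> 0} inverse"
  unfolding smooth_on_def
proof
  fix k
  have S: "open {x::real. x \<noteq> 0}" by (simp add: open_Collect_neq)
  show "Ck_on k {x::real. x \<noteq> 0} inverse"
  proof (induction k)
    case 0
    show ?case by (simp add: continuous_on_inverse)
  next
    case (Suc k)
    have "Ck_on k {x::real. x \<noteq> 0} (\<lambda>x. inverse x * v * inverse x)" for v
      by (rule Ck_on_bounded_bilinear[OF S bounded_bilinear_mult
          Ck_on_bounded_bilinear[OF S bounded_bilinear_mult Suc.IH Ck_on_const[OF S]] Suc.IH])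
    note * = Ck_on_bounded_linear[OF S bounded_linear_minus[OF bounded_linear_ident] this]
    show ?case
      by (rule Ck_on_SucI[OF S, where f'="\<lambda>x v. - (inverse x * v * inverse x)"])
        (simp_all add: * has_derivative_inverse')
  qed
qed

text \<open>A product rule for families of linear maps that are differentiable on each fixed vector,
  the form in which the definitions state smoothness of tensor fields. The first term differentiates
  L with Y frozen at x.\<close>

lemma has_derivative_linear_apply:
  fixes L :: "'a::euclidean_space \<Rightarrow> 'b::euclidean_space \<Rightarrow> 'c::real_normed_vector"
  assumes S: "open S" "x \<in> S" and lin: "\<And>y. y \<in> S \<Longrightarrow> linear (L y)"
    and L: "\<And>u. (\<lambda>y. L y u) differentiable (at x)" and Y: "Y differentiable (at x)"
  shows "((\<lambda>y. L y (Y y)) has_derivative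
    (\<lambda>v. frechet_derivative (\<lambda>y. L y (Y x)) (at x) v + L x (frechet_derivative Y (at x) v))) (at x)"
proof -
  let ?L' = "\<lambda>u. frechet_derivative (\<lambda>y. L y u) (at x)" and ?Y' = "frechet_derivative Y (at x)"
  have L': "((\<lambda>y. L y u) has_derivative ?L' u) (at x)" for u
    using L frechet_derivative_works by blast
  have Y': "(Y has_derivative ?Y') (at x)"
    using Y frechet_derivative_works by blast
  have exp: "L y u = (\<Sum>b\<in>Basis. (u \<bullet> b) *\<^sub>R L y b)" if "y \<in> S" for y u
    by (rule linear_basis_expansion[OF lin[OF that]])
  have 1: "((\<lambda>y. \<Sum>b\<in>Basis. (Y y \<bullet> b) *\<^sub>R L y b) has_derivative
      (\<lambda>v. \<Sum>b\<in>Basis. (Y x \<bullet> b) *\<^sub>R ?L' b v + (?Y' v \<bullet> b) *\<^sub>R L x b)) (at x)"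
    by (intro has_derivative_sum has_derivative_scaleR has_derivative_inner_left Y' L')
  have "((\<lambda>y. L y (Y x)) has_derivative (\<lambda>v. \<Sum>b\<in>Basis. (Y x \<bullet> b) *\<^sub>R ?L' b v)) (at x)"
    by (rule has_derivative_transform_within_open[OF _ S exp[symmetric]])
      (intro has_derivative_sum has_derivative_scaleR_right L')
  then have 2: "?L' (Y x) = (\<lambda>v. \<Sum>b\<in>Basis. (Y x \<bullet> b) *\<^sub>R ?L' b v)"
    by (rule frechet_derivative_at[symmetric])
  have "((\<lambda>y. L y (Y y)) has_derivative
      (\<lambda>v. \<Sum>b\<in>Basis. (Y x \<bullet> b) *\<^sub>R ?L' b v + (?Y' v \<bullet> b) *\<^sub>R L x b)) (at x)"
    by (rule has_derivative_transform_within_open[OF 1 S exp[symmetric]])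
  then show ?thesis
    unfolding 2 exp[OF S(2), of "?Y' _"] by (simp add: sum.distrib)
qed

lemma smooth_on_linear_apply:
  fixes L :: "'a::euclidean_space \<Rightarrow> 'b::euclidean_space \<Rightarrow> 'c::real_normed_vector"
  assumes S: "open S" and lin: "\<And>y. y \<in> S \<Longrightarrow> linear (L y)"
    and L: "\<And>u. smooth_on S (\<lambda>y. L y u)" and Y: "smooth_on S Y"
  shows "smooth_on S (\<lambda>y. L y (Y y))"
proof -
  have exp: "L y u = (\<Sum>b\<in>Basis. (u \<bullet> b) *\<^sub>R L y b)" if "y \<in> S" for y u
    by (rule linear_basis_expansion[OF lin[OF that]])
  have "smooth_on S (\<lambda>y. \<Sum>b\<in>Basis. (Y y \<bullet> b) *\<^sub>R L y b)"
    by (intro smooth_on_sum S smooth_on_bounded_bilinear[OF S bounded_bilinear_scaleR]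
        smooth_on_bounded_linear[OF S bounded_linear_inner_left] Y L)
  then show ?thesis by (subst smooth_on_cong[OF S]) (use exp in auto)
qed

text \<open>The mean value theorem, once along u and once along v, turns the second difference over
  a parallelogram into a mixed second derivative at one of its points.\<close>

lemma mixed_difference_quotient:
  fixes f :: "'a::euclidean_space \<Rightarrow> real"
  assumes "t > 0"
    and f: "\<And>r s. 0 \<le> r \<Longrightarrow> r \<le> t \<Longrightarrow> 0 \<le> s \<Longrightarrow> s \<le> t \<Longrightarrow> f differentiable (at (x + r *\<^sub>R u + s *\<^sub>R v))"
    and f': "\<And>r s. 0 \<le> r \<Longrightarrow> r \<le> t \<Longrightarrow> 0 \<le> s \<Longrightarrow> s \<le> t \<Longrightarrow>
       (\<lambda>y. frechet_derivative f (at y) u) differentiable (at (x + r *\<^sub>R u + s *\<^sub>R v))"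
  shows "\<exists>r s. 0 \<le> r \<and> r \<le> t \<and> 0 \<le> s \<and> s \<le> t \<and>
    f (x + t *\<^sub>R u + t *\<^sub>R v) - f (x + t *\<^sub>R u) - f (x + t *\<^sub>R v) + f x =
    t\<^sup>2 * frechet_derivative (\<lambda>y. frechet_derivative f (at y) u) (at (x + r *\<^sub>R u + s *\<^sub>R v)) v"
proof -
  let ?D = "\<lambda>y. frechet_derivative f (at y)"
  let ?D2 = "\<lambda>y. frechet_derivative (\<lambda>y. frechet_derivative f (at y) u) (at y)"
  have d1: "((\<lambda>r. f (x + r *\<^sub>R u + s *\<^sub>R v)) has_derivative (\<lambda>h. ?D (x + r *\<^sub>R u + s *\<^sub>R v) (h *\<^sub>R u))) (at r)"
    if "0 \<le> r" "r \<le> t" "0 \<le> s" "s \<le> t" for r s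
  proof -
    have "((\<lambda>r. x + r *\<^sub>R u + s *\<^sub>R v) has_derivative (\<lambda>h. h *\<^sub>R u)) (at r)"
      by (auto intro!: derivative_eq_intros)
    from diff_chain_at[OF this f[OF that, unfolded frechet_derivative_works]] show ?thesis
      by (simp add: o_def)
  qed
  have d2: "((\<lambda>s. ?D (x + r *\<^sub>R u + s *\<^sub>R v) u) has_derivative (\<lambda>h. ?D2 (x + r *\<^sub>R u + s *\<^sub>R v) (h *\<^sub>R v))) (at s)"
    if "0 \<le> r" "r \<le> t" "0 \<le> s" "s \<le> t" for r s
  proof -
    have "((\<lambda>s. x + r *\<^sub>R u + s *\<^sub>R v) has_derivative (\<lambda>h. h *\<^sub>R v)) (at s)"
      by (auto intro!: derivative_eq_intros)
    from diff_chain_at[OF this f'[OF that, unfolded frechet_derivative_works]] show ?thesis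
      by (simp add: o_def)
  qed
  \<comment> \<open>The increment of f from one side of the parallelogram to the opposite one. The
    summand \<open>0 *\<^sub>R v\<close> keeps the shape required by \<open>d1\<close>.\<close>
  define F where "F r = f (x + r *\<^sub>R u + t *\<^sub>R v) - f (x + r *\<^sub>R u + 0 *\<^sub>R v)" for r
  have dF: "(F has_derivative (\<lambda>h. ?D (x + r *\<^sub>R u + t *\<^sub>R v) (h *\<^sub>R u) - ?D (x + r *\<^sub>R u + 0 *\<^sub>R v) (h *\<^sub>R u))) (at r within {0..t})"
    if "0 \<le> r" "r \<le> t" for r
    unfolding F_def using that \<open>t > 0\<close>
    by (intro has_derivative_diff has_derivative_at_withinI[OF d1]) auto
  obtain r where r: "r \<in> {0<..<t}" and Fr:
    "F t - F 0 = ?D (x + r *\<^sub>R u + t *\<^sub>R v) ((t - 0) *\<^sub>R u) - ?D (x + r *\<^sub>R u + 0 *\<^sub>R v) ((t - 0) *\<^sub>R u)"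
    using mvt_simple[OF \<open>t > 0\<close> dF] by auto
  have r': "0 \<le> r" "r \<le> t" using r by auto
  obtain s where s: "s \<in> {0<..<t}" and Gs: "?D (x + r *\<^sub>R u + t *\<^sub>R v) u - ?D (x + r *\<^sub>R u + 0 *\<^sub>R v) u =
      ?D2 (x + r *\<^sub>R u + s *\<^sub>R v) ((t - 0) *\<^sub>R v)"
    using mvt_simple[OF \<open>t > 0\<close> has_derivative_at_withinI[OF d2[OF r']]] by auto
  have s': "0 \<le> s" "s \<le> t" using s by auto
  have l: "linear (?D (x + r *\<^sub>R u + s *\<^sub>R v))" if "0 \<le> s" "s \<le> t" for s
    by (rule linear_frechet_derivative[OF f[OF r' that]])
  have l2: "linear (?D2 (x + r *\<^sub>R u + s *\<^sub>R v))"
    by (rule linear_frechet_derivative[OF f'[OF r' s']])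
  have "F t - F 0 = t * (?D (x + r *\<^sub>R u + t *\<^sub>R v) u - ?D (x + r *\<^sub>R u + 0 *\<^sub>R v) u)"
    using Fr linear_cmul[OF l[of t], of t u] linear_cmul[OF l[of 0], of t u] \<open>t > 0\<close>
    by (simp add: algebra_simps)
  also have "\<dots> = t\<^sup>2 * ?D2 (x + r *\<^sub>R u + s *\<^sub>R v) v"
    unfolding Gs using linear_cmul[OF l2, of t v] by (simp add: power2_eq_square)
  finally have "F t - F 0 = t\<^sup>2 * ?D2 (x + r *\<^sub>R u + s *\<^sub>R v) v" .
  then have "f (x + t *\<^sub>R u + t *\<^sub>R v) - f (x + t *\<^sub>R u) - f (x + t *\<^sub>R v) + f x =
      t\<^sup>2 * ?D2 (x + r *\<^sub>R u + s *\<^sub>R v) v"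
    by (simp add: F_def)
  then show ?thesis using r' s' by blast
qed

text \<open>Second differences are symmetric in u and v, so the two mixed derivatives take a common
  value at two points arbitrarily near x; continuity carries this to x.\<close>

lemma mixed_partials_commute_real:
  fixes f :: "'a::euclidean_space \<Rightarrow> real"
  assumes S: "open S" "x \<in> S" and f: "smooth_on S f"
  shows "frechet_derivative (\<lambda>y. frechet_derivative f (at y) u) (at x) v =
    frechet_derivative (\<lambda>y. frechet_derivative f (at y) v) (at x) u" (is "?P x = ?Q x")
proof (rule ccontr)
  assume ne: "?P x \<noteq> ?Q x"
  \<comment> \<open>Half the supposed gap: no number lies within e of both mixed derivatives at
    x.\<close>
  define e where "e = \<bar>?P x - ?Q x\<bar> / 2"
  have e: "e > 0" using ne by (simp add: e_def)
  have "isCont ?P x" "isCont ?Q x"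
    using smooth_on_continuous[OF smooth_on_derivative[OF smooth_on_derivative[OF f]]] S
    by (auto simp: continuous_on_eq_continuous_at)
  then obtain d1 d2 where d1: "d1 > 0" "\<And>y. dist y x < d1 \<Longrightarrow> dist (?P y) (?P x) < e"
    and d2: "d2 > 0" "\<And>y. dist y x < d2 \<Longrightarrow> dist (?Q y) (?Q x) < e"
    using e unfolding continuous_at_eps_delta by metis
  obtain d3 where d3: "d3 > 0" "ball x d3 \<subseteq> S" using S open_contains_ball by blast
  define d where "d = min d1 (min d2 d3)"
  have d: "d > 0" "d \<le> d1" "d \<le> d2" "d \<le> d3" using d1 d2 d3 by (auto simp: d_def)
  \<comment> \<open>The parallelogram with sides tu and tv then stays within d/2 of x; the summand 1
    covers u = v = 0.\<close>
  define t where "t = d / (2 * (norm u + norm v + 1))"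
  have t: "t > 0" unfolding t_def using d by (simp add: add_nonneg_pos)
  have tb: "t * (norm u + norm v) < d"
  proof -
    have "t * (norm u + norm v) \<le> t * (norm u + norm v + 1)" using t by simp
    also have "\<dots> = d / 2"
      using add_nonneg_pos[of "norm u + norm v" 1] by (simp add: t_def divide_simps)
    also have "\<dots> < d" using d by simp
    finally show ?thesis .
  qed
  have near: "dist (x + r *\<^sub>R u + s *\<^sub>R v) x < d" if "0 \<le> r" "r \<le> t" "0 \<le> s" "s \<le> t" for r s
  proof -
    have "dist (x + r *\<^sub>R u + s *\<^sub>R v) x = norm (r *\<^sub>R u + s *\<^sub>R v)" by (simp add: dist_norm)
    also have "\<dots> \<le> r * norm u + s * norm v"
      using norm_triangle_ineq[of "r *\<^sub>R u" "s *\<^sub>R v"] that by simp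
    also have "\<dots> \<le> t * (norm u + norm v)"
      using that by (simp add: distrib_left add_mono mult_right_mono)
    finally show ?thesis using tb by simp
  qed
  then have inS: "x + r *\<^sub>R u + s *\<^sub>R v \<in> S" if "0 \<le> r" "r \<le> t" "0 \<le> s" "s \<le> t" for r s
    using that d d3 by (fastforce simp: dist_commute)
  note dif = smooth_on_differentiable[OF f] smooth_on_differentiable[OF smooth_on_derivative[OF f]]
  obtain r s where 1: "0 \<le> r" "r \<le> t" "0 \<le> s" "s \<le> t"
    "f (x + t *\<^sub>R u + t *\<^sub>R v) - f (x + t *\<^sub>R u) - f (x + t *\<^sub>R v) + f x = t\<^sup>2 * ?P (x + r *\<^sub>R u + s *\<^sub>R v)"
    using mixed_difference_quotient[OF t, of f x u v] dif inS by blast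
  have inS': "x + r *\<^sub>R v + s *\<^sub>R u \<in> S" if "0 \<le> r" "r \<le> t" "0 \<le> s" "s \<le> t" for r s
    using inS[of s r] that by (simp add: algebra_simps)
  obtain r' s' where 2: "0 \<le> r'" "r' \<le> t" "0 \<le> s'" "s' \<le> t"
    "f (x + t *\<^sub>R v + t *\<^sub>R u) - f (x + t *\<^sub>R v) - f (x + t *\<^sub>R u) + f x = t\<^sup>2 * ?Q (x + r' *\<^sub>R v + s' *\<^sub>R u)"
    using mixed_difference_quotient[OF t, of f x v u] dif inS' by blast
  have "t\<^sup>2 * ?P (x + r *\<^sub>R u + s *\<^sub>R v) = t\<^sup>2 * ?Q (x + r' *\<^sub>R v + s' *\<^sub>R u)"
    using 1(5) 2(5) by (simp add: algebra_simps)
  then have "?P (x + r *\<^sub>R u + s *\<^sub>R v) = ?Q (x + r' *\<^sub>R v + s' *\<^sub>R u)" using t by simp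
  moreover have "dist (?P (x + r *\<^sub>R u + s *\<^sub>R v)) (?P x) < e"
    using d1 near[OF 1(1-4)] d by auto
  moreover have "dist (?Q (x + r' *\<^sub>R v + s' *\<^sub>R u)) (?Q x) < e"
  proof (rule d2(2))
    have "x + r' *\<^sub>R v + s' *\<^sub>R u = x + s' *\<^sub>R u + r' *\<^sub>R v" by simp
    then show "dist (x + r' *\<^sub>R v + s' *\<^sub>R u) x < d2"
      by (simp only:) (use near[OF 2(3,4,1,2)] d in linarith)
  qed
  moreover have "\<bar>a - p\<bar> < \<bar>p - q\<bar> / 2 \<Longrightarrow> \<bar>a - q\<bar> < \<bar>p - q\<bar> / 2 \<Longrightarrow> False" for a p q :: real
    by (auto simp: abs_if split: if_splits)
  ultimately show False
    unfolding e_def dist_real_def by metis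
qed

lemma mixed_partials_commute:
  fixes f :: "'a::euclidean_space \<Rightarrow> 'b::euclidean_space"
  assumes S: "open S" "x \<in> S" and f: "smooth_on S f"
  shows "frechet_derivative (\<lambda>y. frechet_derivative f (at y) u) (at x) v =
    frechet_derivative (\<lambda>y. frechet_derivative f (at y) v) (at x) u"
proof (rule euclidean_eqI)
  fix b :: 'b
  have d1: "frechet_derivative (\<lambda>y. f y \<bullet> b) (at y) w = frechet_derivative f (at y) w \<bullet> b"
    if "y \<in> S" for y w
    using frechet_derivative_at[OF has_derivative_inner_left[OF
      smooth_on_differentiable[OF f that, unfolded frechet_derivative_works], of b]] by metis
  have d2: "frechet_derivative (\<lambda>y. frechet_derivative (\<lambda>y. f y \<bullet> b) (at y) w) (at x) z =
      frechet_derivative (\<lambda>y. frechet_derivative f (at y) w) (at x) z \<bullet> b" for w z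
  proof -
    have "((\<lambda>y. frechet_derivative (\<lambda>y. f y \<bullet> b) (at y) w) has_derivative
        (\<lambda>z. frechet_derivative (\<lambda>y. frechet_derivative f (at y) w) (at x) z \<bullet> b)) (at x)"
      by (rule has_derivative_transform_within_open[OF has_derivative_inner_left[OF
        smooth_on_differentiable[OF smooth_on_derivative[OF f] S(2), unfolded frechet_derivative_works]] S])
        (simp add: d1)
    from frechet_derivative_at[OF this] show ?thesis by metis
  qed
  have "smooth_on S (\<lambda>y. f y \<bullet> b)"
    by (rule smooth_on_bounded_linear[OF S(1) bounded_linear_inner_left f])
  from mixed_partials_commute_real[OF S this, of u v] show
    "frechet_derivative (\<lambda>y. frechet_derivative f (at y) u) (at x) v \<bullet> b =
     frechet_derivative (\<lambda>y. frechet_derivative f (at y) v) (at x) u \<bullet> b"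
    by (simp add: d2)
qed

section \<open>Calculus in charts\<close>

lemma chart_inv_eq: "is_chart c \<Longrightarrow> p \<in> fst c \<Longrightarrow> chart_inv c (snd c p) = p"
  unfolding is_chart_def by (auto intro: homeomorphism_apply1)

lemma chart_inv_mem: "is_chart c \<Longrightarrow> U \<subseteq> fst c \<Longrightarrow> x \<in> snd c ` U \<Longrightarrow> chart_inv c x \<in> U"
  by (auto simp: subset_iff chart_inv_eq)

lemma chart_image_open:
  assumes c: "is_chart c" and U: "open U" "U \<subseteq> fst c"
  shows "open (snd c ` U)"
proof -
  have "continuous_on (snd c ` fst c) (chart_inv c)" "open (snd c ` fst c)"
    using c unfolding is_chart_def homeomorphism_def by auto
  then have "open (snd c ` fst c \<inter> chart_inv c -` U)"
    using U by (simp add: continuous_on_open_vimage Int_commute)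
  also have "snd c ` fst c \<inter> chart_inv c -` U = snd c ` U"
    using U c by (auto simp: chart_inv_eq subset_iff image_iff)
  finally show ?thesis .
qed

text \<open>Open subsets U of the chart domain are allowed because another chart is smooth in c only
  on the overlap. The side conditions on c and U are built in so that most closure rules carry them
  along.\<close>

definition smooth_in ::
    "('p::topological_space, 'e::euclidean_space) chart \<Rightarrow> 'p set \<Rightarrow> ('p \<Rightarrow> 'b::real_normed_vector) \<Rightarrow> bool" where
  "smooth_in c U F \<longleftrightarrow> is_chart c \<and> open U \<and> U \<subseteq> fst c \<and> smooth_on (snd c ` U) (\<lambda>x. F (chart_inv c x))"

lemma smooth_inD:
  assumes "smooth_in c U F"
  shows "is_chart c" "open U" "U \<subseteq> fst c" "open (snd c ` U)" "smooth_on (snd c ` U) (\<lambda>x. F (chart_inv c x))"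
  using assms chart_image_open[of c U] by (simp_all add: smooth_in_def)

lemma smooth_in_chart_smooth: "is_chart c \<Longrightarrow> smooth_in c (fst c) F \<longleftrightarrow> chart_smooth c F"
  by (auto simp: smooth_in_def chart_smooth_def is_chart_def o_def)

lemma smooth_in_const: "is_chart c \<Longrightarrow> open U \<Longrightarrow> U \<subseteq> fst c \<Longrightarrow> smooth_in c U (\<lambda>q. k)"
  by (simp add: smooth_in_def smooth_on_const chart_image_open)

lemma smooth_in_chart: "is_chart c \<Longrightarrow> open U \<Longrightarrow> U \<subseteq> fst c \<Longrightarrow> smooth_in c U (snd c)"
  unfolding smooth_in_def
  by (subst smooth_on_cong[of _ _ "\<lambda>x. x"])
    (auto simp: smooth_on_ident chart_image_open chart_inv_eq subset_iff)

lemma smooth_in_cong: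
  assumes "\<And>q. q \<in> U \<Longrightarrow> F q = G q"
  shows "smooth_in c U F \<longleftrightarrow> smooth_in c U G"
proof -
  have "smooth_on (snd c ` U) (\<lambda>x. F (chart_inv c x)) = smooth_on (snd c ` U) (\<lambda>x. G (chart_inv c x))"
    if "is_chart c" "open U" "U \<subseteq> fst c"
    by (rule smooth_on_cong) (use that assms in \<open>auto simp: chart_image_open chart_inv_mem\<close>)
  then show ?thesis unfolding smooth_in_def by blast
qed

lemma smooth_in_subset: "smooth_in c U F \<Longrightarrow> open V \<Longrightarrow> V \<subseteq> U \<Longrightarrow> smooth_in c V F"
  unfolding smooth_in_def by (auto intro: smooth_on_subset)

lemma smooth_in_local:
  assumes "is_chart c" "open U" "U \<subseteq> fst c" "\<And>p. p \<in> U \<Longrightarrow> \<exists>V. p \<in> V \<and> smooth_in c V F"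
  shows "smooth_in c U F"
proof -
  have "smooth_on (snd c ` U) (\<lambda>x. F (chart_inv c x))"
  proof (rule smooth_on_local)
    fix x assume "x \<in> snd c ` U"
    then obtain p where p: "p \<in> U" "x = snd c p" by blast
    with assms(4) obtain V where "p \<in> V" "smooth_in c V F" by blast
    then show "\<exists>W. open W \<and> x \<in> W \<and> smooth_on W (\<lambda>x. F (chart_inv c x))"
      using p by (intro exI[of _ "snd c ` V"]) (simp add: smooth_inD(4,5))
  qed
  then show ?thesis using assms by (simp add: smooth_in_def)
qed

lemma smooth_in_add: "smooth_in c U F \<Longrightarrow> smooth_in c U G \<Longrightarrow> smooth_in c U (\<lambda>q. F q + G q)"
  by (simp add: smooth_in_def smooth_on_add chart_image_open)

lemma smooth_in_bounded_linear: "bounded_linear L \<Longrightarrow> smooth_in c U F \<Longrightarrow> smooth_in c U (\<lambda>q. L (F q))"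
  unfolding smooth_in_def using smooth_on_bounded_linear[of "snd c ` U" L "\<lambda>x. F (chart_inv c x)"]
  by (simp add: chart_image_open)

lemma smooth_in_bounded_bilinear:
  "bounded_bilinear B \<Longrightarrow> smooth_in c U F \<Longrightarrow> smooth_in c U G \<Longrightarrow> smooth_in c U (\<lambda>q. B (F q) (G q))"
  unfolding smooth_in_def
  using smooth_on_bounded_bilinear[of "snd c ` U" B "\<lambda>x. F (chart_inv c x)" "\<lambda>x. G (chart_inv c x)"]
  by (simp add: chart_image_open)

lemma smooth_in_uminus: "smooth_in c U F \<Longrightarrow> smooth_in c U (\<lambda>q. - F q)"
  by (rule smooth_in_bounded_linear[OF bounded_linear_minus[OF bounded_linear_ident]])

lemma smooth_in_diff: "smooth_in c U F \<Longrightarrow> smooth_in c U G \<Longrightarrow> smooth_in c U (\<lambda>q. F q - G q)"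
  using smooth_in_add[OF _ smooth_in_uminus] by fastforce

lemmas smooth_in_scaleR = smooth_in_bounded_bilinear[OF bounded_bilinear_scaleR]
lemmas smooth_in_mult = smooth_in_bounded_bilinear[OF bounded_bilinear_mult]
lemmas smooth_in_inner = smooth_in_bounded_bilinear[OF bounded_bilinear_inner]

lemma smooth_in_sum:
  "is_chart c \<Longrightarrow> open U \<Longrightarrow> U \<subseteq> fst c \<Longrightarrow> (\<And>i. i \<in> I \<Longrightarrow> smooth_in c U (F i)) \<Longrightarrow>
    smooth_in c U (\<lambda>q. \<Sum>i\<in>I. F i q)"
  by (simp add: smooth_in_def smooth_on_sum chart_image_open)

lemma smooth_in_compose:
  fixes f :: "'b::euclidean_space \<Rightarrow> 'c::real_normed_vector"
  assumes "open T" "smooth_on T f" "smooth_in c U F" "\<And>q. q \<in> U \<Longrightarrow> F q \<in> T"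
  shows "smooth_in c U (\<lambda>q. f (F q))"
proof -
  note F = smooth_inD[OF assms(3)]
  have "smooth_on (snd c ` U) (\<lambda>x. f (F (chart_inv c x)))"
    by (rule smooth_on_compose[OF F(4) assms(1) _ assms(2) F(5)])
      (use chart_inv_mem[OF F(1,3)] assms(4) in blast)
  then show ?thesis using F by (simp add: smooth_in_def)
qed

lemma smooth_in_divide:
  fixes F G :: "'p::topological_space \<Rightarrow> real"
  assumes "smooth_in c U F" "smooth_in c U G" "\<And>q. q \<in> U \<Longrightarrow> G q \<noteq> 0"
  shows "smooth_in c U (\<lambda>q. F q / G q)"
proof -
  have "smooth_in c U (\<lambda>q. inverse (G q))"
    by (rule smooth_in_compose[OF _ smooth_on_inverse_real assms(2)])
      (use assms(3) in \<open>auto simp: open_Collect_neq\<close>)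
  from smooth_in_mult[OF assms(1) this] show ?thesis by (simp add: divide_inverse)
qed

lemma smooth_in_Pair: "smooth_in c U F \<Longrightarrow> smooth_in c U G \<Longrightarrow> smooth_in c U (\<lambda>q. (F q, G q))"
  by (simp add: smooth_in_def smooth_on_Pair chart_image_open)

lemma smooth_in_linear_apply:
  fixes L :: "'p::topological_space \<Rightarrow> 'a::euclidean_space \<Rightarrow> 'b::real_normed_vector"
  assumes lin: "\<And>q. q \<in> U \<Longrightarrow> linear (L q)"
    and L: "\<And>u. smooth_in c U (\<lambda>q. L q u)" and Y: "smooth_in c U Y"
  shows "smooth_in c U (\<lambda>q. L q (Y q))"
proof -
  note D = smooth_inD[OF Y]
  have "smooth_on (snd c ` U) (\<lambda>x. L (chart_inv c x) (Y (chart_inv c x)))"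
    by (rule smooth_on_linear_apply[OF D(4) _ _ D(5)])
      (use lin chart_inv_mem[OF D(1,3)] smooth_inD(5)[OF L] in auto)
  then show ?thesis using D by (simp add: smooth_in_def)
qed

lemma smooth_in_bilinear_apply:
  fixes B :: "'p::topological_space \<Rightarrow> 'a::euclidean_space \<Rightarrow> 'a'::euclidean_space \<Rightarrow> 'b::real_normed_vector"
  assumes bil: "\<And>q. q \<in> U \<Longrightarrow> bilinear (B q)"
    and B: "\<And>u v. smooth_in c U (\<lambda>q. B q u v)" and Y: "smooth_in c U Y" "smooth_in c U Z"
  shows "smooth_in c U (\<lambda>q. B q (Y q) (Z q))"
proof (rule smooth_in_linear_apply[OF _ _ Y(2)])
  show "linear (B q (Y q))" if "q \<in> U" for q using bil[OF that] by (simp add: bilinear_def)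
  show "smooth_in c U (\<lambda>q. B q (Y q) u)" for u
    by (rule smooth_in_linear_apply[OF _ _ Y(1)]) (use bil B in \<open>auto simp: bilinear_def\<close>)
qed

section \<open>Derivatives in a chart\<close>

lemma smooth_in_has_derivative:
  assumes "smooth_in c U F" "p \<in> U"
  shows "((\<lambda>x. F (chart_inv c x)) has_derivative pd c F p) (at (snd c p))"
proof -
  have "(\<lambda>x. F (chart_inv c x)) differentiable (at (snd c p))"
    using smooth_on_differentiable[OF smooth_inD(5)[OF assms(1)]] assms(2) by blast
  then have "((\<lambda>x. F (chart_inv c x)) has_derivative
      frechet_derivative (\<lambda>x. F (chart_inv c x)) (at (snd c p))) (at (snd c p))"
    using frechet_derivative_works by blast
  also have "frechet_derivative (\<lambda>x. F (chart_inv c x)) (at (snd c p)) = pd c F p"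
    by (auto simp: pd_def o_def)
  finally show ?thesis .
qed

lemma pd_eqI:
  "((\<lambda>x. F (chart_inv c x)) has_derivative D) (at (snd c p)) \<Longrightarrow> pd c F p = D"
  using frechet_derivative_at by (fastforce simp: pd_def o_def)

lemma pd_linear: "smooth_in c U F \<Longrightarrow> p \<in> U \<Longrightarrow> linear (pd c F p)"
  using smooth_in_has_derivative has_derivative_linear by blast

text \<open>A derivative at p depends only on values near p; this is how pointwise identities
  between fields get differentiated.\<close>

lemma pd_cong:
  assumes F: "smooth_in c U F" and p: "p \<in> U" and eq: "\<And>q. q \<in> U \<Longrightarrow> F q = G q"
  shows "pd c G p = pd c F p"
proof (rule pd_eqI)
  show "((\<lambda>x. G (chart_inv c x)) has_derivative pd c F p) (at (snd c p))"
    by (rule has_derivative_transform_within_open[OF smooth_in_has_derivative[OF F p] smooth_inD(4)[OF F]])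
      (use eq p chart_inv_mem[OF smooth_inD(1,3)[OF F]] in auto)
qed

lemma pd_const [simp]: "pd c (\<lambda>q. k) p u = 0"
proof -
  have "pd c (\<lambda>q. k) p = (\<lambda>u. 0)" by (rule pd_eqI) simp
  then show ?thesis by simp
qed

lemma pd_chart:
  assumes "is_chart c" "p \<in> fst c"
  shows "pd c (snd c) p u = u"
proof -
  have "pd c (snd c) p = (\<lambda>u. u)"
    by (rule pd_eqI, rule has_derivative_transform_within_open[OF has_derivative_ident])
      (use assms in \<open>auto simp: chart_inv_eq is_chart_def\<close>)
  then show ?thesis by simp
qed

lemma pd_bounded_linear:
  "bounded_linear L \<Longrightarrow> smooth_in c U F \<Longrightarrow> p \<in> U \<Longrightarrow> pd c (\<lambda>q. L (F q)) p u = L (pd c F p u)"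
proof -
  assume "bounded_linear L" "smooth_in c U F" "p \<in> U"
  then have "pd c (\<lambda>q. L (F q)) p = (\<lambda>u. L (pd c F p u))"
    by (rule pd_eqI[OF bounded_linear.has_derivative[of L, OF _ smooth_in_has_derivative[of c U F]]])
  then show ?thesis by simp
qed

lemma pd_bounded_bilinear:
  assumes B: "bounded_bilinear B" and F: "smooth_in c U F" and G: "smooth_in c U G" and p: "p \<in> U"
  shows "pd c (\<lambda>q. B (F q) (G q)) p u = B (F p) (pd c G p u) + B (pd c F p u) (G p)"
proof -
  have i: "chart_inv c (snd c p) = p" using smooth_inD(1,3)[OF F] p by (auto intro: chart_inv_eq)
  show ?thesis
    using pd_eqI[OF bounded_bilinear.FDERIV[OF B smooth_in_has_derivative[OF F p]
      smooth_in_has_derivative[OF G p]]] i by simp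
qed

lemmas pd_scaleR = pd_bounded_bilinear[OF bounded_bilinear_scaleR]
lemmas pd_mult = pd_bounded_bilinear[OF bounded_bilinear_mult]

lemma pd_uminus: "smooth_in c U F \<Longrightarrow> p \<in> U \<Longrightarrow> pd c (\<lambda>q. - F q) p u = - pd c F p u"
  by (rule pd_bounded_linear[OF bounded_linear_minus[OF bounded_linear_ident]])

lemma pd_add:
  "smooth_in c U F \<Longrightarrow> smooth_in c U G \<Longrightarrow> p \<in> U \<Longrightarrow> pd c (\<lambda>q. F q + G q) p u = pd c F p u + pd c G p u"
proof -
  assume "smooth_in c U F" "smooth_in c U G" "p \<in> U"
  then have "pd c (\<lambda>q. F q + G q) p = (\<lambda>u. pd c F p u + pd c G p u)"
    by (intro pd_eqI has_derivative_add smooth_in_has_derivative[of c U])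
  then show ?thesis by simp
qed

lemma pd_diff:
  "smooth_in c U F \<Longrightarrow> smooth_in c U G \<Longrightarrow> p \<in> U \<Longrightarrow> pd c (\<lambda>q. F q - G q) p u = pd c F p u - pd c G p u"
proof -
  assume "smooth_in c U F" "smooth_in c U G" "p \<in> U"
  then have "pd c (\<lambda>q. F q - G q) p = (\<lambda>u. pd c F p u - pd c G p u)"
    by (intro pd_eqI has_derivative_diff smooth_in_has_derivative[of c U])
  then show ?thesis by simp
qed

lemma pd_Pair:
  "smooth_in c U F \<Longrightarrow> smooth_in c U G \<Longrightarrow> p \<in> U \<Longrightarrow> pd c (\<lambda>q. (F q, G q)) p u = (pd c F p u, pd c G p u)"
proof -
  assume "smooth_in c U F" "smooth_in c U G" "p \<in> U"
  then have "pd c (\<lambda>q. (F q, G q)) p = (\<lambda>u. (pd c F p u, pd c G p u))"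
    by (intro pd_eqI has_derivative_Pair smooth_in_has_derivative[of c U])
  then show ?thesis by simp
qed

lemma pd_linear_apply:
  fixes L :: "'p::topological_space \<Rightarrow> 'a::euclidean_space \<Rightarrow> 'b::real_normed_vector"
  assumes lin: "\<And>q. q \<in> U \<Longrightarrow> linear (L q)"
    and L: "\<And>u. smooth_in c U (\<lambda>q. L q u)" and Y: "smooth_in c U Y" and p: "p \<in> U"
  shows "pd c (\<lambda>q. L q (Y q)) p u = pd c (\<lambda>q. L q (Y p)) p u + L p (pd c Y p u)"
proof -
  note D = smooth_inD[OF Y]
  have i: "chart_inv c (snd c p) = p" using D p by (auto intro: chart_inv_eq)
  have "((\<lambda>x. L (chart_inv c x) (Y (chart_inv c x))) has_derivative
    (\<lambda>v. frechet_derivative (\<lambda>x. L (chart_inv c x) (Y (chart_inv c (snd c p)))) (at (snd c p)) v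
        + L (chart_inv c (snd c p)) (frechet_derivative (\<lambda>x. Y (chart_inv c x)) (at (snd c p)) v)))
    (at (snd c p))"
    by (rule has_derivative_linear_apply[OF D(4)])
      (use p lin chart_inv_mem[OF D(1,3)] smooth_in_has_derivative[OF L p] smooth_in_has_derivative[OF Y p]
        in \<open>auto simp: differentiable_def\<close>)
  from pd_eqI[OF this] show ?thesis unfolding i by (simp add: pd_def o_def)
qed

lemma pd_bilinear_apply:
  fixes B :: "'p::topological_space \<Rightarrow> 'a::euclidean_space \<Rightarrow> 'a'::euclidean_space \<Rightarrow> 'b::real_normed_vector"
  assumes bil: "\<And>q. q \<in> U \<Longrightarrow> bilinear (B q)"
    and B: "\<And>u v. smooth_in c U (\<lambda>q. B q u v)" and Y: "smooth_in c U Y" "smooth_in c U Z" and p: "p \<in> U"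
  shows "pd c (\<lambda>q. B q (Y q) (Z q)) p u =
    pd c (\<lambda>q. B q (Y p) (Z p)) p u + B p (pd c Y p u) (Z p) + B p (Y p) (pd c Z p u)"
proof -
  have l: "\<And>q v. q \<in> U \<Longrightarrow> linear (B q v)" "\<And>q v. q \<in> U \<Longrightarrow> linear (\<lambda>u. B q u v)"
    using bil by (auto simp: bilinear_def)
  have "pd c (\<lambda>q. B q (Y q) (Z q)) p u = pd c (\<lambda>q. B q (Y q) (Z p)) p u + B p (Y p) (pd c Z p u)"
    by (rule pd_linear_apply[OF _ _ Y(2) p, of "\<lambda>q. B q (Y q)"])
      (auto simp: l intro: smooth_in_linear_apply[OF l(2) B Y(1)])
  also have "pd c (\<lambda>q. B q (Y q) (Z p)) p u = pd c (\<lambda>q. B q (Y p) (Z p)) p u + B p (pd c Y p u) (Z p)"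
    by (rule pd_linear_apply[OF l(2) B Y(1) p])
  finally show ?thesis by simp
qed

lemma smooth_in_pd:
  assumes F: "smooth_in c U F"
  shows "smooth_in c U (\<lambda>q. pd c F q u)"
proof -
  note D = smooth_inD[OF F]
  have "smooth_on (snd c ` U) (\<lambda>x. pd c F (chart_inv c x) u)"
  proof (subst smooth_on_cong[OF D(4)])
    show "smooth_on (snd c ` U) (\<lambda>x. frechet_derivative (\<lambda>x. F (chart_inv c x)) (at x) u)"
      by (rule smooth_on_derivative[OF D(5)])
    show "pd c F (chart_inv c x) u = frechet_derivative (\<lambda>x. F (chart_inv c x)) (at x) u"
      if "x \<in> snd c ` U" for x
      using that D(1,3) by (auto simp: pd_def o_def chart_inv_eq subset_iff)
  qed
  then show ?thesis using D by (simp add: smooth_in_def)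
qed

lemma smooth_in_pd_apply:
  "smooth_in c U F \<Longrightarrow> smooth_in c U X \<Longrightarrow> smooth_in c U (\<lambda>q. pd c F q (X q))"
  by (rule smooth_in_linear_apply[OF pd_linear smooth_in_pd])

text \<open>Coordinate directions commute. This is behind the tensoriality of the curvature and the
  symmetry of the second derivative of a coordinate change.\<close>

lemma pd_commute:
  fixes F :: "'p::topological_space \<Rightarrow> 'b::euclidean_space"
  assumes F: "smooth_in c U F" and p: "p \<in> U"
  shows "pd c (\<lambda>q. pd c F q u) p v = pd c (\<lambda>q. pd c F q v) p u"
proof -
  note D = smooth_inD[OF F]
  let ?f = "\<lambda>x. F (chart_inv c x)"
  have *: "pd c (\<lambda>q. pd c F q u) p v = frechet_derivative (\<lambda>y. frechet_derivative ?f (at y) u) (at (snd c p)) v"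
    for u v
  proof -
    have "((\<lambda>x. pd c F (chart_inv c x) u) has_derivative
      frechet_derivative (\<lambda>y. frechet_derivative ?f (at y) u) (at (snd c p))) (at (snd c p))"
      by (rule has_derivative_transform_within_open[OF
        smooth_on_differentiable[OF smooth_on_derivative[OF D(5)], unfolded frechet_derivative_works] D(4)])
        (use p D(1,3) in \<open>auto simp: pd_def o_def chart_inv_eq subset_iff\<close>)
    from pd_eqI[of "\<lambda>q. pd c F q u" c, OF this] show ?thesis by simp
  qed
  show ?thesis unfolding * by (rule mixed_partials_commute[OF D(4) _ D(5)]) (use p in auto)
qed

section \<open>Coordinate changes\<close>

lemma smooth_atlasD:
  assumes "smooth_atlas A" "c \<in> A" "d \<in> A"
  shows "is_chart c" "smooth_in c (fst c \<inter> fst d) (snd d)"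
proof -
  show c: "is_chart c" using assms by (simp add: smooth_atlas_def)
  have "is_chart d" using assms by (simp add: smooth_atlas_def)
  then show "smooth_in c (fst c \<inter> fst d) (snd d)"
    using assms c by (auto simp: smooth_in_def smooth_atlas_def o_def is_chart_def)
qed

text \<open>Read in the chart c, the map \<open>snd d\<close> is the coordinate change; both facts
  are the chain rule for F factored through the coordinates of d.\<close>

lemma smooth_in_change:
  fixes F :: "'p::topological_space \<Rightarrow> 'b::real_normed_vector"
  assumes "smooth_in c U (snd d)" "smooth_in d U F"
  shows "smooth_in c U F" and "p \<in> U \<Longrightarrow> pd c F p u = pd d F p (pd c (snd d) p u)"
proof -
  note C = smooth_inD[OF assms(1)] and D = smooth_inD[OF assms(2)]
  have eq: "F (chart_inv d (snd d (chart_inv c x))) = F (chart_inv c x)" if "x \<in> snd c ` U" for x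
    using chart_inv_mem[OF C(1,3) that] D(1,3) by (simp add: chart_inv_eq subset_iff)
  have "smooth_on (snd c ` U) (\<lambda>x. F (chart_inv d (snd d (chart_inv c x))))"
    by (rule smooth_on_compose[OF C(4) D(4) _ D(5) C(5)]) (use chart_inv_mem[OF C(1,3)] in auto)
  then have "smooth_on (snd c ` U) (\<lambda>x. F (chart_inv c x))"
    by (subst (asm) smooth_on_cong[OF C(4) eq]) auto
  then show "smooth_in c U F" using C by (simp add: smooth_in_def)
  assume p: "p \<in> U"
  then have i: "chart_inv c (snd c p) = p" using C by (auto intro: chart_inv_eq)
  have "((\<lambda>x. F (chart_inv d (snd d (chart_inv c x)))) has_derivative
      (\<lambda>u. pd d F p (pd c (snd d) p u))) (at (snd c p))"
    using diff_chain_at[OF smooth_in_has_derivative[OF assms(1) p], of "\<lambda>x. F (chart_inv d x)" "pd d F p"]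
      smooth_in_has_derivative[OF assms(2) p] by (simp add: i o_def)
  then have "((\<lambda>x. F (chart_inv c x)) has_derivative (\<lambda>u. pd d F p (pd c (snd d) p u))) (at (snd c p))"
    by (rule has_derivative_transform_within_open[OF _ C(4)]) (use p eq in auto)
  then show "pd c F p u = pd d F p (pd c (snd d) p u)"
    using pd_eqI[of F c] by simp
qed

section \<open>Traces\<close>

lemma endo_trace_add: "endo_trace (\<lambda>u. f u + g u) = endo_trace f + endo_trace g"
  by (simp add: endo_trace_def inner_add_left sum.distrib)

lemma endo_trace_diff: "endo_trace (\<lambda>u. f u - g u) = endo_trace f - endo_trace g"
  by (simp add: endo_trace_def inner_diff_left sum_subtractf)

lemma endo_trace_uminus: "endo_trace (\<lambda>u. - f u) = - endo_trace f"
  by (simp add: endo_trace_def sum_negf)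

lemma endo_trace_scaleR: "endo_trace (\<lambda>u. k *\<^sub>R f u) = k * endo_trace f"
  by (simp add: endo_trace_def sum_distrib_left)

lemma endo_trace_ident: "endo_trace (\<lambda>u. u :: 'e::euclidean_space) = real DIM('e)"
  by (simp add: endo_trace_def inner_same_Basis)

lemma endo_trace_rank1:
  assumes "linear l" shows "endo_trace (\<lambda>u. l u *\<^sub>R a) = l a"
  using linear_basis_expansion[OF assms, of a]
  by (simp add: endo_trace_def mult.commute)

lemma endo_trace_comp_commute:
  fixes f g :: "'e::euclidean_space \<Rightarrow> 'e"
  assumes f: "linear f" and g: "linear g"
  shows "endo_trace (\<lambda>u. f (g u)) = endo_trace (\<lambda>u. g (f u))"
proof -
  have *: "endo_trace (\<lambda>u. f (g u)) = (\<Sum>b\<in>Basis. \<Sum>a\<in>Basis. (g b \<bullet> a) * (f a \<bullet> b))"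
    if "linear f" for f g :: "'e \<Rightarrow> 'e"
    unfolding endo_trace_def
    by (subst linear_basis_expansion[OF that]) (simp add: inner_sum_left)
  show ?thesis
    unfolding *[OF f] *[OF g] by (subst sum.swap) (simp add: mult.commute)
qed

text \<open>In finite dimension the left inverse J' is two-sided, so f' is J f J' and the trace may
  be rotated cyclically. In the application J is the Jacobian of a coordinate change.\<close>

lemma endo_trace_conjugate:
  fixes f J :: "'e::euclidean_space \<Rightarrow> 'e"
  assumes f: "linear f" "linear f'" and J: "linear J" "linear J'"
    and JJ: "\<And>u. J' (J u) = u" and fJ: "\<And>u. f' (J u) = J (f u)"
  shows "endo_trace f' = endo_trace f"
proof -
  have "inj J" by (rule injI) (metis JJ)
  then have "surj J" by (rule linear_injective_imp_surjective[OF J(1)]) simp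
  then have JJ2: "J (J' u) = u" for u by (metis JJ surjD)
  have "f' = (\<lambda>u. J (f (J' u)))" by (metis JJ2 fJ)
  then have "endo_trace f' = endo_trace (\<lambda>u. J ((\<lambda>u. f (J' u)) u))" by simp
  also have "\<dots> = endo_trace (\<lambda>u. f (J' (J u)))"
    by (subst endo_trace_comp_commute[OF J(1)]) (auto intro: linear_compose[OF J(2) f(1), unfolded o_def])
  finally show ?thesis by (simp add: JJ)
qed

section \<open>Positive definite symmetric forms\<close>

locale inner_form =
  fixes B :: "'e::euclidean_space \<Rightarrow> 'e \<Rightarrow> real"
  assumes bil: "bilinear B" and sym: "\<And>u v. B u v = B v u" and pos: "\<And>u. u \<noteq> 0 \<Longrightarrow> B u u > 0"
begin

lemmas add_left = bilinear_ladd[OF bil] and add_right = bilinear_radd[OF bil]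
lemmas diff_left = bilinear_lsub[OF bil] and diff_right = bilinear_rsub[OF bil]
lemmas scale_left = bilinear_lmul[OF bil] and scale_right = bilinear_rmul[OF bil]
lemmas minus_left = bilinear_lneg[OF bil] and minus_right = bilinear_rneg[OF bil]
lemmas zero_left = bilinear_lzero[OF bil] and zero_right = bilinear_rzero[OF bil]
lemmas simps = add_left add_right diff_left diff_right scale_left scale_right minus_left minus_right
  zero_left zero_right

lemma linear_left: "linear (\<lambda>u. B u v)" and linear_right: "linear (B u)"
  using bil by (auto simp: bilinear_def)

lemma nondegenerate:
  assumes "\<And>z. B x z = B y z" shows "x = y"
proof -
  have "B (x - y) (x - y) = 0" by (simp add: diff_left assms)
  then show ?thesis using pos[of "x - y"] by force
qed

text \<open>Adjointness refers to B, but \<open>endo_trace\<close> is defined with the standard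
  inner product. The operator T that represents B conjugates f' into the Euclidean adjoint of f,
  which has the same trace as f.\<close>

lemma endo_trace_adjoint:
  assumes f: "linear f" and f': "linear f'" and adj: "\<And>u v. B (f u) v = B u (f' v)"
  shows "endo_trace f = endo_trace f'"
proof -
  define T where "T w = (\<Sum>b\<in>Basis. B w b *\<^sub>R b)" for w
  have BT: "B w z = T w \<bullet> z" for w z
    using linear_basis_expansion[OF linear_right, of w z]
    by (simp add: T_def inner_sum_left mult.commute inner_commute[of z])
  have T: "linear T"
    by (rule linearI) (simp_all add: T_def simps scaleR_add_left sum.distrib scaleR_sum_right)
  have "inj T"
    unfolding linear_injective_0[OF T] using BT pos by (metis inner_zero_left less_irrefl)
  from linear_injective_left_inverse[OF T this] obtain T' where T': "linear T'" "T' \<circ> T = id" by blast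
  have "T (f' v) = adjoint f (T v)" for v
  proof (rule vector_eq_ldot[THEN iffD1], rule allI)
    fix u
    have "u \<bullet> T (f' v) = B u (f' v)" using BT[of "f' v" u] sym by (simp add: inner_commute)
    also have "\<dots> = f u \<bullet> T v" using BT[of v "f u"] sym adj by (simp add: inner_commute)
    also have "\<dots> = u \<bullet> adjoint f (T v)" by (rule adjoint_works[OF f, symmetric])
    finally show "u \<bullet> T (f' v) = u \<bullet> adjoint f (T v)" .
  qed
  then have "endo_trace (adjoint f) = endo_trace f'"
    by (intro endo_trace_conjugate[OF f' adjoint_linear[OF f] T T'(1)])
      (use T'(2) in \<open>auto simp: fun_eq_iff\<close>)
  moreover have "endo_trace (adjoint f) = endo_trace f"
    by (simp add: endo_trace_def inner_commute adjoint_works[OF f])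
  ultimately show ?thesis by simp
qed

lemma endo_trace_skew:
  assumes "linear f" "\<And>u v. B (f u) v = - B u (f v)"
  shows "endo_trace f = 0"
proof -
  have "linear (\<lambda>u. - f u)" using assms(1) by (rule linear_compose_neg)
  from endo_trace_adjoint[OF assms(1) this] have "endo_trace f = endo_trace (\<lambda>u. - f u)"
    by (simp add: assms(2) simps)
  then show ?thesis by (simp add: endo_trace_uminus)
qed

end

section \<open>Smooth frames\<close>

text \<open>Gram-Schmidt on the standard basis without normalisation: only quotients by the positive
  numbers g(e, e) occur, so no square roots have to be smooth. The span clause keeps the next vector
  from vanishing.\<close>

lemma smooth_orthogonal_frame:
  fixes g :: "'p::topological_space \<Rightarrow> 'e::euclidean_space \<Rightarrow> 'e \<Rightarrow> real"
  assumes c: "is_chart c" "open U" "U \<subseteq> fst c" and g: "\<And>q. q \<in> U \<Longrightarrow> inner_form (g q)"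
    and sm: "\<And>u v. smooth_in c U (\<lambda>q. g q u v)"
  shows "finite I \<Longrightarrow> I \<subseteq> Basis \<Longrightarrow> \<exists>e. (\<forall>b\<in>I. smooth_in c U (e b)) \<and> (\<forall>q\<in>U. (\<forall>b\<in>I. e b q \<noteq> 0) \<and>
     (\<forall>a\<in>I. \<forall>b\<in>I. a \<noteq> b \<longrightarrow> g q (e a q) (e b q) = 0) \<and> span ((\<lambda>b. e b q) ` I) = span I)"
proof (induction I rule: finite_induct)
  case empty
  then show ?case by simp
next
  case (insert b I)
  then have "\<exists>e. (\<forall>b\<in>I. smooth_in c U (e b)) \<and> (\<forall>q\<in>U. (\<forall>b\<in>I. e b q \<noteq> 0) \<and>
     (\<forall>a\<in>I. \<forall>b\<in>I. a \<noteq> b \<longrightarrow> g q (e a q) (e b q) = 0) \<and> span ((\<lambda>b. e b q) ` I) = span I)"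
    by simp
  then obtain e where E: "\<forall>b\<in>I. smooth_in c U (e b)" "\<forall>q\<in>U. (\<forall>b\<in>I. e b q \<noteq> 0) \<and>
     (\<forall>a\<in>I. \<forall>b\<in>I. a \<noteq> b \<longrightarrow> g q (e a q) (e b q) = 0) \<and> span ((\<lambda>b. e b q) ` I) = span I"
    by blast
  then have e: "\<And>b. b \<in> I \<Longrightarrow> smooth_in c U (e b)"
    and ne: "\<And>b q. q \<in> U \<Longrightarrow> b \<in> I \<Longrightarrow> e b q \<noteq> 0"
    and orth: "\<And>a b q. q \<in> U \<Longrightarrow> a \<in> I \<Longrightarrow> b \<in> I \<Longrightarrow> a \<noteq> b \<Longrightarrow> g q (e a q) (e b q) = 0"
    and span: "\<And>q. q \<in> U \<Longrightarrow> span ((\<lambda>b. e b q) ` I) = span I"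
    by simp_all
  have gb: "bilinear (g q)" if "q \<in> U" for q using g[OF that] by (simp add: inner_form_def)
  have gpos: "g q (e a q) (e a q) > 0" if "q \<in> U" "a \<in> I" for q a
    using inner_form.pos[OF g] ne that by blast
  \<comment> \<open>The g-orthogonal projection of b to the span of the vectors already
    constructed.\<close>
  define pr where "pr q = (\<Sum>a\<in>I. (g q b (e a q) / g q (e a q) (e a q)) *\<^sub>R e a q)" for q
  define e' where "e' = e(b := (\<lambda>q. b - pr q))"
  have e'I: "e' a = e a" if "a \<in> I" for a using that insert.hyps by (auto simp: e'_def)
  have e'b: "e' b q = b - pr q" for q by (simp add: e'_def)
  have "smooth_in c U pr"
    unfolding pr_def
    by (intro smooth_in_sum[OF c] smooth_in_scaleR smooth_in_divide
        smooth_in_bilinear_apply[OF gb sm] smooth_in_const[OF c] e) (use gpos in force)+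
  then have 1: "smooth_in c U (e' b)"
    using smooth_in_diff[OF smooth_in_const[OF c]] unfolding e'_def by simp
  have pr: "pr q \<in> span I" if "q \<in> U" for q
  proof -
    have "e a q \<in> span I" if "a \<in> I" for a
      unfolding span[OF \<open>q \<in> U\<close>, symmetric] using that by (intro span_base) simp
    then show ?thesis unfolding pr_def by (intro span_sum span_scale)
  qed
  have 2: "e' b q \<noteq> 0" if "q \<in> U" for q
  proof
    assume "e' b q = 0"
    then have "b \<in> span I" using pr[OF that] by (simp add: e'b)
    moreover have "independent (insert b I)"
      using insert.prems independent_Basis independent_mono by blast
    ultimately show False using insert.hyps by (simp add: independent_insert)
  qed
  have 3: "g q (e' b q) (e a q) = 0" if q: "q \<in> U" and a: "a \<in> I" for q a
  proof -
    interpret inner_form "g q" by (rule g[OF q])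
    have "g q (pr q) (e a q) = (\<Sum>a'\<in>I. g q b (e a' q) / g q (e a' q) (e a' q) * g q (e a' q) (e a q))"
      unfolding pr_def by (simp add: linear_sum[OF linear_left] simps)
    also have "\<dots> = (\<Sum>a'\<in>I. if a' = a then g q b (e a q) else 0)"
      using gpos[OF q a] orth[OF q] a by (intro sum.cong) auto
    also have "\<dots> = g q b (e a q)" using insert.hyps a by simp
    finally show ?thesis by (simp add: e'b simps)
  qed
  have 4: "span ((\<lambda>b. e' b q) ` insert b I) = span (insert b I)" if q: "q \<in> U" for q
  proof -
    have "(\<lambda>b. e' b q) ` insert b I = insert (b - pr q) ((\<lambda>b. e b q) ` I)"
      using e'I by (auto simp: e'b)
    also have "span \<dots> = span (insert b ((\<lambda>b. e b q) ` I))"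
      by (rule eq_span_insert_eq) (use pr[OF q] span[OF q] in \<open>simp add: span_neg\<close>)
    also have "\<dots> = span (insert b I)" using span[OF q] by (simp add: span_insert)
    finally show ?thesis .
  qed
  have 5: "g q (e a q) (e' b q) = 0" if q: "q \<in> U" and a: "a \<in> I" for q a
    using 3[OF that] inner_form.sym[OF g[OF q]] by metis
  show ?case
    using 1 2 3 4 5 e ne orth e'I insert.hyps
    by (intro exI[of _ e']) auto
qed

text \<open>Expanding in an orthogonal frame shows that raising an index preserves smoothness.\<close>

lemma smooth_in_riesz:
  fixes g :: "'p::topological_space \<Rightarrow> 'e::euclidean_space \<Rightarrow> 'e \<Rightarrow> real"
  assumes c: "is_chart c" "open U" "U \<subseteq> fst c" and g: "\<And>q. q \<in> U \<Longrightarrow> inner_form (g q)"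
    and sm: "\<And>u v. smooth_in c U (\<lambda>q. g q u v)"
    and f: "\<And>z. smooth_in c U (\<lambda>q. f q z)" and w: "\<And>q z. q \<in> U \<Longrightarrow> g q (w q) z = f q z"
  shows "smooth_in c U w"
proof -
  have "\<exists>e. (\<forall>b\<in>(Basis :: 'e set). smooth_in c U (e b)) \<and> (\<forall>q\<in>U. (\<forall>b\<in>Basis. e b q \<noteq> 0) \<and>
     (\<forall>a\<in>Basis. \<forall>b\<in>Basis. a \<noteq> b \<longrightarrow> g q (e a q) (e b q) = 0) \<and>
       span ((\<lambda>b. e b q) ` Basis) = span (Basis :: 'e set))"
    by (rule smooth_orthogonal_frame[OF c g sm]) simp_all
  then obtain e where E: "\<forall>b\<in>(Basis :: 'e set). smooth_in c U (e b)" "\<forall>q\<in>U. (\<forall>b\<in>Basis. e b q \<noteq> 0) \<and>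
     (\<forall>a\<in>Basis. \<forall>b\<in>Basis. a \<noteq> b \<longrightarrow> g q (e a q) (e b q) = 0) \<and> span ((\<lambda>b. e b q) ` Basis) = span Basis"
    by blast
  then have e: "\<And>b. b \<in> Basis \<Longrightarrow> smooth_in c U (e b)"
    and ne: "\<And>b q. q \<in> U \<Longrightarrow> b \<in> Basis \<Longrightarrow> e b q \<noteq> 0"
    and orth: "\<And>a b q. q \<in> U \<Longrightarrow> a \<in> Basis \<Longrightarrow> b \<in> Basis \<Longrightarrow> a \<noteq> b \<Longrightarrow> g q (e a q) (e b q) = 0"
    and span: "\<And>q. q \<in> U \<Longrightarrow> span ((\<lambda>b. e b q) ` Basis) = UNIV"
    by simp_all
  have gb: "bilinear (g q)" if "q \<in> U" for q using g[OF that] by (simp add: inner_form_def)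
  have fl: "linear (f q)" if "q \<in> U" for q
  proof -
    have "f q = g q (w q)" using w[OF that] by auto
    then show ?thesis using gb[OF that] by (simp add: bilinear_def)
  qed
  define w' where "w' q = (\<Sum>a\<in>Basis. (f q (e a q) / g q (e a q) (e a q)) *\<^sub>R e a q)" for q
  have gpos: "g q (e a q) (e a q) > 0" if "q \<in> U" "a \<in> Basis" for q a
    using inner_form.pos[OF g] ne that by blast
  have "smooth_in c U w'"
    unfolding w'_def
    by (intro smooth_in_sum[OF c] smooth_in_scaleR smooth_in_divide
        smooth_in_bilinear_apply[OF gb sm] smooth_in_linear_apply[OF fl f] e) (use gpos in force)+
  moreover have "w' q = w q" if q: "q \<in> U" for q
  proof -
    interpret inner_form "g q" by (rule g[OF q])
    have 1: "g q (w' q) (e a q) = f q (e a q)" if a: "a \<in> Basis" for a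
    proof -
      have "g q (w' q) (e a q) = (\<Sum>a'\<in>Basis. f q (e a' q) / g q (e a' q) (e a' q) * g q (e a' q) (e a q))"
        unfolding w'_def by (simp add: linear_sum[OF linear_left] simps)
      also have "\<dots> = (\<Sum>a'\<in>Basis. if a' = a then f q (e a q) else 0)"
        using gpos[OF q a] orth[OF q] a by (intro sum.cong) auto
      also have "\<dots> = f q (e a q)" using a by simp
      finally show ?thesis .
    qed
    have "g q (w' q - w q) z = 0" for z
      by (rule linear_eq_0_on_span[OF linear_right, of "(\<lambda>b. e b q) ` Basis"])
        (use span[OF q] 1 w[OF q] in \<open>auto simp: simps\<close>)
    then show ?thesis using nondegenerate[of "w' q - w q" 0] by (simp add: simps)
  qed
  ultimately show ?thesis using smooth_in_cong[of U w' w c] by blast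
qed

section \<open>The Levi-Civita connection and its curvature in a chart\<close>

lemma pd_param_linear:
  fixes L :: "'p::topological_space \<Rightarrow> 'a::euclidean_space \<Rightarrow> 'b::real_normed_vector"
  assumes lin: "\<And>q. q \<in> U \<Longrightarrow> linear (L q)" and L: "\<And>u. smooth_in c U (\<lambda>q. L q u)" and p: "p \<in> U"
  shows "linear (\<lambda>u. pd c (\<lambda>q. L q u) p v)"
proof (rule linearI)
  fix u u' :: 'a and k :: real
  have "pd c (\<lambda>q. L q (u + u')) p = pd c (\<lambda>q. L q u + L q u') p"
    by (rule pd_cong[OF smooth_in_add[OF L L] p]) (simp add: linear_add[OF lin])
  then show "pd c (\<lambda>q. L q (u + u')) p v = pd c (\<lambda>q. L q u) p v + pd c (\<lambda>q. L q u') p v"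
    by (simp add: pd_add[OF L L p])
  have "pd c (\<lambda>q. L q (k *\<^sub>R u)) p = pd c (\<lambda>q. k *\<^sub>R L q u) p"
    by (rule pd_cong[OF smooth_in_bounded_linear[OF bounded_linear_scaleR_right L] p])
      (simp add: linear_cmul[OF lin])
  then show "pd c (\<lambda>q. L q (k *\<^sub>R u)) p v = k *\<^sub>R pd c (\<lambda>q. L q u) p v"
    by (simp add: pd_bounded_linear[OF bounded_linear_scaleR_right L p])
qed

text \<open>The value of \<open>riem\<close> on tangent vectors, computed on coordinate fields, whose brackets vanish.\<close>

definition curvature ::
    "('p, 'e::euclidean_space) bform \<Rightarrow> ('p, 'e) chart \<Rightarrow> 'p \<Rightarrow> 'e \<Rightarrow> 'e \<Rightarrow> 'e \<Rightarrow> 'e" where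
  "curvature g c p u v w =
     pd c (\<lambda>q. christoffel g c q v w) p u - pd c (\<lambda>q. christoffel g c q u w) p v
     + christoffel g c p u (christoffel g c p v w) - christoffel g c p v (christoffel g c p u w)"

definition ricci_form ::
    "('p, 'e::euclidean_space) bform \<Rightarrow> ('p, 'e) chart \<Rightarrow> 'p \<Rightarrow> 'e \<Rightarrow> 'e \<Rightarrow> real" where
  "ricci_form g c p v w = endo_trace (\<lambda>u. curvature g c p u v w)"

definition ricci_endo ::
    "('p, 'e::euclidean_space) bform \<Rightarrow> ('p, 'e) chart \<Rightarrow> 'p \<Rightarrow> 'e \<Rightarrow> 'e" where
  "ricci_endo g c p v = (THE w. \<forall>z. g c p w z = ricci_form g c p v z)"

section \<open>The connection in one chart\<close>

locale riem_chart =
  fixes A :: "('p::{t2_space,second_countable_topology}, 'e::euclidean_space) chart set"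
    and g :: "('p, 'e) bform" and c :: "('p, 'e) chart"
  assumes atlas: "smooth_atlas A" and metric: "riemannian_metric A g" and c_in: "c \<in> A"
begin

abbreviation "\<Gamma> \<equiv> christoffel g c"
abbreviation smooth_c :: "('p \<Rightarrow> 'b::real_normed_vector) \<Rightarrow> bool"
  where "smooth_c \<equiv> smooth_in c (fst c)"

lemma chart: "is_chart c" "open (fst c)"
  using atlas c_in by (auto simp: smooth_atlas_def is_chart_def)

lemma inner_form: "q \<in> fst c \<Longrightarrow> inner_form (g c q)"
  using metric c_in unfolding riemannian_metric_def by unfold_locales blast+

lemma g_bilinear: "q \<in> fst c \<Longrightarrow> bilinear (g c q)"
  using inner_form inner_form.bil by blast

lemma smooth_g: "smooth_c (\<lambda>q. g c q u v)"
  using metric c_in by (simp add: riemannian_metric_def smooth_in_chart_smooth[OF chart(1)])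

lemma smooth_const: "smooth_c (\<lambda>q. k)"
  by (rule smooth_in_const[OF chart order_refl])

lemma christoffel:
  assumes "p \<in> fst c"
  shows "(\<forall>u v. \<Gamma> p u v = \<Gamma> p v u) \<and>
     (\<forall>u v w. pd c (\<lambda>q. g c q v w) p u = g c p (\<Gamma> p u v) w + g c p v (\<Gamma> p u w))"
  unfolding christoffel_def by (rule theI'[OF christoffel_ex1[OF metric atlas c_in assms]])

lemma christoffel_commute: "p \<in> fst c \<Longrightarrow> \<Gamma> p u v = \<Gamma> p v u"
  using christoffel by blast

lemma pd_g: "p \<in> fst c \<Longrightarrow> pd c (\<lambda>q. g c q v w) p u = g c p (\<Gamma> p u v) w + g c p v (\<Gamma> p u w)"
  using christoffel by blast

text \<open>The Koszul formula for coordinate fields: in three permuted instances of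
  \<open>pd_g\<close>, the symmetry of \<Gamma> cancels all but one term. Its right side contains no
  definite description, so linearity and smoothness of \<Gamma> can be read off.\<close>

lemma koszul:
  assumes p: "p \<in> fst c"
  shows "g c p (\<Gamma> p u v) z = (pd c (\<lambda>q. g c q v z) p u + pd c (\<lambda>q. g c q u z) p v - pd c (\<lambda>q. g c q u v) p z) / 2"
  unfolding pd_g[OF p] christoffel_commute[OF p, of v u] christoffel_commute[OF p, of z u]
    christoffel_commute[OF p, of z v]
  using inner_form.sym[OF inner_form[OF p], of v "\<Gamma> p u z"] by simp

lemma christoffel_bilinear:
  assumes p: "p \<in> fst c"
  shows "bilinear (\<Gamma> p)"
proof -
  interpret inner_form "g c p" by (rule inner_form[OF p])
  have l: "linear (\<lambda>u. pd c (\<lambda>q. g c q u v) p w)" for v w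
    by (rule pd_param_linear[OF _ smooth_g p]) (use g_bilinear in \<open>simp add: bilinear_def\<close>)
  have r: "linear (\<lambda>v. pd c (\<lambda>q. g c q u v) p w)" for u w
    by (rule pd_param_linear[OF _ smooth_g p]) (use g_bilinear in \<open>simp add: bilinear_def\<close>)
  note lin = l r pd_linear[OF smooth_g p]
  have L: "linear (\<lambda>u. \<Gamma> p u v)" for v
    by (rule linearI; rule nondegenerate)
      (simp_all add: simps koszul[OF p] lin[THEN linear_add] lin[THEN linear_cmul] field_simps)
  then have "linear (\<Gamma> p u)" for u
  proof -
    have "\<Gamma> p u = (\<lambda>v. \<Gamma> p v u)" using christoffel_commute[OF p] by blast
    with L show ?thesis by simp
  qed
  with L show ?thesis by (simp add: bilinear_def)
qed

text \<open>The Koszul formula shows that the pairings with fixed vectors are smooth; raising the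
  index gives \<Gamma> itself.\<close>

lemma smooth_christoffel: "smooth_c (\<lambda>q. \<Gamma> q u v)"
proof (rule smooth_in_riesz[OF chart order_refl inner_form smooth_g])
  show "smooth_c (\<lambda>q. (1/2) *\<^sub>R (pd c (\<lambda>q. g c q v z) q u + pd c (\<lambda>q. g c q u z) q v - pd c (\<lambda>q. g c q u v) q z))" for z
    by (rule smooth_in_scaleR[OF smooth_const smooth_in_diff[OF smooth_in_add]]; rule smooth_in_pd[OF smooth_g])
qed (auto simp: koszul)

end

section \<open>Symmetries of the curvature at a point\<close>

locale riem_point = riem_chart A g c
  for A :: "('p::{t2_space,second_countable_topology}, 'e::euclidean_space) chart set" and g c +
  fixes p :: 'p
  assumes p_in: "p \<in> fst c"
begin

sublocale inner_form "g c p" by (rule inner_form[OF p_in])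

abbreviation "R \<equiv> curvature g c p"

lemmas \<Gamma>_bil = christoffel_bilinear[OF p_in]
lemmas \<Gamma>_simps = bilinear_ladd[OF \<Gamma>_bil] bilinear_radd[OF \<Gamma>_bil] bilinear_lsub[OF \<Gamma>_bil] bilinear_rsub[OF \<Gamma>_bil]
  bilinear_lmul[OF \<Gamma>_bil] bilinear_rmul[OF \<Gamma>_bil] bilinear_lneg[OF \<Gamma>_bil] bilinear_rneg[OF \<Gamma>_bil]
  bilinear_lzero[OF \<Gamma>_bil] bilinear_rzero[OF \<Gamma>_bil]

lemma pd_christoffel_linear:
  "linear (\<lambda>u. pd c (\<lambda>q. \<Gamma> q u v) p w)" "linear (\<lambda>v. pd c (\<lambda>q. \<Gamma> q u v) p w)"
  "linear (pd c (\<lambda>q. \<Gamma> q u v) p)"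
  by (rule pd_param_linear[OF _ smooth_christoffel p_in], use christoffel_bilinear in \<open>simp add: bilinear_def\<close>)+
    (rule pd_linear[OF smooth_christoffel p_in])

lemmas pd\<Gamma>_simps = pd_christoffel_linear[THEN linear_add] pd_christoffel_linear[THEN linear_cmul]

lemma curvature_linear: "linear (\<lambda>u. R u v w)" "linear (\<lambda>v. R u v w)" "linear (R u v)"
  by (rule linearI; simp add: curvature_def \<Gamma>_simps pd\<Gamma>_simps algebra_simps)+

lemma curvature_skew: "R u v w = - R v u w"
  by (simp add: curvature_def)

lemma bianchi: "R u v w + R v w u + R w u v = 0"
proof -
  have "pd c (\<lambda>q. \<Gamma> q v w) p u = pd c (\<lambda>q. \<Gamma> q w v) p u" for u v w
    by (rule pd_cong[OF smooth_christoffel p_in, THEN fun_cong]) (rule christoffel_commute)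
  then show ?thesis
    using christoffel_commute[OF p_in, of u v] christoffel_commute[OF p_in, of w v]
      christoffel_commute[OF p_in, of u w]
    by (simp add: curvature_def)
qed

lemma pd_g_\<Gamma>:
  "pd c (\<lambda>q. g c q (\<Gamma> q v w) z) p u =
    g c p (\<Gamma> p u (\<Gamma> p v w)) z + g c p (\<Gamma> p v w) (\<Gamma> p u z) + g c p (pd c (\<lambda>q. \<Gamma> q v w) p u) z"
  by (subst pd_bilinear_apply[OF g_bilinear smooth_g smooth_christoffel smooth_const p_in])
    (simp_all add: pd_g[OF p_in] simps)

text \<open>Differentiate g(w, z) along v and then along u, using metricity twice, and exchange u
  and v. The terms with one \<Gamma> on each of w and z cancel, and the rest is the curvature acting
  on w and on z.\<close>

lemma curvature_metric: "g c p (R u v w) z = - g c p w (R u v z)"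
proof -
  have *: "pd c (\<lambda>q. pd c (\<lambda>q. g c q w z) q v) p u =
    pd c (\<lambda>q. g c q (\<Gamma> q v w) z) p u + pd c (\<lambda>q. g c q (\<Gamma> q v z) w) p u" for u v
  proof -
    have 1: "smooth_c (\<lambda>q. g c q (\<Gamma> q v w) z)" for v w z
      by (rule smooth_in_bilinear_apply[OF g_bilinear smooth_g smooth_christoffel smooth_const])
    have "pd c (\<lambda>q. pd c (\<lambda>q. g c q w z) q v) p = pd c (\<lambda>q. g c q (\<Gamma> q v w) z + g c q (\<Gamma> q v z) w) p"
      by (rule pd_cong[OF smooth_in_add[OF 1 1] p_in])
        (simp add: pd_g inner_form.sym[OF inner_form])
    then show ?thesis by (simp add: pd_add[OF 1 1 p_in])
  qed
  have "pd c (\<lambda>q. pd c (\<lambda>q. g c q w z) q v) p u = pd c (\<lambda>q. pd c (\<lambda>q. g c q w z) q u) p v"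
    by (rule pd_commute[OF smooth_g p_in])
  then show ?thesis
    unfolding * pd_g_\<Gamma> curvature_def simps
    using sym by (simp add: algebra_simps)
qed

text \<open>The octahedron argument: four instances of the Bianchi identity, combined through skew
  symmetry in the first and in the last pair of arguments.\<close>

lemma curvature_pair: "g c p (R u v w) z = g c p (R w z u) v"
proof -
  let ?K = "\<lambda>u v w z. g c p (R u v w) z"
  have s: "?K u v w z = - ?K v u w z" for u v w z by (subst curvature_skew) (simp add: simps)
  have m: "?K u v w z = - ?K u v z w" for u v w z 
    using curvature_metric[of u v w z] sym[of w "R u v z"] by simp
  have b: "?K u v w z + ?K v w u z + ?K w u v z = 0" for u v w z
    using bianchi[of u v w] by (simp flip: add_left add: zero_left)
  show ?thesis
    using b[of u v w z] b[of v w z u] b[of w z u v] b[of z u v w]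
      s[of u v w z] s[of v w u z] s[of w u v z] s[of v w z u] s[of w z v u] s[of z v w u]
      s[of w z u v] s[of z u w v] s[of u w z v] s[of z u v w] s[of u v z w] s[of v z u w]
      m[of u v w z] m[of v w u z] m[of w u v z] m[of v w z u] m[of w z v u] m[of z v w u]
      m[of w z u v] m[of z u w v] m[of u w z v] m[of z u v w] m[of u v z w] m[of v z u w]
    by linarith
qed

text \<open>All derivatives of the fields cancel: the second derivatives of Z by symmetry, those of
  X and Y against the bracket term. So the curvature sees only the values at p.\<close>

lemma riem_eq_curvature:
  assumes X: "smooth_c (X c)" and Y: "smooth_c (Y c)" and Z: "smooth_c (Z c)"
  shows "riem g X Y Z c p = R (X c p) (Y c p) (Z c p)"
proof -
  have cov2: "cov g X (cov g Y Z) c p =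
      pd c (\<lambda>q. pd c (Z c) q (Y c p)) p (X c p) + pd c (Z c) p (pd c (Y c) p (X c p))
      + (pd c (\<lambda>q. \<Gamma> q (Y c p) (Z c p)) p (X c p) + \<Gamma> p (pd c (Y c) p (X c p)) (Z c p) + \<Gamma> p (Y c p) (pd c (Z c) p (X c p)))
      + \<Gamma> p (X c p) (pd c (Z c) p (Y c p) + \<Gamma> p (Y c p) (Z c p))"
    if Y: "smooth_c (Y c)" for X Y
  proof -
    have "pd c (\<lambda>q. pd c (Z c) q (Y c q) + \<Gamma> q (Y c q) (Z c q)) p (X c p) =
      pd c (\<lambda>q. pd c (Z c) q (Y c q)) p (X c p) + pd c (\<lambda>q. \<Gamma> q (Y c q) (Z c q)) p (X c p)"
      by (rule pd_add[OF smooth_in_pd_apply[OF Z Y]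
        smooth_in_bilinear_apply[OF christoffel_bilinear smooth_christoffel Y Z] p_in])
    then show ?thesis
      unfolding cov_def
      by (simp add: pd_linear_apply[OF pd_linear[OF Z] smooth_in_pd[OF Z] Y p_in]
        pd_bilinear_apply[OF christoffel_bilinear smooth_christoffel Y Z p_in])
  qed
  show ?thesis
    unfolding riem_def cov2[of Y X, OF Y] cov2[of X Y, OF X]
    using pd_commute[OF Z p_in, of "X c p" "Y c p"]
    by (simp add: cov_def bracket_def curvature_def \<Gamma>_simps linear_diff[OF pd_linear[OF Z p_in]])
qed

lemma ric_eq_ricci_form:
  assumes "smooth_c (Y c)" "smooth_c (Z c)"
  shows "ric g Y Z c p = ricci_form g c p (Y c p) (Z c p)"
proof -
  have "riem g (coord_field u) Y Z c p = R u (Y c p) (Z c p)" for u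
    using riem_eq_curvature[of "coord_field u" Y Z] assms smooth_const[of u] by (simp add: coord_field_def)
  then show ?thesis by (simp add: ric_def ricci_form_def)
qed

text \<open>By pair symmetry, exchanging v and w replaces the map under the trace by its
  g-adjoint.\<close>

lemma ricci_form_commute: "ricci_form g c p v w = ricci_form g c p w v"
  unfolding ricci_form_def
proof (rule endo_trace_adjoint[OF curvature_linear(1) curvature_linear(1)])
  fix x y
  have "g c p (R x v w) y = g c p (R w y x) v" by (rule curvature_pair)
  also have "\<dots> = g c p x (R y w v)"
    by (subst curvature_metric) (simp add: curvature_skew[of w y] simps)
  finally show "g c p (R x v w) y = g c p x (R y w v)" .
qed

lemma ricci_form_linear: "linear (\<lambda>v. ricci_form g c p v w)" "linear (ricci_form g c p v)"
  unfolding ricci_form_def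
  by (rule linearI; simp add: curvature_linear[THEN linear_add] curvature_linear[THEN linear_cmul]
      endo_trace_add endo_trace_scaleR)+

lemma ricci_endo: "g c p (ricci_endo g c p v) z = ricci_form g c p v z"
  unfolding ricci_endo_def
  using theI'[OF pos_form_represents[OF bil pos ricci_form_linear(2)]] by blast

lemma ricci_endo_eqI: "(\<And>z. g c p w z = ricci_form g c p v z) \<Longrightarrow> ricci_endo g c p v = w"
  by (rule nondegenerate) (simp add: ricci_endo)

lemma ricci_endo_linear: "linear (ricci_endo g c p)"
  by (rule linearI; rule nondegenerate)
    (simp_all add: simps ricci_endo ricci_form_linear(1)[THEN linear_add] ricci_form_linear(1)[THEN linear_cmul])

lemma ricci_op_eq:
  assumes "smooth_c (X c)"
  shows "ricci_op g X c p = ricci_endo g c p (X c p)"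
proof -
  have "ric g X (coord_field v) c p = ricci_form g c p (X c p) v" for v
    using ric_eq_ricci_form[of X "coord_field v"] assms smooth_const[of v] by (simp add: coord_field_def)
  then show ?thesis by (simp add: ricci_op_def ricci_endo_def)
qed

lemma scal_eq: "scal g c p = endo_trace (ricci_endo g c p)"
proof -
  have "ricci_op g (coord_field u) c p = ricci_endo g c p u" for u
    using ricci_op_eq[of "coord_field u"] smooth_const[of u] by (simp add: coord_field_def)
  then show ?thesis by (simp add: scal_def)
qed

end

section \<open>Smoothness of the curvature tensors\<close>

context riem_chart
begin

lemma smooth_curvature: "smooth_c (\<lambda>q. curvature g c q u v w)"
  unfolding curvature_def
  by (intro smooth_in_add smooth_in_diff smooth_in_pd smooth_christoffel
      smooth_in_bilinear_apply[OF christoffel_bilinear smooth_christoffel smooth_const smooth_christoffel])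

lemma smooth_ricci_form: "smooth_c (\<lambda>q. ricci_form g c q v w)"
  unfolding ricci_form_def endo_trace_def
  by (rule smooth_in_sum[OF chart order_refl]) (rule smooth_in_inner[OF smooth_curvature smooth_const])

lemma smooth_scal: "smooth_c (scal g c)"
proof -
  have rp: "riem_point A g c q" if "q \<in> fst c" for q using that by unfold_locales
  have "smooth_c (\<lambda>q. ricci_endo g c q v)" for v
    by (rule smooth_in_riesz[OF chart order_refl inner_form smooth_g smooth_ricci_form[of v]])
      (simp_all add: riem_point.ricci_endo[OF rp])
  then have "smooth_c (\<lambda>q. endo_trace (ricci_endo g c q))"
    unfolding endo_trace_def
    by (intro smooth_in_sum[OF chart order_refl] smooth_in_inner smooth_const)
  then show ?thesis
    using smooth_in_cong[of "fst c" "scal g c" "\<lambda>q. endo_trace (ricci_endo g c q)" c] riem_point.scal_eq[OF rp]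
    by simp
qed

end

section \<open>K-contact structures at a point\<close>

context riem_point
begin

text \<open>The counterpart of \<open>weyl\<close> for single tangent vectors, on which the algebra
  of the Weyl conditions is carried out.\<close>

definition weyl_tensor :: "'e \<Rightarrow> 'e \<Rightarrow> 'e \<Rightarrow> 'e" where
  "weyl_tensor u v w = (let n = real DIM('e); Q = ricci_endo g c p in R u v w
     + (1 / (n - 2)) *\<^sub>R (ricci_form g c p u w *\<^sub>R v - ricci_form g c p v w *\<^sub>R u
         + g c p u w *\<^sub>R Q v - g c p v w *\<^sub>R Q u)
     - (scal g c p / ((n - 1) * (n - 2))) *\<^sub>R (g c p u w *\<^sub>R v - g c p v w *\<^sub>R u))"

lemma weyl_eq_weyl_tensor:
  assumes "smooth_c (X c)" "smooth_c (Y c)" "smooth_c (Z c)"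
  shows "weyl g X Y Z c p = weyl_tensor (X c p) (Y c p) (Z c p)"
  using assms
  by (simp add: weyl_def weyl_tensor_def Let_def riem_eq_curvature ric_eq_ricci_form ricci_op_eq)

end

text \<open>The structure in one chart, as pointwise identities with \<eta> written as g(\<xi>, .)
  throughout. The last assumption is \<nabla>\<xi> = - \<phi>; it is where the Killing condition and
  the formula for d\<eta> have been absorbed.\<close>

locale k_contact_chart = riem_chart A g c
  for A :: "('p::{t2_space,second_countable_topology}, 'e::euclidean_space) chart set" and g c +
  fixes m :: nat and \<phi> :: "('p, 'e) endo" and \<xi> :: "('p, 'e) vfield"
  assumes dim: "DIM('e) = 2 * m + 1"
    and smooth_\<xi>: "smooth_c (\<xi> c)"
    and smooth_\<phi>: "smooth_c (\<lambda>q. \<phi> c q u)"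
    and \<phi>_linear: "q \<in> fst c \<Longrightarrow> linear (\<phi> c q)"
    and \<xi>_unit: "q \<in> fst c \<Longrightarrow> g c q (\<xi> c q) (\<xi> c q) = 1"
    and \<phi>_\<phi>: "q \<in> fst c \<Longrightarrow> \<phi> c q (\<phi> c q u) = - u + g c q (\<xi> c q) u *\<^sub>R \<xi> c q"
    and \<phi>_skew: "q \<in> fst c \<Longrightarrow> g c q (\<phi> c q u) v = - g c q u (\<phi> c q v)"
    and \<phi>_\<xi>: "q \<in> fst c \<Longrightarrow> \<phi> c q (\<xi> c q) = 0"
    and nabla_\<xi>: "q \<in> fst c \<Longrightarrow> pd c (\<xi> c) q u + christoffel g c q u (\<xi> c q) = - \<phi> c q u"

locale k_contact_point = k_contact_chart A g c m \<phi> \<xi> + riem_point A g c p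
  for A :: "('p::{t2_space,second_countable_topology}, 'e::euclidean_space) chart set"
    and g c m \<phi> \<xi> and p :: 'p
begin

abbreviation "G \<equiv> g c p"
abbreviation "x \<equiv> \<xi> c p"
abbreviation "F \<equiv> \<phi> c p"
abbreviation "Ric \<equiv> ricci_form g c p"
abbreviation "Q \<equiv> ricci_endo g c p"

text \<open>\<open>N u v\<close> is \<open>(\<nabla>\<^sub>u \<phi>) v\<close>.\<close>

definition N :: "'e \<Rightarrow> 'e \<Rightarrow> 'e" where
  "N u v = pd c (\<lambda>q. \<phi> c q v) p u + \<Gamma> p u (F v) - F (\<Gamma> p u v)"

lemmas F_lin = \<phi>_linear[OF p_in]
lemmas F_simps = linear_add[OF F_lin] linear_diff[OF F_lin] linear_cmul[OF F_lin] linear_neg[OF F_lin] linear_0[OF F_lin]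
lemmas FF = \<phi>_\<phi>[OF p_in] and F_skew = \<phi>_skew[OF p_in] and F_x = \<phi>_\<xi>[OF p_in] and x_unit = \<xi>_unit[OF p_in]

section \<open>Identities for \<nabla>\<phi>\<close>

lemma pd_\<xi>: "q \<in> fst c \<Longrightarrow> pd c (\<xi> c) q u = - \<phi> c q u - \<Gamma> q u (\<xi> c q)"
  using nabla_\<xi>[of q u] by (simp add: algebra_simps eq_neg_iff_add_eq_0)

lemma pd_\<phi>_linear: "linear (\<lambda>v. pd c (\<lambda>q. \<phi> c q v) p u)" "linear (pd c (\<lambda>q. \<phi> c q v) p)"
  by (rule pd_param_linear[OF \<phi>_linear smooth_\<phi> p_in], assumption) (rule pd_linear[OF smooth_\<phi> p_in])

lemma N_linear: "linear (N u)" "linear (\<lambda>u. N u v)"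
  by (rule linearI; simp add: N_def F_simps \<Gamma>_simps pd_\<phi>_linear[THEN linear_add] pd_\<phi>_linear[THEN linear_cmul]
      algebra_simps)+

lemma G_x_F: "G x (F v) = 0" "G (F v) x = 0"
  using F_skew[of x v] by (simp_all add: F_x simps F_skew)

text \<open>Differentiate \<nabla>\<xi> = - \<phi> once more and antisymmetrise: the \<Gamma>-terms
  assemble to the curvature on one side and to \<nabla>\<phi> on the other.\<close>

lemma curvature_\<xi>: "R u v x = N v u - N u v"
proof -
  have *: "pd c (\<lambda>q. pd c (\<xi> c) q v) p u =
      - pd c (\<lambda>q. \<phi> c q v) p u - (pd c (\<lambda>q. \<Gamma> q v x) p u + \<Gamma> p v (- F u - \<Gamma> p u x))" for u v
  proof -
    have l: "linear (\<Gamma> q v)" if "q \<in> fst c" for q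
      using christoffel_bilinear[OF that] by (simp add: bilinear_def)
    have s: "smooth_c (\<lambda>q. \<Gamma> q v (\<xi> c q))"
      by (rule smooth_in_linear_apply[OF l smooth_christoffel smooth_\<xi>])
    have "pd c (\<lambda>q. pd c (\<xi> c) q v) p = pd c (\<lambda>q. - \<phi> c q v - \<Gamma> q v (\<xi> c q)) p"
      by (rule pd_cong[OF smooth_in_diff[OF smooth_in_uminus[OF smooth_\<phi>] s] p_in]) (simp add: pd_\<xi>)
    then show ?thesis
      by (simp add: pd_diff[OF smooth_in_uminus[OF smooth_\<phi>] s p_in] pd_uminus[OF smooth_\<phi> p_in]
        pd_linear_apply[OF l smooth_christoffel smooth_\<xi> p_in] pd_\<xi>[OF p_in])
  qed
  have "pd c (\<lambda>q. pd c (\<xi> c) q v) p u = pd c (\<lambda>q. pd c (\<xi> c) q u) p v"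
    by (rule pd_commute[OF smooth_\<xi> p_in])
  then show ?thesis
    unfolding * curvature_def N_def by (simp add: \<Gamma>_simps christoffel_commute[OF p_in, of v u] algebra_simps)
qed

text \<open>The covariant derivative of the skewness of \<phi>, with g parallel.\<close>

lemma N_skew: "G (N u v) w = - G v (N u w)"
proof -
  have 1: "pd c (\<lambda>q. g c q (\<phi> c q v) w) p u =
      G (\<Gamma> p u (F v)) w + G (F v) (\<Gamma> p u w) + G (pd c (\<lambda>q. \<phi> c q v) p u) w" for v w
    by (subst pd_bilinear_apply[OF g_bilinear smooth_g smooth_\<phi> smooth_const p_in])
      (simp_all add: pd_g[OF p_in] simps)
  have s: "smooth_c (\<lambda>q. g c q (\<phi> c q v) w)" for v w
    by (rule smooth_in_bilinear_apply[OF g_bilinear smooth_g smooth_\<phi> smooth_const])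
  have "pd c (\<lambda>q. g c q (\<phi> c q v) w) p u = pd c (\<lambda>q. - g c q (\<phi> c q w) v) p u"
  proof (rule pd_cong[OF smooth_in_uminus[OF s] p_in, THEN fun_cong])
    fix q assume "q \<in> fst c"
    then show "- g c q (\<phi> c q w) v = g c q (\<phi> c q v) w"
      using \<phi>_skew[of q w v] inner_form.sym[OF inner_form, of q w "\<phi> c q v"] by simp
  qed
  then have "pd c (\<lambda>q. g c q (\<phi> c q v) w) p u = - pd c (\<lambda>q. g c q (\<phi> c q w) v) p u"
    by (simp add: pd_uminus[OF s p_in])
  then show ?thesis
    unfolding 1 N_def simps
    using F_skew[of v "\<Gamma> p u w"] F_skew[of w "\<Gamma> p u v"] sym[of v "pd c (\<lambda>q. \<phi> c q w) p u"]
      sym[of v "\<Gamma> p u (F w)"] sym[of w "F (\<Gamma> p u v)"] by linarith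
qed

text \<open>The covariant derivative of the formula for \<phi>^2, with \<nabla>\<xi> = - \<phi>
  inserted on the right.\<close>

lemma N_F: "N u (F v) + F (N u v) = - G (F u) v *\<^sub>R x - G x v *\<^sub>R F u"
proof -
  have s: "smooth_c (\<lambda>q. g c q (\<xi> c q) v)"
    by (rule smooth_in_bilinear_apply[OF g_bilinear smooth_g smooth_\<xi> smooth_const])
  have s2: "smooth_c (\<lambda>q. g c q (\<xi> c q) v *\<^sub>R \<xi> c q - v)"
    by (rule smooth_in_diff[OF smooth_in_scaleR[OF s smooth_\<xi>] smooth_const])
  have 1: "pd c (\<lambda>q. g c q (\<xi> c q) v) p u = - G (F u) v + G x (\<Gamma> p u v)"
    by (subst pd_bilinear_apply[OF g_bilinear smooth_g smooth_\<xi> smooth_const p_in])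
      (simp_all add: pd_g[OF p_in] simps pd_\<xi>[OF p_in])
  have "pd c (\<lambda>q. \<phi> c q (\<phi> c q v)) p u = pd c (\<lambda>q. g c q (\<xi> c q) v *\<^sub>R \<xi> c q - v) p u"
    by (rule pd_cong[OF s2 p_in, THEN fun_cong]) (simp add: \<phi>_\<phi>)
  also have "\<dots> = G x v *\<^sub>R (- F u - \<Gamma> p u x) + (- G (F u) v + G x (\<Gamma> p u v)) *\<^sub>R x"
    by (simp add: pd_diff[OF smooth_in_scaleR[OF s smooth_\<xi>] smooth_const p_in] pd_scaleR[OF s smooth_\<xi> p_in]
        1 pd_\<xi>[OF p_in])
  finally have "pd c (\<lambda>q. \<phi> c q (F v)) p u + F (pd c (\<lambda>q. \<phi> c q v) p u) =
      G x v *\<^sub>R (- F u - \<Gamma> p u x) + (- G (F u) v + G x (\<Gamma> p u v)) *\<^sub>R x"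
    by (simp add: pd_linear_apply[OF \<phi>_linear smooth_\<phi> smooth_\<phi> p_in])
  then show ?thesis
    unfolding N_def F_simps FF \<Gamma>_simps by (simp add: algebra_simps)
qed

text \<open>Differentiating \<phi>\<xi> = 0 expresses the left side as \<phi>(\<phi> u).\<close>

lemma N_\<xi>: "N u x = - u + G x u *\<^sub>R x"
proof -
  have "pd c (\<lambda>q. \<phi> c q (\<xi> c q)) p u = pd c (\<lambda>q. 0) p u"
    by (rule pd_cong[OF smooth_const p_in, THEN fun_cong]) (simp add: \<phi>_\<xi>)
  then have "pd c (\<lambda>q. \<phi> c q x) p u + F (- F u - \<Gamma> p u x) = 0"
    by (simp add: pd_linear_apply[OF \<phi>_linear smooth_\<phi> smooth_\<xi> p_in] pd_\<xi>[OF p_in])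
  then show ?thesis
    unfolding N_def F_x F_simps FF \<Gamma>_simps by (simp add: algebra_simps)
qed

text \<open>This is the closedness of the 2-form g(., \<phi> .). Here it comes from the Bianchi
  identity paired with \<xi>: skewness of \<nabla>\<phi> turns the alternating sum in R(., .)\<xi>
  into a multiple of the cyclic one.\<close>

lemma N_cyclic: "G (N u v) w + G (N v w) u + G (N w u) v = 0"
proof -
  have "G (R u v x) w = - G (R u v w) x" for u v w
    using curvature_metric[of u v x w] sym by simp
  moreover have "G (R u v w) x + G (R v w u) x + G (R w u v) x = 0"
    using bianchi[of u v w] by (simp flip: add_left add: zero_left)
  ultimately have "G (R u v x) w + G (R v w x) u + G (R w u x) v = 0" by simp
  then show ?thesis
    unfolding curvature_\<xi> simps
    using N_skew[of u w v] N_skew[of v u w] N_skew[of w v u] sym[of w "N u v"] sym[of u "N v w"] sym[of v "N w u"]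
    by simp
qed

text \<open>R(v, w)\<xi> is a difference of two values of \<nabla>\<phi>; by skewness and the cyclic
  identity that difference is the third one. Thus R(., .)\<xi> determines \<nabla>\<phi>
  completely.\<close>

lemma N_eq_curvature: "G (N u v) w = G (R v w x) u"
  unfolding curvature_\<xi> simps
  using N_cyclic[of u v w] N_skew[of w v u] sym[of v "N w u"] by simp

text \<open>\<phi> is parallel along \<xi>, because R(u, w)\<xi> is orthogonal to \<xi>; so only the
  term of \<open>N_\<xi>\<close> survives.\<close>

lemma curvature_\<xi>_\<xi>: "R u x x = u - G x u *\<^sub>R x"
proof -
  have "N x u = 0"
  proof (rule nondegenerate)
    fix w
    show "G (N x u) w = G 0 w"
      unfolding N_eq_curvature using curvature_metric[of u w x x] sym[of x "R u w x"] by (simp add: simps)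
  qed
  then show ?thesis by (simp add: curvature_\<xi> N_\<xi>)
qed

section \<open>The Ricci tensor in the direction \<xi>\<close>

lemma Ric_\<xi>_\<xi>: "Ric x x = 2 * real m"
proof -
  have "Ric x x = endo_trace (\<lambda>u::'e. u) - endo_trace (\<lambda>u. G x u *\<^sub>R x)"
    unfolding ricci_form_def curvature_\<xi>_\<xi> by (rule endo_trace_diff)
  also have "\<dots> = 2 * real m"
    using endo_trace_rank1[OF linear_right, of x x] by (simp add: endo_trace_ident dim x_unit)
  finally show ?thesis .
qed

text \<open>Only the trace of \<open>u \<mapsto> (\<nabla>\<^sub>u \<phi>) y\<close> matters for \<open>Ric(y, \<xi>)\<close>. Twice its skew part is \<open>\<nabla>\<^sub>y \<phi>\<close> by the cyclic
  identity, so composing with \<open>\<phi>\<close> gives a traceless map, and differentiating \<open>\<phi>\<^sup>2\<close> turns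
  this into the vanishing of the trace at \<open>\<phi> y\<close>.\<close>

lemma Ric_\<xi>: "Ric y x = 2 * real m * G x y"
proof -
  have trN: "endo_trace (N y) = 0" for y
    by (rule endo_trace_skew[OF N_linear(1)]) (rule N_skew)
  have trF: "endo_trace F = 0"
    by (rule endo_trace_skew[OF F_lin]) (rule F_skew)
  have Ric: "Ric y x = - endo_trace (\<lambda>u. N u y)" for y
    unfolding ricci_form_def curvature_\<xi> by (simp add: endo_trace_diff trN)
  have "endo_trace (\<lambda>u. N u (F y)) = 0" for y
  proof -
    \<comment> \<open>By cyclicity both summands under the trace contribute equally, and the right
      side vanishes because \<phi> takes values orthogonal to \<xi>.\<close>
    have "endo_trace (\<lambda>u. N y (F u) + F (N y u)) = - G (F y) x - G x (F y)"
      unfolding N_F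
      by (simp add: endo_trace_diff endo_trace_uminus
        endo_trace_rank1[OF linear_right] endo_trace_rank1[OF linear_left])
    then have "endo_trace (\<lambda>u. N y (F u)) = 0"
      by (simp add: endo_trace_add G_x_F endo_trace_comp_commute[OF F_lin N_linear(1)])
    moreover have "endo_trace (\<lambda>u. F (N u y)) = endo_trace (\<lambda>w. N y (F w) - N (F w) y)"
    proof (rule endo_trace_adjoint)
      show "linear (\<lambda>u. F (N u y))"
        using linear_compose[OF N_linear(2) F_lin] by (simp add: o_def)
      show "linear (\<lambda>w. N y (F w) - N (F w) y)"
        using linear_compose[OF F_lin N_linear(2)] linear_compose[OF F_lin N_linear(1)]
        by (intro linear_compose_sub) (simp_all add: o_def)
      show "G (F (N u y)) v = G u (N y (F v) - N (F v) y)" for u v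
        using N_cyclic[of u y "F v"] N_skew[of "F v" u y] sym[of u "N y (F v)"]
        by (simp add: F_skew simps)
    qed
    \<comment> \<open>Cyclicity turns the subtracted trace into the left side again, so the left
      side is half of a trace already known to vanish.\<close>
    then have "endo_trace (\<lambda>u. F (N u y)) = endo_trace (\<lambda>w. N y (F w)) - endo_trace (\<lambda>u. F (N u y))"
      by (simp add: endo_trace_diff endo_trace_comp_commute[OF F_lin N_linear(2)])
    \<comment> \<open>Now \<open>N_F\<close> is traced over the direction of differentiation; the
      right side contributes multiples of \<phi>\<xi> = 0 and of the trace of \<phi>.\<close>
    moreover have "endo_trace (\<lambda>u. N u (F y) + F (N u y)) = 0"
    proof -
      have "linear (\<lambda>u. - G (F u) y)"
        using linear_compose[OF F_lin linear_left] by (intro linear_compose_neg) (simp add: o_def)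
      then show ?thesis
        unfolding N_F
        by (simp add: endo_trace_diff endo_trace_scaleR trF endo_trace_rank1 F_x simps del: scaleR_minus_left)
    qed
    ultimately show ?thesis by (simp add: endo_trace_add)
  qed
  then have 1: "Ric (F y) x = 0" for y by (simp add: Ric)
  \<comment> \<open>Up to its \<xi>-component, y lies in the image of \<phi>, where Ric(., \<xi>)
    has just been shown to vanish.\<close>
  have "y = G x y *\<^sub>R x - F (F y)" by (simp add: FF)
  then have "Ric y x = G x y * Ric x x - Ric (F (F y)) x"
    using linear_diff[OF ricci_form_linear(1)] linear_cmul[OF ricci_form_linear(1)] by (metis real_scaleR_def)
  then show ?thesis by (simp add: 1 Ric_\<xi>_\<xi>)
qed

lemma Q_\<xi>: "Q x = (2 * real m) *\<^sub>R x"
  by (rule ricci_endo_eqI) (simp add: simps ricci_form_commute[of x] Ric_\<xi>)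

text \<open>Together with \<open>coeff_b\<close> the solution of a + b = 2m and (2m + 1)a + b = r,
  which are the value on (\<xi>, \<xi>) and the trace of Ric = a g + b \<eta> \<otimes>
  \<eta>.\<close>

definition coeff_a :: real where "coeff_a = scal g c p / (2 * real m) - 1"
definition coeff_b :: real where "coeff_b = 2 * real m + 1 - scal g c p / (2 * real m)"

text \<open>Here n - 2 = 2m - 1 and (n - 1)(n - 2) = 2m(2m - 1). After multiplication by 2m - 1 the
  factor of u is (2m - 1) - 2m + r/2m, from R, from Ric(\<xi>, \<xi>) and from the scalar term; that
  of \<eta>(u)\<xi> is -(2m - 1) + 2m + 2m - r/2m.\<close>

lemma weyl_\<xi>_\<xi>:
  assumes "m \<ge> 2"
  shows "weyl_tensor u x x = (1 / (2 * real m - 1)) *\<^sub>R (coeff_a *\<^sub>R u + (coeff_b * G x u) *\<^sub>R x - Q u)"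
proof (rule nondegenerate)
  fix z
  have "2 * real m - 1 > 0" "real m > 0" using assms by auto
  then show "G (weyl_tensor u x x) z =
      G ((1 / (2 * real m - 1)) *\<^sub>R (coeff_a *\<^sub>R u + (coeff_b * G x u) *\<^sub>R x - Q u)) z"
    unfolding weyl_tensor_def Let_def dim Ric_\<xi> Q_\<xi> curvature_\<xi>_\<xi> x_unit coeff_a_def coeff_b_def sym[of u x] simps
    by (simp add: divide_simps x_unit) (simp add: algebra_simps)
qed

lemma weyl_\<xi>_\<xi>_eq_0_iff:
  assumes "m \<ge> 2"
  shows "weyl_tensor u x x = 0 \<longleftrightarrow> Q u = coeff_a *\<^sub>R u + (coeff_b * G x u) *\<^sub>R x"
  using assms unfolding weyl_\<xi>_\<xi>[OF assms] by auto

lemma \<eta>_einstein_coeffs: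
  assumes m: "m \<ge> 2" and Ric: "\<And>u v. Ric u v = a * G u v + b * G x u * G x v"
  shows "a = coeff_a" "b = coeff_b"
proof -
  have "a + b = 2 * real m"
    using Ric[of x x] by (simp add: Ric_\<xi>_\<xi> x_unit)
  have Q: "Q u = a *\<^sub>R u + (b * G x u) *\<^sub>R x" for u
    by (rule ricci_endo_eqI) (simp add: Ric simps)
  have "scal g c p = a * endo_trace (\<lambda>u::'e. u) + b * endo_trace (\<lambda>u. G x u *\<^sub>R x)"
    unfolding scal_eq Q by (simp add: endo_trace_add endo_trace_scaleR flip: scaleR_scaleR)
  also have "\<dots> = a * (2 * real m + 1) + b"
    using endo_trace_rank1[OF linear_right, of x x] by (simp add: endo_trace_ident dim x_unit)
  finally have "scal g c p = 2 * real m * (a + 1)"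
    using \<open>a + b = 2 * real m\<close> by (simp add: algebra_simps)
  then show "a = coeff_a" "b = coeff_b"
    using m \<open>a + b = 2 * real m\<close> by (simp_all add: coeff_a_def coeff_b_def)
qed

lemma Ric_eq:
  assumes "Q u = a *\<^sub>R u + (b * G x u) *\<^sub>R x"
  shows "Ric u v = a * G u v + b * G x u * G x v"
  using ricci_endo[of u v] by (simp add: assms simps)

text \<open>The case v = \<xi> determines Q. Substituting it, the parts of Q along \<xi> cancel by
  antisymmetry, and the remaining factor (2m + a - r/2m)/(2m - 1) equals 1, so the scalar curvature
  disappears.\<close>

lemma weyl_\<xi>_flat:
  assumes m: "m \<ge> 2" and W: "\<And>u v. weyl_tensor u v x = 0"
  shows "R u v x = G x v *\<^sub>R u - G x u *\<^sub>R v"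
proof (rule nondegenerate)
  fix z
  have Q: "Q u = coeff_a *\<^sub>R u + (coeff_b * G x u) *\<^sub>R x" for u
    using weyl_\<xi>_\<xi>_eq_0_iff[OF m] W by blast
  have "2 * real m - 1 > 0" "real m > 0" using m by auto
  then have "G (weyl_tensor u v x) z = G (R u v x) z + G x u * G v z - G x v * G u z"
    unfolding weyl_tensor_def Let_def dim Ric_\<xi> Q coeff_a_def coeff_b_def sym[of u x] sym[of v x] simps
    by (simp add: divide_simps) (simp add: algebra_simps)
  then show "G (R u v x) z = G (G x v *\<^sub>R u - G x u *\<^sub>R v) z"
    by (simp add: W simps)
qed

lemma N_sasakian:
  assumes "\<And>u v. R u v x = G x v *\<^sub>R u - G x u *\<^sub>R v"
  shows "N u v = G u v *\<^sub>R x - G x v *\<^sub>R u"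
  by (rule nondegenerate) (simp add: N_eq_curvature assms simps sym[of v u] algebra_simps sym[of _ u])

end

section \<open>Vector fields with prescribed values\<close>

text \<open>The flat function exp(-1/t), with powers of 1/t included so that the family is closed
  under differentiation up to linear combinations.\<close>

definition flat_exp :: "nat \<Rightarrow> real \<Rightarrow> real" where
  "flat_exp j t = (if t > 0 then inverse t ^ j * exp (- inverse t) else 0)"

text \<open>With x = 1/t this is the growth of exp x against powers of x.\<close>

lemma flat_exp_tendsto: "(flat_exp j \<longlongrightarrow> 0) (at_right 0)"
proof -
  have "((\<lambda>x::real. x ^ j / exp x) \<longlongrightarrow> 0) at_top" by (rule tendsto_power_div_exp_0)
  then have "((\<lambda>t::real. inverse t ^ j / exp (inverse t)) \<longlongrightarrow> 0) (at_right 0)"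
    by (rule filterlim_compose[OF _ filterlim_inverse_at_top_right])
  then show ?thesis
    by (rule Lim_transform_eventually)
      (auto simp: flat_exp_def exp_minus divide_inverse eventually_at_right_field intro: exI[of _ 1])
qed

lemma flat_exp_derivative:
  "(flat_exp j has_real_derivative - real j * flat_exp (Suc j) t + flat_exp (Suc (Suc j)) t) (at t)"
proof -
  consider "t > 0" | "t < 0" | "t = 0" by linarith
  then show ?thesis
  proof cases
    case 1
    have a: "((\<lambda>t. inverse t ^ j) has_real_derivative - real j * inverse t ^ Suc j) (at t)"
      using DERIV_power[OF DERIV_inverse'[OF DERIV_ident], where n=j and x=t and s=UNIV] 1 by (cases j) (simp_all add: algebra_simps)
    have b: "((\<lambda>t. exp (- inverse t)) has_real_derivative inverse t * inverse t * exp (- inverse t)) (at t)"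
      using 1 by (auto intro!: derivative_eq_intros)
    have "((\<lambda>t. inverse t ^ j * exp (- inverse t)) has_real_derivative
        - real j * (inverse t ^ Suc j * exp (- inverse t)) + inverse t ^ Suc (Suc j) * exp (- inverse t)) (at t)"
      using DERIV_mult[OF a b] by (simp add: algebra_simps)
    then have "(flat_exp j has_real_derivative
        - real j * (inverse t ^ Suc j * exp (- inverse t)) + inverse t ^ Suc (Suc j) * exp (- inverse t)) (at t)"
      by (rule has_field_derivative_transform_within[where d=t])
        (use 1 in \<open>auto simp: flat_exp_def dist_real_def\<close>)
    then show ?thesis using 1 by (simp add: flat_exp_def)
  next
    case 2
    have "((\<lambda>t. 0) has_real_derivative 0) (at t)" by simp
    then have "(flat_exp j has_real_derivative 0) (at t)"
      by (rule has_field_derivative_transform_within[where d="-t"])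
        (use 2 in \<open>auto simp: flat_exp_def dist_real_def\<close>)
    then show ?thesis using 2 by (simp add: flat_exp_def)
  next
    case 3
    \<comment> \<open>To the right of 0 the difference quotient is the next function of the family,
      to the left it is 0.\<close>
    have "((\<lambda>h. flat_exp j h / h) \<longlongrightarrow> 0) (at_right 0)"
      by (rule Lim_transform_eventually[OF flat_exp_tendsto[of "Suc j"]])
        (auto simp: flat_exp_def divide_inverse eventually_at_right_field intro: exI[of _ 1])
    moreover have "((\<lambda>h. flat_exp j h / h) \<longlongrightarrow> 0) (at_left 0)"
      by (rule Lim_transform_eventually[OF tendsto_const])
        (auto simp: flat_exp_def eventually_at_left_field intro: exI[of _ "-1"])
    ultimately have "((\<lambda>h. flat_exp j h / h) \<longlongrightarrow> 0) (at 0)"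
      by (simp add: filterlim_split_at)
    then show ?thesis using 3 by (simp add: DERIV_def flat_exp_def)
  qed
qed

lemma smooth_on_flat_exp: "smooth_on UNIV (flat_exp j)"
proof -
  have "Ck_on k UNIV (flat_exp j)" for k
  proof (induction k arbitrary: j)
    case 0
    then show ?case
      by simp (intro continuous_at_imp_continuous_on ballI DERIV_isCont[OF flat_exp_derivative])
  next
    case (Suc k)
    have "Ck_on k UNIV (\<lambda>x. (- real j * flat_exp (Suc j) x + flat_exp (Suc (Suc j)) x) * v)" for v
      by (rule Ck_on_bounded_bilinear[OF open_UNIV bounded_bilinear_mult
          Ck_on_add[OF open_UNIV Ck_on_bounded_linear[OF open_UNIV bounded_linear_mult_right Suc.IH] Suc.IH]
          Ck_on_const[OF open_UNIV]])
    then show ?case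
      by (intro Ck_on_SucI[OF open_UNIV, where f'="\<lambda>x v. (- real j * flat_exp (Suc j) x + flat_exp (Suc (Suc j)) x) * v"]
          flat_exp_derivative[unfolded has_field_derivative_def])
  qed
  then show ?thesis by (simp add: smooth_on_def)
qed

text \<open>A polynomial in x, rather than the distance to z, is fed into \<open>flat_exp 0\<close>,
  which keeps \<psi> smooth at z. The factor \<open>?k\<close> normalises the value there.\<close>

lemma smooth_bump:
  fixes z :: "'a::euclidean_space"
  assumes "e > 0"
  obtains \<psi> :: "'a \<Rightarrow> real" where "smooth_on UNIV \<psi>" "\<psi> z = 1" "\<And>x. \<psi> x \<noteq> 0 \<Longrightarrow> dist z x \<le> e"
proof
  let ?k = "inverse (flat_exp 0 (e\<^sup>2))"
  define \<psi> where "\<psi> x = ?k * flat_exp 0 (e\<^sup>2 + - ((x + - z) \<bullet> (x + - z)))" for x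
  note c = smooth_on_const[OF open_UNIV] and i = smooth_on_add[OF open_UNIV smooth_on_ident[OF open_UNIV]]
  have q: "smooth_on UNIV (\<lambda>x. (x + - z) \<bullet> (x + - z))"
    by (rule smooth_on_bounded_bilinear[OF open_UNIV bounded_bilinear_inner i[OF c] i[OF c]])
  have "smooth_on UNIV (\<lambda>x. e\<^sup>2 + - ((x + - z) \<bullet> (x + - z)))"
    by (rule smooth_on_add[OF open_UNIV c smooth_on_bounded_linear[OF open_UNIV
        bounded_linear_minus[OF bounded_linear_ident] q]])
  from smooth_on_compose[OF open_UNIV open_UNIV _ smooth_on_flat_exp this]
  show "smooth_on UNIV \<psi>"
    unfolding \<psi>_def by (intro smooth_on_bounded_linear[OF open_UNIV bounded_linear_mult_right]) simp
  show "\<psi> z = 1" using assms by (simp add: \<psi>_def flat_exp_def)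
  show "dist z x \<le> e" if "\<psi> x \<noteq> 0" for x
  proof -
    have "(x - z) \<bullet> (x - z) < e\<^sup>2" using that by (auto simp: \<psi>_def flat_exp_def split: if_splits)
    then have "(norm (x - z))\<^sup>2 < e\<^sup>2" by (simp add: power2_norm_eq_inner)
    then show ?thesis using assms by (simp add: dist_norm norm_minus_commute power2_less_imp_less less_imp_le)
  qed
qed

section \<open>Global vector fields\<close>

lemma vector_fieldD:
  assumes "smooth_atlas A" "vector_field A X" "c \<in> A"
  shows "smooth_in c (fst c) (X c)"
    and "d \<in> A \<Longrightarrow> p \<in> fst c \<Longrightarrow> p \<in> fst d \<Longrightarrow> X d p = pd c (snd d) p (X c p)"
proof -
  show "smooth_in c (fst c) (X c)"
    unfolding smooth_in_chart_smooth[OF smooth_atlasD(1)[OF assms(1,3,3)]]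
    using assms(2,3) by (simp add: vector_field_def)
  assume "d \<in> A" "p \<in> fst c" "p \<in> fst d"
  then show "X d p = pd c (snd d) p (X c p)"
    using assms(2,3) unfolding vector_field_def by blast
qed

lemma vector_fieldI:
  assumes "smooth_atlas A" "\<And>c. c \<in> A \<Longrightarrow> smooth_in c (fst c) (X c)"
    "\<And>c d p. c \<in> A \<Longrightarrow> d \<in> A \<Longrightarrow> p \<in> fst c \<Longrightarrow> p \<in> fst d \<Longrightarrow> X d p = pd c (snd d) p (X c p)"
  shows "vector_field A X"
  unfolding vector_field_def
proof (intro conjI ballI)
  show "chart_smooth c (X c)" if "c \<in> A" for c
    using assms(2)[OF that] smooth_in_chart_smooth[OF smooth_atlasD(1)[OF assms(1) that that], of "X c"] by simp
next
  fix c d p assume "c \<in> A" "d \<in> A" "p \<in> fst c \<inter> fst d"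
  then show "X d p = pd c (snd d) p (X c p)" by (intro assms(3)) simp_all
qed

lemma open_chart_domain: "is_chart c \<Longrightarrow> open (fst c)"
  by (simp add: is_chart_def)

text \<open>Jacobians of coordinate changes compose; with equal outer charts this makes them
  invertible.\<close>

lemma pd_change_compose:
  assumes A: "smooth_atlas A" "c \<in> A" "d \<in> A" "e \<in> A" and p: "p \<in> fst c" "p \<in> fst d" "p \<in> fst e"
  shows "pd c (snd e) p u = pd d (snd e) p (pd c (snd d) p u)"
proof -
  let ?U = "fst c \<inter> fst d \<inter> fst e"
  have U: "open ?U"
    using A by (intro open_Int open_chart_domain smooth_atlasD(1)[OF A(1)])
  have "smooth_in c ?U (snd d)" "smooth_in d ?U (snd e)"
    by (auto intro: smooth_in_subset[OF smooth_atlasD(2)[OF A(1,2,3)] U] smooth_in_subset[OF smooth_atlasD(2)[OF A(1,3,4)] U])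
  from smooth_in_change(2)[OF this] show ?thesis using p by simp
qed

text \<open>Conditions on all global vector fields become conditions on all tangent vectors through
  this lemma. A constant field in one chart is multiplied by a bump function with support in that
  chart.\<close>

lemma vector_field_extension:
  fixes A :: "('p::{t2_space,second_countable_topology}, 'e::euclidean_space) chart set"
  assumes A: "smooth_atlas A" and cA: "c \<in> A" and p: "p \<in> fst c"
  obtains X :: "('p, 'e) vfield" where "vector_field A X" "X c p = u"
proof -
  have chart: "is_chart d" "open (fst d)" if "d \<in> A" for d
    using smooth_atlasD(1)[OF A that that] open_chart_domain[of d] by simp_all
  note c = chart[OF cA]
  have "open (snd c ` fst c)" "snd c p \<in> snd c ` fst c"
    using c p by (auto simp: is_chart_def)
  then obtain e where e: "e > 0" "cball (snd c p) e \<subseteq> snd c ` fst c"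
    using open_contains_cball by blast
  obtain \<psi> :: "'e \<Rightarrow> real" where \<psi>: "smooth_on UNIV \<psi>" "\<psi> (snd c p) = 1"
    "\<And>x. \<psi> x \<noteq> 0 \<Longrightarrow> dist (snd c p) x \<le> e"
    using smooth_bump[OF e(1)] by blast
  define K where "K = chart_inv c ` cball (snd c p) e"
  have "continuous_on (snd c ` fst c) (chart_inv c)"
    using c unfolding is_chart_def homeomorphism_def by blast
  then have "compact K"
    unfolding K_def by (intro compact_continuous_image compact_cball) (rule continuous_on_subset[OF _ e(2)])
  \<comment> \<open>The manifold is Hausdorff, so the complement of K is open and X can be continued
    by 0 there.\<close>
  then have K: "closed K" by (rule compact_imp_closed)
  have Kc: "K \<subseteq> fst c"
    unfolding K_def using e(2) chart_inv_mem[OF c(1) order_refl] by blast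
  have supp: "\<psi> (snd c q) = 0" if "q \<in> fst c" "q \<notin> K" for q
  proof (rule ccontr)
    assume "\<psi> (snd c q) \<noteq> 0"
    then have "snd c q \<in> cball (snd c p) e" using \<psi>(3) by simp
    then have "chart_inv c (snd c q) \<in> K" unfolding K_def by blast
    then show False using that c by (simp add: chart_inv_eq)
  qed
  \<comment> \<open>The constant field u of the chart c, cut off by \<psi> and transported to the
    chart d by the Jacobian.\<close>
  define X :: "('p, 'e) vfield" where "X d q = (if q \<in> fst c then \<psi> (snd c q) *\<^sub>R pd c (snd d) q u else 0)" for d q
  have "vector_field A X"
  proof (rule vector_fieldI[OF A])
    fix d assume dA: "d \<in> A"
    note d = chart[OF dA]
    show "smooth_in d (fst d) (X d)"
    proof (rule smooth_in_local[OF d order_refl])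
      fix q assume q: "q \<in> fst d"
      show "\<exists>V. q \<in> V \<and> smooth_in d V (X d)"
      proof (cases "q \<in> fst c")
        case True
        let ?V = "fst d \<inter> fst c"
        have "smooth_in c ?V (\<lambda>q. \<psi> (snd c q) *\<^sub>R pd c (snd d) q u)"
          using smooth_atlasD(2)[OF A cA dA] c d
          by (intro smooth_in_scaleR smooth_in_compose[OF open_UNIV \<psi>(1)] smooth_in_chart smooth_in_pd)
            (auto simp: Int_commute)
        from smooth_in_change(1)[OF smooth_atlasD(2)[OF A dA cA] this]
        have "smooth_in d ?V (X d)"
          by (subst smooth_in_cong[of ?V "X d"]) (auto simp: X_def)
        then show ?thesis using True q by blast
      next
        case False
        \<comment> \<open>A neighbourhood of q on which X vanishes; \<open>supp\<close> takes care
          of its points that lie in the domain of c.\<close>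
        let ?V = "fst d - K"
        have "smooth_in d ?V (\<lambda>q. 0)"
          using d K by (intro smooth_in_const) (auto intro: open_Diff)
        then have "smooth_in d ?V (X d)"
          by (subst smooth_in_cong[of ?V "X d"]) (auto simp: X_def supp)
        then show ?thesis using False q Kc by blast
      qed
    qed
  next
    fix d e q assume *: "d \<in> A" "e \<in> A" "q \<in> fst d" "q \<in> fst e"
    have "linear (pd d (snd e) q)"
      by (rule pd_linear[OF smooth_atlasD(2)[OF A *(1,2)]]) (use * in auto)
    then show "X e q = pd d (snd e) q (X d q)"
      using pd_change_compose[OF A cA *(1,2) _ *(3,4)]
      by (simp add: X_def linear_cmul linear_0)
  qed
  moreover have "X c p = u" using p c by (simp add: X_def \<psi>(2) pd_chart)
  ultimately show ?thesis using that by blast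
qed

section \<open>Invariance under change of charts\<close>

locale riem_charts = c: riem_point A g c p + d: riem_point A g d p
  for A :: "('p::{t2_space,second_countable_topology}, 'e::euclidean_space) chart set" and g c d p
begin

abbreviation "J \<equiv> pd c (snd d) p"
abbreviation "J' \<equiv> pd d (snd c) p"
abbreviation "U \<equiv> fst c \<inter> fst d"

text \<open>The second derivative of the coordinate change, the non-tensorial term in the
  transformation of derivatives of fields. Its symmetry removes it from brackets; in covariant
  derivatives the Christoffel symbols absorb it.\<close>

definition H :: "'e \<Rightarrow> 'e \<Rightarrow> 'e" where "H u v = pd c (\<lambda>q. pd c (snd d) q v) p u"

lemma U: "open U" "p \<in> U"
  using c.chart d.chart c.p_in d.p_in by auto

lemma smooth_change: "smooth_in c U (snd d)" "smooth_in d U (snd c)"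
  using smooth_atlasD(2)[OF c.atlas c.c_in d.c_in] smooth_atlasD(2)[OF c.atlas d.c_in c.c_in]
  by (simp_all add: Int_commute)

lemma J_linear: "linear J" "linear J'"
  using pd_linear[OF smooth_change(1) U(2)] pd_linear[OF smooth_change(2) U(2)] by auto

lemma J_inverse: "J' (J u) = u" "J (J' u) = u"
  using pd_change_compose[OF c.atlas c.c_in d.c_in c.c_in c.p_in d.p_in c.p_in]
    pd_change_compose[OF c.atlas d.c_in c.c_in d.c_in d.p_in c.p_in d.p_in]
    pd_chart[OF c.chart(1) c.p_in] pd_chart[OF d.chart(1) d.p_in] by simp_all

lemma H_commute: "H u v = H v u"
  unfolding H_def by (rule pd_commute[OF smooth_change(1) U(2)])

lemma smooth_c_U: "smooth_in c (fst c) Y \<Longrightarrow> smooth_in c U Y"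
  by (rule smooth_in_subset[OF _ U(1)]) auto

lemma smooth_d_U: "smooth_in d (fst d) Y \<Longrightarrow> smooth_in d U Y"
  by (rule smooth_in_subset[OF _ U(1)]) auto

lemma vector_field_change: "vector_field A X \<Longrightarrow> X d p = J (X c p)"
  by (rule vector_fieldD(2)[OF c.atlas _ c.c_in d.c_in c.p_in d.p_in])

lemma pd_vector_field:
  assumes Y: "vector_field A Y"
  shows "pd d (Y d) p (J u) = H u (Y c p) + J (pd c (Y c) p u)"
proof -
  note Yc = smooth_c_U[OF vector_fieldD(1)[OF c.atlas Y c.c_in]]
  note Yd = smooth_d_U[OF vector_fieldD(1)[OF c.atlas Y d.c_in]]
  have lin: "linear (pd c (snd d) q)" if "q \<in> U" for q by (rule pd_linear[OF smooth_change(1) that])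
  have "pd d (Y d) p (J u) = pd c (Y d) p u"
    by (rule smooth_in_change(2)[OF smooth_change(1) Yd U(2), symmetric])
  also have "\<dots> = pd c (\<lambda>q. pd c (snd d) q (Y c q)) p u"
    by (rule pd_cong[OF smooth_in_pd_apply[OF smooth_change(1) Yc] U(2), THEN fun_cong])
      (use vector_fieldD(2)[OF c.atlas Y c.c_in d.c_in] in auto)
  also have "\<dots> = H u (Y c p) + J (pd c (Y c) p u)"
    unfolding H_def by (rule pd_linear_apply[OF lin smooth_in_pd[OF smooth_change(1)] Yc U(2)])
  finally show ?thesis .
qed

lemma g_change: "q \<in> U \<Longrightarrow> g d q (pd c (snd d) q u) (pd c (snd d) q v) = g c q u v"
  using c.metric c.c_in d.c_in by (auto simp: riemannian_metric_def)

text \<open>The connection of the chart d, pulled back to c as K, is symmetric and metric in c;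
  uniqueness in \<open>christoffel_ex1\<close> identifies it with the Christoffel symbols of
  c.\<close>

lemma christoffel_change:
  "christoffel g d p (J u) (J v) + H u v = J (christoffel g c p u v)"
proof -
  let ?\<Gamma> = "christoffel g d p"
  define K where "K u v = J' (?\<Gamma> (J u) (J v) + H u v)" for u v
  have JK: "J (K u v) = ?\<Gamma> (J u) (J v) + H u v" for u v by (simp add: K_def J_inverse)
  have "K u v = K v u" for u v
    by (simp add: K_def H_commute[of u] d.christoffel_commute[OF d.p_in, of "J u"])
  moreover have "pd c (\<lambda>q. g c q v w) p u = g c p (K u v) w + g c p v (K u w)" for u v w
  proof -
    have bil: "bilinear (g d q)" if "q \<in> U" for q using d.g_bilinear that by simp
    have sm: "smooth_in c U (\<lambda>q. g d q a b)" for a b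
      by (rule smooth_in_change(1)[OF smooth_change(1) smooth_d_U[OF d.smooth_g]])
    note smJ = smooth_in_pd[OF smooth_change(1)]
    have "pd c (\<lambda>q. g c q v w) p u = pd c (\<lambda>q. g d q (pd c (snd d) q v) (pd c (snd d) q w)) p u"
      by (rule pd_cong[OF smooth_in_bilinear_apply[OF bil sm smJ smJ] U(2), THEN fun_cong], assumption, erule g_change)
    also have "\<dots> = pd c (\<lambda>q. g d q (J v) (J w)) p u + g d p (H u v) (J w) + g d p (J v) (H u w)"
      unfolding H_def by (rule pd_bilinear_apply[OF bil sm smJ smJ U(2)])
    also have "pd c (\<lambda>q. g d q (J v) (J w)) p u = pd d (\<lambda>q. g d q (J v) (J w)) p (J u)"
      by (rule smooth_in_change(2)[OF smooth_change(1) smooth_d_U[OF d.smooth_g] U(2)])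
    also have "\<dots> = g d p (?\<Gamma> (J u) (J v)) (J w) + g d p (J v) (?\<Gamma> (J u) (J w))"
      by (rule d.pd_g[OF d.p_in])
    also have "\<dots> + g d p (H u v) (J w) + g d p (J v) (H u w) = g d p (J (K u v)) (J w) + g d p (J v) (J (K u w))"
      by (simp add: JK d.simps)
    finally show ?thesis by (simp add: g_change[OF U(2)])
  qed
  ultimately have "christoffel g c p = K"
    unfolding christoffel_def
    by (intro the1_equality[OF christoffel_ex1[OF c.metric c.atlas c.c_in c.p_in]]) blast
  then show ?thesis by (simp add: JK)
qed

lemma bracket_change:
  assumes X: "vector_field A X" and Y: "vector_field A Y"
  shows "bracket X Y d p = J (bracket X Y c p)"
  unfolding bracket_def vector_field_change[OF X] vector_field_change[OF Y]
    pd_vector_field[OF X] pd_vector_field[OF Y]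
  by (simp add: linear_diff[OF J_linear(1)] H_commute[of "X c p"])

lemma cov_change:
  assumes X: "vector_field A X" and Y: "vector_field A Y"
  shows "cov g X Y d p = J (cov g X Y c p)"
  unfolding cov_def vector_field_change[OF X] vector_field_change[OF Y] pd_vector_field[OF Y]
  using christoffel_change[of "X c p" "Y c p"]
  by (simp add: linear_add[OF J_linear(1)] algebra_simps)

end

section \<open>Operations on global vector fields\<close>

locale riem_atlas =
  fixes A :: "('p::{t2_space,second_countable_topology}, 'e::euclidean_space) chart set"
    and g :: "('p, 'e) bform"
  assumes atlas: "smooth_atlas A" and metric: "riemannian_metric A g"
begin

lemma riem_chart: "c \<in> A \<Longrightarrow> riem_chart A g c"
  using atlas metric by unfold_locales

lemma riem_point: "c \<in> A \<Longrightarrow> p \<in> fst c \<Longrightarrow> riem_point A g c p"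
  using atlas metric by unfold_locales

lemma riem_charts: "c \<in> A \<Longrightarrow> d \<in> A \<Longrightarrow> p \<in> fst c \<Longrightarrow> p \<in> fst d \<Longrightarrow> riem_charts A g c d p"
  by (simp add: riem_charts_def riem_point)

lemma vector_field_diff:
  assumes X: "vector_field A X" and Y: "vector_field A Y"
  shows "vector_field A (\<lambda>c p. X c p - Y c p)"
proof (rule vector_fieldI[OF atlas])
  show "smooth_in c (fst c) (\<lambda>p. X c p - Y c p)" if "c \<in> A" for c
    by (intro smooth_in_diff vector_fieldD(1)[OF atlas] X Y that)
  fix c d p assume *: "c \<in> A" "d \<in> A" "p \<in> fst c" "p \<in> fst d"
  interpret riem_charts A g c d p by (rule riem_charts[OF *])
  show "X d p - Y d p = J (X c p - Y c p)"
    by (simp add: linear_diff[OF J_linear(1)] vector_field_change X Y)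
qed

lemma vector_field_bracket:
  assumes X: "vector_field A X" and Y: "vector_field A Y"
  shows "vector_field A (bracket X Y)"
proof (rule vector_fieldI[OF atlas])
  fix c assume c: "c \<in> A"
  note s = vector_fieldD(1)[OF atlas X c] vector_fieldD(1)[OF atlas Y c]
  show "smooth_in c (fst c) (bracket X Y c)"
    unfolding bracket_def by (intro smooth_in_diff smooth_in_pd_apply s)
next
  fix c d p assume *: "c \<in> A" "d \<in> A" "p \<in> fst c" "p \<in> fst d"
  interpret riem_charts A g c d p by (rule riem_charts[OF *])
  show "bracket X Y d p = J (bracket X Y c p)" by (rule bracket_change[OF X Y])
qed

lemma vector_field_cov:
  assumes X: "vector_field A X" and Y: "vector_field A Y"
  shows "vector_field A (cov g X Y)"
proof (rule vector_fieldI[OF atlas])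
  fix c assume c: "c \<in> A"
  interpret riem_chart A g c by (rule riem_chart[OF c])
  note s = vector_fieldD(1)[OF atlas X c] vector_fieldD(1)[OF atlas Y c]
  show "smooth_in c (fst c) (cov g X Y c)"
    unfolding cov_def
    by (intro smooth_in_add smooth_in_pd_apply smooth_in_bilinear_apply[OF christoffel_bilinear smooth_christoffel] s)
next
  fix c d p assume *: "c \<in> A" "d \<in> A" "p \<in> fst c" "p \<in> fst d"
  interpret riem_charts A g c d p by (rule riem_charts[OF *])
  show "cov g X Y d p = J (cov g X Y c p)" by (rule cov_change[OF X Y])
qed

lemma vector_field_riem:
  assumes "vector_field A X" "vector_field A Y" "vector_field A Z"
  shows "vector_field A (riem g X Y Z)"
  unfolding riem_def by (intro vector_field_diff vector_field_cov vector_field_bracket assms)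

end

context riem_charts
begin

sublocale riem_atlas A g using c.atlas c.metric by unfold_locales

text \<open>Extending u, v, w to global fields avoids differentiating the transformation law of
  \<Gamma>: \<open>riem\<close> is built from brackets and covariant derivatives, hence is a vector
  field, and its value at p depends on u, v, w alone.\<close>

lemma curvature_change: "curvature g d p (J u) (J v) (J w) = J (curvature g c p u v w)"
proof -
  note ext = vector_field_extension[OF c.atlas c.c_in c.p_in]
  obtain X Y Z where X: "vector_field A X" "X c p = u" and Y: "vector_field A Y" "Y c p = v"
    and Z: "vector_field A Z" "Z c p = w"
    using ext[of u] ext[of v] ext[of w] by metis
  note sc = vector_fieldD(1)[OF c.atlas _ c.c_in] and sd = vector_fieldD(1)[OF c.atlas _ d.c_in]
  have "riem g X Y Z d p = J (riem g X Y Z c p)"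
    by (rule vector_field_change[OF vector_field_riem[OF X(1) Y(1) Z(1)]])
  then show ?thesis
    by (simp add: c.riem_eq_curvature sc d.riem_eq_curvature sd X Y Z vector_field_change)
qed

lemma ricci_form_change: "ricci_form g d p (J v) (J w) = ricci_form g c p v w"
proof -
  have "endo_trace (\<lambda>u. curvature g d p u (J v) (J w)) = endo_trace (\<lambda>u. curvature g c p u v w)"
    by (rule endo_trace_conjugate[where J=J and J'=J'])
      (simp_all add: c.curvature_linear d.curvature_linear J_linear J_inverse curvature_change)
  then show ?thesis by (simp add: ricci_form_def)
qed

lemma ricci_endo_change: "ricci_endo g d p (J u) = J (ricci_endo g c p u)"
proof (rule d.ricci_endo_eqI)
  fix z
  have "ricci_form g d p (J u) (J (J' z)) = g c p (ricci_endo g c p u) (J' z)"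
    by (simp add: ricci_form_change c.ricci_endo)
  also have "\<dots> = g d p (J (ricci_endo g c p u)) (J (J' z))"
    by (rule g_change[OF U(2), symmetric])
  finally show "g d p (J (ricci_endo g c p u)) z = ricci_form g d p (J u) z"
    by (simp add: J_inverse)
qed

lemma scal_change: "scal g d p = scal g c p"
  unfolding c.scal_eq d.scal_eq
  by (rule endo_trace_conjugate[where J=J and J'=J'])
    (simp_all add: c.ricci_endo_linear d.ricci_endo_linear J_linear J_inverse ricci_endo_change)

end

context riem_atlas
begin

text \<open>\<open>scal\<close> takes a chart as argument, whereas \<open>smooth_fun\<close> speaks
  of functions on the manifold. By \<open>scal_change\<close> the chosen chart does not affect the
  value.\<close>

definition scalar_curvature :: "'p \<Rightarrow> real" where
  "scalar_curvature p = scal g (SOME c. c \<in> A \<and> p \<in> fst c) p"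

lemma scalar_curvature_eq:
  assumes "c \<in> A" "p \<in> fst c"
  shows "scalar_curvature p = scal g c p"
proof -
  let ?d = "SOME c. c \<in> A \<and> p \<in> fst c"
  have d: "?d \<in> A \<and> p \<in> fst ?d" by (rule someI[of _ c]) (use assms in blast)
  interpret riem_charts A g c ?d p by (rule riem_charts) (use assms d in auto)
  show ?thesis unfolding scalar_curvature_def by (rule scal_change)
qed

lemma smooth_scalar_curvature: "c \<in> A \<Longrightarrow> smooth_in c (fst c) scalar_curvature"
proof -
  assume c: "c \<in> A"
  show ?thesis
    by (subst smooth_in_cong[where G="scal g c"])
      (simp_all add: riem_chart.smooth_scal[OF riem_chart[OF c]] scalar_curvature_eq[OF c])
qed

end

section \<open>K-contact manifolds in charts\<close>

lemma k_contact_chart: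
  fixes A :: "('p::{t2_space,second_countable_topology}, 'e::euclidean_space) chart set"
  assumes K: "k_contact A m \<phi> \<eta> \<xi> g" and cA: "c \<in> A"
  shows "k_contact_chart A g c m \<phi> \<xi>" and "q \<in> fst c \<Longrightarrow> \<eta> c q u = g c q (\<xi> c q) u"
proof -
  have C: "contact_riemannian A m \<phi> \<eta> \<xi> g" and Kil: "killing A g \<xi>"
    using K by (auto simp: k_contact_def)
  have atlas: "smooth_atlas A" and metric: "riemannian_metric A g" and \<xi>: "vector_field A \<xi>"
    and \<phi>: "endo_field A \<phi>" and \<eta>: "one_form A \<eta>" and dim: "DIM('e) = 2 * m + 1"
    using C by (auto simp: contact_riemannian_def contact_form_def)
  interpret riem_chart A g c using atlas metric cA by unfold_locales
  note ext = vector_field_extension[OF atlas cA]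
  note smooth = vector_fieldD(1)[OF atlas _ cA]
  note s\<xi> = smooth[OF \<xi>]
  have \<eta>_smooth: "smooth_c (\<lambda>q. \<eta> c q u)" for u
    using \<eta> cA by (simp add: one_form_def smooth_in_chart_smooth[OF chart(1)])
  have \<eta>_linear: "linear (\<eta> c q)" if "q \<in> fst c" for q
    using \<eta> cA that by (simp add: one_form_def)
  have \<eta>_g: "\<eta> c q u = g c q (\<xi> c q) u" if q: "q \<in> fst c" for q u
  proof -
    obtain X where "vector_field A X" "X c q = u" using ext[OF q] by blast
    then show ?thesis using C cA q unfolding contact_riemannian_def by blast
  qed
  then show "\<eta> c q u = g c q (\<xi> c q) u" if "q \<in> fst c" using that .
  \<comment> \<open>\<open>n q u\<close> is the covariant derivative of \<xi> in the direction
    u.\<close>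
  define n where "n q u = pd c (\<xi> c) q u + \<Gamma> q u (\<xi> c q)" for q u
  have pd_\<eta>: "pd c (\<lambda>q. \<eta> c q v) q u = g c q (n q u) v + g c q (\<xi> c q) (\<Gamma> q u v)" if q: "q \<in> fst c" for q u v
  proof -
    interpret riem_point A g c q using q by unfold_locales
    have "pd c (\<lambda>q. \<eta> c q v) q u = pd c (\<lambda>q. g c q (\<xi> c q) v) q u"
      by (rule pd_cong[OF smooth_in_bilinear_apply[OF g_bilinear smooth_g s\<xi> smooth_const] q, THEN fun_cong])
        (simp_all add: \<eta>_g)
    then show ?thesis
      by (simp add: pd_bilinear_apply[OF g_bilinear smooth_g s\<xi> smooth_const q] pd_g[OF q] simps n_def)
  qed
  \<comment> \<open>The factor 2 clears the 1/2 in the convention for d\<eta>; the Christoffel terms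
    cancel by symmetry.\<close>
  have ext_d: "2 * ext_d \<eta> X Y c q = g c q (n q (X c q)) (Y c q) - g c q (n q (Y c q)) (X c q)"
    if q: "q \<in> fst c" and X: "vector_field A X" and Y: "vector_field A Y" for q X Y
    unfolding ext_d_def bracket_def
    by (simp add: pd_linear_apply[OF \<eta>_linear \<eta>_smooth smooth[OF X] q] pd_linear_apply[OF \<eta>_linear \<eta>_smooth smooth[OF Y] q]
        linear_diff[OF \<eta>_linear[OF q]] pd_\<eta>[OF q] christoffel_commute[OF q, of "Y c q"])
  have killing: "g c q (n q u) v = - g c q u (n q v)" if q: "q \<in> fst c" for q u v
  proof -
    interpret riem_point A g c q using q by unfold_locales
    obtain X where X: "vector_field A X" "X c q = u" using ext[OF q] by blast
    obtain Y where Y: "vector_field A Y" "Y c q = v" using ext[OF q] by blast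
    have "pd c (\<lambda>q. g c q (X c q) (Y c q)) q (\<xi> c q) - g c q (bracket \<xi> X c q) (Y c q)
        - g c q (X c q) (bracket \<xi> Y c q) = 0"
      using Kil X Y cA q by (auto simp: killing_def)
    then show ?thesis
      by (simp add: pd_bilinear_apply[OF g_bilinear smooth_g smooth[OF X(1)] smooth[OF Y(1)] q]
        pd_g[OF q] bracket_def simps n_def X Y christoffel_commute[OF q, of "\<xi> c q"])
  qed
  have n: "g c q (n q u) v = g c q u (\<phi> c q v)" if q: "q \<in> fst c" for q u v
  proof -
    interpret riem_point A g c q using q by unfold_locales
    obtain X where X: "vector_field A X" "X c q = u" using ext[OF q] by blast
    obtain Y where Y: "vector_field A Y" "Y c q = v" using ext[OF q] by blast
    have "ext_d \<eta> X Y c q = g c q (X c q) (\<phi> c q (Y c q))"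
      using C X Y cA q unfolding contact_riemannian_def by blast
    then show ?thesis
      using ext_d[OF q X(1) Y(1)] killing[OF q, of v u] sym[of v "n q u"] by (simp add: X Y)
  qed
  have skew: "g c q (\<phi> c q u) v = - g c q u (\<phi> c q v)" if q: "q \<in> fst c" for q u v
    using n[OF q, of u v] n[OF q, of v u] killing[OF q, of u v]
      inner_form.sym[OF inner_form[OF q], of v "\<phi> c q u"] inner_form.sym[OF inner_form[OF q], of u "n q v"]
    by simp
  show "k_contact_chart A g c m \<phi> \<xi>"
  proof (rule k_contact_chart.intro[OF riem_chart_axioms], rule k_contact_chart_axioms.intro, goal_cases)
    case 1 show ?case by (rule dim)
  next
    case 2 show ?case by (rule s\<xi>)
  next
    case (3 u) show ?case
      using \<phi> cA by (simp add: endo_field_def smooth_in_chart_smooth[OF chart(1)])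
  next
    case (4 q) then show ?case using \<phi> cA by (simp add: endo_field_def)
  next
    case (5 q)
    then have "\<eta> c q (\<xi> c q) = 1" using C cA unfolding contact_riemannian_def by blast
    then show ?case by (simp add: \<eta>_g[OF 5])
  next
    case (6 q u)
    obtain X where X: "vector_field A X" "X c q = u" using ext[OF 6] by blast
    have "\<phi> c q (\<phi> c q (X c q)) = - X c q + \<eta> c q (X c q) *\<^sub>R \<xi> c q"
      using C X cA 6 unfolding contact_riemannian_def by blast
    then show ?case by (simp add: X \<eta>_g[OF 6])
  next
    case (7 q u v) then show ?case by (rule skew)
  next
    case (8 q)
    interpret riem_point A g c q using 8 by unfold_locales
    show ?case
    proof (rule nondegenerate)
      fix v
      obtain X where X: "vector_field A X" "X c q = v" using ext[OF 8] by blast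
      \<comment> \<open>Up to sign, g(\<phi>\<xi>, v) is d\<eta>(\<xi>, v), which the Reeb condition
        makes zero.\<close>
      have "ext_d \<eta> \<xi> X c q = 0" "ext_d \<eta> \<xi> X c q = g c q (\<xi> c q) (\<phi> c q (X c q))"
        using C X \<xi> cA 8 unfolding contact_riemannian_def by blast+
      then show "g c q (\<phi> c q (\<xi> c q)) v = g c q 0 v" by (simp add: skew[OF 8] X simps)
    qed
  next
    case (9 q u)
    interpret riem_point A g c q using 9 by unfold_locales
    show ?case
      by (rule nondegenerate) (use n[OF 9] in \<open>simp add: n_def skew[OF 9] simps\<close>)
  qed
qed

section \<open>Tensoriality\<close>

text \<open>Derivatives of the fields from the product rule cancel those in the brackets, so the
  arguments may be frozen at z. The factor 3 clears the convention.\<close>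

lemma ext_d2_tensorial:
  fixes C :: "('p::topological_space, 'e::euclidean_space) chart"
  assumes C: "is_chart C" and z: "z \<in> fst C"
    and bil: "\<And>q. q \<in> fst C \<Longrightarrow> bilinear (\<omega> C q)" and sm: "\<And>u v. smooth_in C (fst C) (\<lambda>q. \<omega> C q u v)"
    and alt: "\<And>u v. \<omega> C z u v = - \<omega> C z v u"
    and X: "smooth_in C (fst C) (X C)" and Y: "smooth_in C (fst C) (Y C)" and Z: "smooth_in C (fst C) (Z C)"
  shows "3 * ext_d2 \<omega> X Y Z C z =
    pd C (\<lambda>q. \<omega> C q (Y C z) (Z C z)) z (X C z) + pd C (\<lambda>q. \<omega> C q (Z C z) (X C z)) z (Y C z)
    + pd C (\<lambda>q. \<omega> C q (X C z) (Y C z)) z (Z C z)"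
proof -
  note b = bilinear_lsub[OF bil[OF z]]
  show ?thesis
    using alt[of "pd C (Z C) z (X C z)" "Y C z"] alt[of "pd C (X C) z (Y C z)" "Z C z"]
      alt[of "pd C (Y C) z (Z C z)" "X C z"]
    by (simp add: ext_d2_def bracket_def b pd_bilinear_apply[OF bil sm X Y z]
      pd_bilinear_apply[OF bil sm Y Z z] pd_bilinear_apply[OF bil sm Z X z])
qed

text \<open>Derivatives of X and Y cancel, those in [X, Y] by means of J^2 = -1; what remains
  differentiates J on arguments frozen at z.\<close>

lemma nijenhuis_tensorial:
  fixes C :: "('p::topological_space, 'e::euclidean_space) chart"
  assumes C: "is_chart C" and z: "z \<in> fst C"
    and lin: "\<And>q. q \<in> fst C \<Longrightarrow> linear (J C q)" and sm: "\<And>u. smooth_in C (fst C) (\<lambda>q. J C q u)"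
    and JJ: "\<And>u. J C z (J C z u) = - u"
    and X: "smooth_in C (fst C) (X C)" and Y: "smooth_in C (fst C) (Y C)"
  shows "nijenhuis J X Y C z =
    pd C (\<lambda>q. J C q (Y C z)) z (J C z (X C z)) - pd C (\<lambda>q. J C q (X C z)) z (J C z (Y C z))
    + J C z (pd C (\<lambda>q. J C q (X C z)) z (Y C z)) - J C z (pd C (\<lambda>q. J C q (Y C z)) z (X C z))"
  by (simp add: nijenhuis_def bracket_def endo_app_def pd_linear_apply[OF lin sm X z]
      pd_linear_apply[OF lin sm Y z] linear_diff[OF lin[OF z]] linear_add[OF lin[OF z]] JJ)

section \<open>Cone charts\<close>

lemma fst_cone_chart: "fst (cone_chart c) = fst c \<times> {0<..}"
  and snd_cone_chart: "snd (cone_chart c) z = (snd c (fst z), snd z)"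
  by (simp_all add: cone_chart_def case_prod_beta)

lemma cone_chart_image: "snd (cone_chart c) ` (U \<times> {0<..}) = snd c ` U \<times> {0<..}"
  by (force simp: snd_cone_chart image_iff)

lemma cone_chart_inv:
  assumes c: "is_chart c" and x: "x \<in> snd c ` fst c" "r > 0"
  shows "chart_inv (cone_chart c) (x, r) = (chart_inv c x, r)"
proof -
  obtain p where p: "p \<in> fst c" "x = snd c p" using x by blast
  have inj: "inj_on (snd (cone_chart c)) (fst (cone_chart c))"
    by (rule inj_onI) (auto simp: fst_cone_chart snd_cone_chart, metis c chart_inv_eq)
  have "chart_inv (cone_chart c) (snd (cone_chart c) (p, r)) = (p, r)"
    unfolding chart_inv_def by (rule inv_into_f_f[OF inj]) (use p x in \<open>simp add: fst_cone_chart\<close>)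
  then show ?thesis using p c by (simp add: snd_cone_chart chart_inv_eq)
qed

lemma is_chart_cone_chart:
  assumes c: "is_chart c"
  shows "is_chart (cone_chart c)"
proof -
  have h: "homeomorphism (fst c) (snd c ` fst c) (snd c) (chart_inv c)" "open (fst c)" "open (snd c ` fst c)"
    using c by (auto simp: is_chart_def)
  have cont: "continuous_on (fst c) (snd c)" "continuous_on (snd c ` fst c) (chart_inv c)"
    using h by (auto simp: homeomorphism_def)
  have "continuous_on (fst c \<times> {0::real<..}) (\<lambda>z. (snd c (fst z), snd z))"
    by (intro continuous_intros continuous_on_compose2[OF cont(1)]) auto
  then have 1: "continuous_on (fst c \<times> {0<..}) (snd (cone_chart c))"
    by (simp add: snd_cone_chart[abs_def])
  have "continuous_on (snd c ` fst c \<times> {0::real<..}) (\<lambda>x. (chart_inv c (fst x), snd x))"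
    by (intro continuous_intros continuous_on_compose2[OF cont(2)]) auto
  then have 2: "continuous_on (snd c ` fst c \<times> {0<..}) (chart_inv (cone_chart c))"
    by (rule continuous_on_eq) (auto simp: cone_chart_inv[OF c])
  have inv: "chart_inv (cone_chart c) (snd (cone_chart c) z) = z" if "z \<in> fst c \<times> {0<..}" for z
    using that cone_chart_inv[OF c, of "snd c (fst z)" "snd z"] by (auto simp: snd_cone_chart chart_inv_eq[OF c])
  have "homeomorphism (fst c \<times> {0<..}) (snd (cone_chart c) ` (fst c \<times> {0<..})) (snd (cone_chart c)) (chart_inv (cone_chart c))"
    by (rule homeomorphismI) (use 1 2[folded cone_chart_image] inv in auto)
  then show ?thesis
    using h by (simp add: is_chart_def fst_cone_chart cone_chart_image open_Times)
qed

lemma smooth_in_cone_fst: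
  assumes "smooth_in c U F"
  shows "smooth_in (cone_chart c) (U \<times> {0<..}) (\<lambda>z. F (fst z))"
proof -
  note D = smooth_inD[OF assms]
  have o: "open (snd c ` U \<times> {0::real<..})" using D by (intro open_Times) auto
  have "smooth_on (snd c ` U \<times> {0::real<..}) (\<lambda>x. F (chart_inv c (fst x)))"
    by (rule smooth_on_compose[OF o D(4) _ D(5) smooth_on_linear_fun[OF o bounded_linear_fst]]) auto
  then have "smooth_on (snd c ` U \<times> {0<..}) (\<lambda>x. F (fst (chart_inv (cone_chart c) x)))"
    by (subst smooth_on_cong[OF o]) (use D in \<open>auto simp: cone_chart_inv subset_iff\<close>)
  then show ?thesis
    using D by (auto simp: smooth_in_def is_chart_cone_chart fst_cone_chart cone_chart_image open_Times)
qed

lemma smooth_in_cone_snd: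
  assumes "is_chart c" "open U" "U \<subseteq> fst c"
  shows "smooth_in (cone_chart c) (U \<times> {0<..}) snd"
proof -
  have o: "open (snd c ` U \<times> {0::real<..})"
    using chart_image_open[OF assms] by (intro open_Times) auto
  have "smooth_on (snd c ` U \<times> {0<..}) (\<lambda>x. snd (chart_inv (cone_chart c) x))"
    by (subst smooth_on_cong[OF o, of _ snd])
      (use assms o in \<open>auto simp: cone_chart_inv subset_iff intro: smooth_on_linear_fun bounded_linear_snd\<close>)
  then show ?thesis
    using assms by (auto simp: smooth_in_def is_chart_cone_chart fst_cone_chart cone_chart_image open_Times)
qed

lemma pd_cone_fst:
  assumes F: "smooth_in c U F" and p: "p \<in> U" and r: "r > 0"
  shows "pd (cone_chart c) (\<lambda>z. F (fst z)) (p, r) (u, s) = pd c F p u"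
proof -
  note D = smooth_inD[OF F]
  have o: "open (snd c ` U \<times> {0::real<..})" using D by (intro open_Times) auto
  have "((\<lambda>x. F (chart_inv c (fst x))) has_derivative (\<lambda>w. pd c F p (fst w))) (at (snd c p, r))"
    using diff_chain_at[OF bounded_linear_imp_has_derivative[OF bounded_linear_fst], of "\<lambda>x. F (chart_inv c x)" "pd c F p" "(snd c p, r)"]
      smooth_in_has_derivative[OF F p] by (simp add: o_def)
  then have "((\<lambda>x. F (fst (chart_inv (cone_chart c) x))) has_derivative (\<lambda>w. pd c F p (fst w))) (at (snd c p, r))"
    by (rule has_derivative_transform_within_open[OF _ o]) (use p r D in \<open>auto simp: cone_chart_inv subset_iff\<close>)
  then have "pd (cone_chart c) (\<lambda>z. F (fst z)) (p, r) = (\<lambda>w. pd c F p (fst w))"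
    by (intro pd_eqI) (simp add: snd_cone_chart)
  then show ?thesis by simp
qed

lemma pd_cone_snd:
  assumes c: "is_chart c" and p: "p \<in> fst c" and r: "r > 0"
  shows "pd (cone_chart c) snd (p, r) (u, s) = s"
proof -
  have o: "open (snd c ` fst c \<times> {0::real<..})" using c by (auto simp: is_chart_def intro: open_Times)
  have "((\<lambda>x. snd (chart_inv (cone_chart c) x)) has_derivative snd) (at (snd c p, r))"
    by (rule has_derivative_transform_within_open[OF bounded_linear_imp_has_derivative[OF bounded_linear_snd] o])
      (use p r c in \<open>auto simp: cone_chart_inv\<close>)
  then have "pd (cone_chart c) snd (p, r) = snd"
    by (intro pd_eqI) (simp add: snd_cone_chart)
  then show ?thesis by simp
qed

lemma smooth_in_cone_change:
  assumes A: "smooth_atlas A" "c \<in> A" "d \<in> A"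
  shows "smooth_in (cone_chart c) ((fst c \<inter> fst d) \<times> {0<..}) (snd (cone_chart d))"
proof -
  note s = smooth_atlasD(2)[OF A]
  show ?thesis
    unfolding snd_cone_chart[abs_def]
    by (rule smooth_in_Pair[OF smooth_in_cone_fst[OF s] smooth_in_cone_snd[OF smooth_inD(1-3)[OF s]]])
qed

lemma smooth_atlas_cone:
  assumes A: "smooth_atlas A"
  shows "smooth_atlas (cone_atlas A)"
proof -
  have "smooth_on (snd (cone_chart c) ` (fst (cone_chart c) \<inter> fst (cone_chart d))) (snd (cone_chart d) \<circ> chart_inv (cone_chart c))"
    if "c \<in> A" "d \<in> A" for c d
  proof -
    have "fst (cone_chart c) \<inter> fst (cone_chart d) = (fst c \<inter> fst d) \<times> {0<..}"
      by (auto simp: fst_cone_chart)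
    then show ?thesis
      using smooth_inD(5)[OF smooth_in_cone_change[OF A that]] by (simp add: o_def)
  qed
  moreover have "is_chart (cone_chart c)" if "c \<in> A" for c
    using is_chart_cone_chart smooth_atlasD(1)[OF A that that] by blast
  ultimately show ?thesis by (auto simp: smooth_atlas_def cone_atlas_def)
qed

text \<open>A change of cone charts leaves r fixed, so transformation laws on the cone reduce to
  those on the base.\<close>

lemma pd_cone_change:
  assumes A: "smooth_atlas A" "c \<in> A" "d \<in> A" and p: "p \<in> fst c" "p \<in> fst d" and r: "r > 0"
  shows "pd (cone_chart c) (snd (cone_chart d)) (p, r) (u, s) = (pd c (snd d) p u, s)"
proof -
  note s = smooth_atlasD(2)[OF A]
  have p': "p \<in> fst c \<inter> fst d" using p by simp
  show ?thesis
    unfolding snd_cone_chart[abs_def]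
    by (subst pd_Pair[OF smooth_in_cone_fst[OF s] smooth_in_cone_snd[OF smooth_inD(1-3)[OF s]]])
      (use p r in \<open>auto simp: pd_cone_fst[OF s p' r] pd_cone_snd smooth_inD(1)[OF s]\<close>)
qed

section \<open>The cone over a K-contact manifold\<close>

lemma cone_metric_cone_chart:
  "cone_metric g (cone_chart c) z U V = snd U * snd V + (snd z)\<^sup>2 * g c (fst z) (fst U) (fst V)"
  by (simp add: cone_metric_def base_chart_cone_chart case_prod_beta)

lemma cone_J_cone_chart:
  "cone_J \<phi> \<eta> \<xi> (cone_chart c) z U =
    (\<phi> c (fst z) (fst U) - (snd U / snd z) *\<^sub>R \<xi> c (fst z), snd z * \<eta> c (fst z) (fst U))"
  by (simp add: cone_J_def base_chart_cone_chart case_prod_beta)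

locale k_contact_manifold =
  fixes A :: "('p::{t2_space,second_countable_topology}, 'e::euclidean_space) chart set"
    and m :: nat and \<phi> :: "('p, 'e) endo" and \<eta> :: "('p, 'e) oneform"
    and \<xi> :: "('p, 'e) vfield" and g :: "('p, 'e) bform"
  assumes k_contact: "k_contact A m \<phi> \<eta> \<xi> g"
begin

abbreviation "CJ \<equiv> cone_J \<phi> \<eta> \<xi>"

lemma fields:
  shows "smooth_atlas A" "riemannian_metric A g" "vector_field A \<xi>" "endo_field A \<phi>" "one_form A \<eta>"
  using k_contact by (auto simp: k_contact_def contact_riemannian_def contact_form_def)

lemma chart_locale: "c \<in> A \<Longrightarrow> k_contact_chart A g c m \<phi> \<xi>"
  by (rule k_contact_chart(1)[OF k_contact])

lemma point_locale: "c \<in> A \<Longrightarrow> p \<in> fst c \<Longrightarrow> k_contact_point A g c m \<phi> \<xi> p"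
  using chart_locale k_contact_chart.axioms(1)
  by (intro k_contact_point.intro riem_point.intro riem_point_axioms.intro) blast+

lemma \<eta>_eq: "c \<in> A \<Longrightarrow> q \<in> fst c \<Longrightarrow> \<eta> c q u = g c q (\<xi> c q) u"
  by (rule k_contact_chart(2)[OF k_contact])

sublocale riem_atlas A g using fields by unfold_locales

lemma smooth_\<eta>: "c \<in> A \<Longrightarrow> smooth_in c (fst c) (\<lambda>q. \<eta> c q u)"
proof -
  assume c: "c \<in> A"
  then have "chart_smooth c (\<lambda>q. \<eta> c q u)" using fields(5) by (simp add: one_form_def)
  then show ?thesis using smooth_in_chart_smooth[OF smooth_atlasD(1)[OF atlas c c], of "\<lambda>q. \<eta> c q u"] by simp
qed

lemma riemannian_metric_cone: "riemannian_metric (cone_atlas A) (cone_metric g)"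
proof -
  have "chart_smooth (cone_chart c) (\<lambda>z. cone_metric g (cone_chart c) z U V)"
    if c: "c \<in> A" for c and U V :: "'e \<times> real"
  proof -
    interpret k_contact_chart A g c m \<phi> \<xi> by (rule chart_locale[OF c])
    have "smooth_in (cone_chart c) (fst (cone_chart c)) (\<lambda>z. cone_metric g (cone_chart c) z U V)"
      unfolding cone_metric_cone_chart power2_eq_square fst_cone_chart
      using smooth_in_const[OF is_chart_cone_chart[OF chart(1)], of "fst c \<times> {0<..}"] chart
      by (intro smooth_in_add smooth_in_mult smooth_in_cone_fst[OF smooth_g] smooth_in_cone_snd)
        (simp_all add: fst_cone_chart open_Times)
    then show ?thesis by (simp add: smooth_in_chart_smooth[OF is_chart_cone_chart[OF chart(1)]])
  qed
  moreover have "bilinear (cone_metric g (cone_chart c) z)"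
    "cone_metric g (cone_chart c) z U V = cone_metric g (cone_chart c) z V U"
    "U \<noteq> 0 \<Longrightarrow> cone_metric g (cone_chart c) z U U > 0"
    if c: "c \<in> A" and z: "z \<in> fst (cone_chart c)" for c z U V
  proof -
    have p: "fst z \<in> fst c" and r: "snd z > 0" using z by (auto simp: fst_cone_chart)
    interpret k_contact_point A g c m \<phi> \<xi> "fst z" by (rule point_locale[OF c p])
    show "bilinear (cone_metric g (cone_chart c) z)"
      unfolding bilinear_def by (auto intro!: linearI simp: cone_metric_cone_chart simps algebra_simps)
    show "cone_metric g (cone_chart c) z U V = cone_metric g (cone_chart c) z V U"
      by (simp add: cone_metric_cone_chart sym)
    assume "U \<noteq> 0"
    then consider "fst U \<noteq> 0" | "fst U = 0" "snd U \<noteq> 0" by (metis prod_eq_iff fst_zero snd_zero)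
    then show "cone_metric g (cone_chart c) z U U > 0"
    proof cases
      case 1
      then show ?thesis
        using r pos[OF 1] by (auto simp: cone_metric_cone_chart intro!: add_nonneg_pos mult_pos_pos)
    next
      case 2
      then show ?thesis
        using r by (auto simp: cone_metric_cone_chart simps zero_less_mult_iff linorder_neq_iff)
    qed
  qed
  moreover have "cone_metric g (cone_chart d) z (pd (cone_chart c) (snd (cone_chart d)) z U)
      (pd (cone_chart c) (snd (cone_chart d)) z V) = cone_metric g (cone_chart c) z U V"
    if c: "c \<in> A" and d: "d \<in> A" and z: "z \<in> fst (cone_chart c) \<inter> fst (cone_chart d)" for c d z U V
  proof -
    obtain p r u s v t where [simp]: "z = (p, r)" "U = (u, s)" "V = (v, t)" by (metis prod.exhaust)
    have p: "p \<in> fst c" "p \<in> fst d" "r > 0" using z by (auto simp: fst_cone_chart)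
    have "g d p (pd c (snd d) p u) (pd c (snd d) p v) = g c p u v"
      using metric c d p by (simp add: riemannian_metric_def)
    then show ?thesis using p by (simp add: pd_cone_change[OF atlas c d] cone_metric_cone_chart)
  qed
  ultimately show ?thesis by (auto simp: riemannian_metric_def cone_atlas_def)
qed

lemma smooth_cone_J:
  assumes c: "c \<in> A"
  shows "smooth_in (cone_chart c) (fst (cone_chart c)) (\<lambda>z. CJ (cone_chart c) z U)"
proof -
  interpret k_contact_chart A g c m \<phi> \<xi> by (rule chart_locale[OF c])
  show ?thesis
    unfolding cone_J_cone_chart fst_cone_chart
    using smooth_in_const[OF is_chart_cone_chart[OF chart(1)], of "fst c \<times> {0<..}"] chart
    by (intro smooth_in_Pair smooth_in_diff smooth_in_scaleR smooth_in_mult smooth_in_divide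
        smooth_in_cone_fst[OF smooth_\<phi>] smooth_in_cone_fst[OF smooth_\<xi>] smooth_in_cone_fst[OF smooth_\<eta>[OF c]]
        smooth_in_cone_snd) (auto simp: fst_cone_chart open_Times)
qed

lemma linear_cone_J:
  assumes c: "c \<in> A" and z: "z \<in> fst (cone_chart c)"
  shows "linear (CJ (cone_chart c) z)"
proof -
  have p: "fst z \<in> fst c" using z by (auto simp: fst_cone_chart)
  interpret k_contact_point A g c m \<phi> \<xi> "fst z" by (rule point_locale[OF c p])
  show ?thesis
    by (rule linearI) (auto simp: cone_J_cone_chart \<eta>_eq[OF c p] F_simps simps algebra_simps add_divide_distrib)
qed

lemma cone_J_cone_J:
  assumes c: "c \<in> A" and z: "z \<in> fst (cone_chart c)"
  shows "CJ (cone_chart c) z (CJ (cone_chart c) z U) = - U"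
proof -
  have p: "fst z \<in> fst c" and r: "snd z > 0" using z by (auto simp: fst_cone_chart)
  interpret k_contact_point A g c m \<phi> \<xi> "fst z" by (rule point_locale[OF c p])
  show ?thesis
    using r by (auto simp: prod_eq_iff cone_J_cone_chart \<eta>_eq[OF c p] F_simps FF F_x G_x_F x_unit simps)
qed

lemma cone_metric_cone_J:
  assumes c: "c \<in> A" and z: "z \<in> fst (cone_chart c)"
  shows "cone_metric g (cone_chart c) z (CJ (cone_chart c) z U) (CJ (cone_chart c) z V) =
    cone_metric g (cone_chart c) z U V"
proof -
  have p: "fst z \<in> fst c" and r: "snd z > 0" using z by (auto simp: fst_cone_chart)
  interpret k_contact_point A g c m \<phi> \<xi> "fst z" by (rule point_locale[OF c p])
  have FF': "G (F a) (F b) = G a b - G x a * G x b" for a b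
    using sym[of a x] by (simp add: F_skew FF simps)
  have "(snd z)\<^sup>2 * (snd U / snd z * (snd V / snd z)) = snd U * snd V"
    using r by (simp add: power2_eq_square)
  then show ?thesis
    by (simp add: cone_metric_cone_chart cone_J_cone_chart \<eta>_eq[OF c p] simps FF' G_x_F x_unit)
      (simp add: algebra_simps power2_eq_square)
qed

lemma endo_field_cone: "endo_field (cone_atlas A) CJ"
proof -
  have "CJ (cone_chart d) z (pd (cone_chart c) (snd (cone_chart d)) z U) =
      pd (cone_chart c) (snd (cone_chart d)) z (CJ (cone_chart c) z U)"
    if c: "c \<in> A" and d: "d \<in> A" and z: "z \<in> fst (cone_chart c) \<inter> fst (cone_chart d)" for c d z U
  proof -
    obtain p r u s where [simp]: "z = (p, r)" "U = (u, s)" by (metis prod.exhaust)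
    have p: "p \<in> fst c" "p \<in> fst d" "r > 0" using z by (auto simp: fst_cone_chart)
    interpret ch: riem_charts A g c d p by (rule riem_charts[OF c d p(1,2)])
    have "\<phi> d p (ch.J u) = ch.J (\<phi> c p u)" "\<eta> d p (ch.J u) = \<eta> c p u"
      using fields(4,5) c d p by (auto simp: endo_field_def one_form_def)
    moreover have "\<xi> d p = ch.J (\<xi> c p)" by (rule ch.vector_field_change[OF fields(3)])
    ultimately show ?thesis
      using p by (simp add: pd_cone_change[OF atlas c d] cone_J_cone_chart linear_diff[OF ch.J_linear(1)]
        linear_cmul[OF ch.J_linear(1)])
  qed
  moreover have "chart_smooth (cone_chart c) (\<lambda>z. CJ (cone_chart c) z U)" if c: "c \<in> A" for c U
    using smooth_cone_J[OF c] smooth_in_chart_smooth[OF is_chart_cone_chart[OF smooth_atlasD(1)[OF atlas c c]]]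
    by blast
  ultimately show ?thesis using linear_cone_J by (auto simp: endo_field_def cone_atlas_def)
qed

text \<open>In invariant terms (\<nabla>\<eta>)(w, v) = g(w, \<phi> v), which is \<nabla>\<xi> = -
  \<phi> with the index lowered.\<close>

lemma pd_\<eta>:
  assumes c: "c \<in> A" and p: "p \<in> fst c"
  shows "pd c (\<lambda>q. \<eta> c q v) p w = g c p w (\<phi> c p v) + \<eta> c p (christoffel g c p w v)"
proof -
  interpret k_contact_point A g c m \<phi> \<xi> p by (rule point_locale[OF c p])
  have "pd c (\<lambda>q. \<eta> c q v) p w = pd c (\<lambda>q. g c q (\<xi> c q) v) p w"
    by (rule pd_cong[OF smooth_in_bilinear_apply[OF g_bilinear smooth_g smooth_\<xi> smooth_const] p, THEN fun_cong])
      (simp_all add: \<eta>_eq[OF c])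
  then show ?thesis
    by (simp add: pd_bilinear_apply[OF g_bilinear smooth_g smooth_\<xi> smooth_const p] pd_g[OF p] pd_\<xi>[OF p]
      simps F_skew \<eta>_eq[OF c p])
qed

text \<open>The form is d(r^2 \<eta>), but closedness is verified directly: the dr-terms cancel by
  skewness of \<phi>, the \<Gamma>-terms by symmetry of \<Gamma>, and the r^2-terms leave the cyclic
  sum of \<open>N_cyclic\<close>.\<close>

lemma cone_form_closed:
  assumes c: "c \<in> A" and z: "z \<in> fst (cone_chart c)"
    and X: "smooth_in (cone_chart c) (fst (cone_chart c)) (X (cone_chart c))"
    and Y: "smooth_in (cone_chart c) (fst (cone_chart c)) (Y (cone_chart c))"
    and Z: "smooth_in (cone_chart c) (fst (cone_chart c)) (Z (cone_chart c))"
  shows "ext_d2 (\<lambda>C z U V. cone_metric g C z U (CJ C z V)) X Y Z (cone_chart c) z = 0"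
proof -
  let ?C = "cone_chart c"
  obtain p r where z_eq: "z = (p, r)" by (metis prod.exhaust)
  have p: "p \<in> fst c" and r: "r > 0" using z by (auto simp: fst_cone_chart z_eq)
  interpret k_contact_point A g c m \<phi> \<xi> p by (rule point_locale[OF c p])
  let ?\<omega> = "\<lambda>C z U V. cone_metric g C z U (CJ C z V)"
  \<comment> \<open>The first term is the part with dr and \<eta>, the second is r^2
    d\<eta>.\<close>
  have \<omega>: "?\<omega> ?C q U V = snd q * (snd U * \<eta> c (fst q) (fst V) - snd V * \<eta> c (fst q) (fst U))
      + snd q * snd q * g c (fst q) (fst U) (\<phi> c (fst q) (fst V))"
    if "q \<in> fst ?C" for q U V
  proof -
    have q: "fst q \<in> fst c" "snd q > 0" using that by (auto simp: fst_cone_chart)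
    interpret q: k_contact_point A g c m \<phi> \<xi> "fst q" by (rule point_locale[OF c q(1)])
    show ?thesis
      using q(2) by (simp add: cone_metric_cone_chart cone_J_cone_chart q.simps \<eta>_eq[OF c q(1)] q.sym[of _ "\<xi> c (fst q)"])
        (simp add: field_simps power2_eq_square)
  qed
  have bil: "bilinear (?\<omega> ?C q)" if "q \<in> fst ?C" for q
  proof -
    have q: "fst q \<in> fst c" "snd q > 0" using that by (auto simp: fst_cone_chart)
    interpret q: k_contact_point A g c m \<phi> \<xi> "fst q" by (rule point_locale[OF c q(1)])
    show ?thesis
      unfolding bilinear_def
      by (auto intro!: linearI simp: \<omega>[OF that] \<eta>_eq[OF c q(1)] q.simps q.F_simps algebra_simps)
  qed
  have s\<Phi>: "smooth_c (\<lambda>q. g c q u (\<phi> c q v))" for u v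
    by (rule smooth_in_bilinear_apply[OF g_bilinear smooth_g smooth_const smooth_\<phi>])
  note snd_smooth = smooth_in_cone_snd[OF chart order_refl]
  have const: "smooth_in ?C (fst c \<times> {0<..}) (\<lambda>q. k)" for k :: real
    using chart by (intro smooth_in_const is_chart_cone_chart) (auto simp: fst_cone_chart open_Times)
  note s1 = smooth_in_diff[OF smooth_in_mult[OF const smooth_in_cone_fst[OF smooth_\<eta>[OF c]]]
      smooth_in_mult[OF const smooth_in_cone_fst[OF smooth_\<eta>[OF c]]]]
  note s2 = smooth_in_mult[OF snd_smooth snd_smooth]
  note s3 = smooth_in_add[OF smooth_in_mult[OF snd_smooth s1] smooth_in_mult[OF s2 smooth_in_cone_fst[OF s\<Phi>]]]
  have sm: "smooth_in ?C (fst ?C) (\<lambda>q. ?\<omega> ?C q U V)" for U V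
    by (subst smooth_in_cong[OF \<omega>], assumption) (unfold fst_cone_chart, rule s3)
  have z': "(p, r) \<in> fst c \<times> {0<..}" using p r by simp
  have pd_\<Phi>: "pd c (\<lambda>q. g c q u (\<phi> c q v)) p w =
      G u (N w v) + G (\<Gamma> p w u) (F v) + G u (F (\<Gamma> p w v))" for u v w
    by (simp add: pd_bilinear_apply[OF g_bilinear smooth_g smooth_const smooth_\<phi> p] pd_g[OF p] N_def simps)
  have pd_\<omega>: "pd ?C (\<lambda>q. ?\<omega> ?C q (u, s) (v, t)) (p, r) (w, k) =
      k * (s * \<eta> c p v - t * \<eta> c p u) + r * (s * pd c (\<lambda>q. \<eta> c q v) p w - t * pd c (\<lambda>q. \<eta> c q u) p w)
      + 2 * r * k * G u (F v) + r * r * pd c (\<lambda>q. g c q u (\<phi> c q v)) p w" for u s v t w k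
  proof -
    let ?h = "\<lambda>q. snd q * (s * \<eta> c (fst q) v - t * \<eta> c (fst q) u) + snd q * snd q * g c (fst q) u (\<phi> c (fst q) v)"
    have "pd ?C (\<lambda>q. ?\<omega> ?C q (u, s) (v, t)) (p, r) (w, k) = pd ?C ?h (p, r) (w, k)"
      by (rule pd_cong[OF s3 z', THEN fun_cong]) (simp add: \<omega> fst_cone_chart)
    also have "\<dots> =
      k * (s * \<eta> c p v - t * \<eta> c p u) + r * (s * pd c (\<lambda>q. \<eta> c q v) p w - t * pd c (\<lambda>q. \<eta> c q u) p w)
      + 2 * r * k * G u (F v) + r * r * pd c (\<lambda>q. g c q u (\<phi> c q v)) p w"
      by (simp add: pd_add[OF smooth_in_mult[OF snd_smooth s1] smooth_in_mult[OF s2 smooth_in_cone_fst[OF s\<Phi>]] z']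
        pd_mult[OF snd_smooth s1 z'] pd_mult[OF s2 smooth_in_cone_fst[OF s\<Phi>] z'] pd_mult[OF snd_smooth snd_smooth z']
        pd_diff[OF smooth_in_mult[OF const smooth_in_cone_fst[OF smooth_\<eta>[OF c]]]
          smooth_in_mult[OF const smooth_in_cone_fst[OF smooth_\<eta>[OF c]]] z']
        pd_mult[OF const smooth_in_cone_fst[OF smooth_\<eta>[OF c]] z']
        pd_cone_fst[OF smooth_\<eta>[OF c] p r] pd_cone_fst[OF s\<Phi> p r] pd_cone_snd[OF chart(1) p r])
    finally show ?thesis .
  qed
  obtain u s v t w k where V: "X ?C z = (u, s)" "Y ?C z = (v, t)" "Z ?C z = (w, k)" by (metis prod.exhaust)
  have \<Phi>_alt: "G a (F b) = - G b (F a)" for a b using F_skew[of a b] sym[of b "F a"] by simp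
  have cyc: "G u (N w v) + G v (N u w) + G w (N v u) = 0"
    using N_cyclic[of w v u] sym[of u "N w v"] sym[of v "N u w"] sym[of w "N v u"] by simp
  have alt: "?\<omega> ?C z U V = - ?\<omega> ?C z V U" for U V
    using \<Phi>_alt[of "fst U" "fst V"] by (simp add: \<omega>[OF z]) (simp add: z_eq algebra_simps)
  \<comment> \<open>Solved for one summand so that the simplifier can eliminate it.\<close>
  have cyc': "G u (N w v) = - G v (N u w) - G w (N v u)" using cyc by linarith
  note eqs = cyc' \<Phi>_alt[of v u] \<Phi>_alt[of w v] \<Phi>_alt[of w u] christoffel_commute[OF p, of v u]
    christoffel_commute[OF p, of w v] christoffel_commute[OF p, of w u]
    \<Phi>_alt[of w "\<Gamma> p u v"] \<Phi>_alt[of u "\<Gamma> p v w"] \<Phi>_alt[of v "\<Gamma> p u w"]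
  have ext: "3 * ext_d2 ?\<omega> X Y Z ?C z =
      pd ?C (\<lambda>q. ?\<omega> ?C q (v, t) (w, k)) z (u, s) + pd ?C (\<lambda>q. ?\<omega> ?C q (w, k) (u, s)) z (v, t)
      + pd ?C (\<lambda>q. ?\<omega> ?C q (u, s) (v, t)) z (w, k)"
    unfolding V[symmetric]
    by (rule ext_d2_tensorial[where \<omega>="?\<omega>" and C="?C" and X=X and Y=Y and Z=Z and z=z, OF is_chart_cone_chart[OF chart(1)] z bil sm alt X Y Z])
  have "3 * ext_d2 ?\<omega> X Y Z ?C z = 0"
    unfolding ext unfolding z_eq pd_\<omega> pd_\<Phi> pd_\<eta>[OF c p]
    by (simp add: eqs) (simp add: algebra_simps)
  then show ?thesis by simp
qed

lemma pd_cone_J: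
  assumes c: "c \<in> A" and p: "p \<in> fst c" and r: "r > 0"
  shows "pd (cone_chart c) (\<lambda>q. CJ (cone_chart c) q (v, t)) (p, r) (u, s) =
    (pd c (\<lambda>q. \<phi> c q v) p u - (t / r) *\<^sub>R pd c (\<xi> c) p u + (s * t / (r * r)) *\<^sub>R \<xi> c p,
     s * \<eta> c p v + r * pd c (\<lambda>q. \<eta> c q v) p u)"
proof -
  interpret k_contact_point A g c m \<phi> \<xi> p by (rule point_locale[OF c p])
  let ?C = "cone_chart c" and ?U = "fst c \<times> {0::real<..}"
  note snd_smooth = smooth_in_cone_snd[OF chart order_refl]
  have const: "smooth_in ?C ?U (\<lambda>q. k)" for k :: real
    using chart by (intro smooth_in_const is_chart_cone_chart) (auto simp: fst_cone_chart open_Times)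
  have z': "(p, r) \<in> ?U" using p r by simp
  have sd: "smooth_in ?C ?U (\<lambda>q. t / snd q)"
    by (rule smooth_in_divide[OF const snd_smooth]) auto
  \<comment> \<open>The derivative of t/r is found from the product rule for (t/r) r, which is the
    constant t.\<close>
  have "pd ?C (\<lambda>q. t / snd q * snd q) (p, r) (u, s) = t / r * s + pd ?C (\<lambda>q. t / snd q) (p, r) (u, s) * r"
    using pd_mult[OF sd snd_smooth z', of "(u, s)"] by (simp only: pd_cone_snd[OF chart(1) p r] snd_conv)
  moreover have "pd ?C (\<lambda>q. t / snd q * snd q) (p, r) (u, s) = 0"
    by (rule trans[OF pd_cong[OF const[of t] z', THEN fun_cong] pd_const]) auto
  ultimately have "t / r * s + pd ?C (\<lambda>q. t / snd q) (p, r) (u, s) * r = 0" by simp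
  then have pd_inv: "pd ?C (\<lambda>q. t / snd q) (p, r) (u, s) = - (s * t / (r * r))"
    using r by (simp add: field_simps)
  note sx = smooth_in_scaleR[OF sd smooth_in_cone_fst[OF smooth_\<xi>]]
  note s\<eta> = smooth_in_cone_fst[OF smooth_\<eta>[OF c]] and s\<phi> = smooth_in_cone_fst[OF smooth_\<phi>]
  show ?thesis
    unfolding cone_J_cone_chart fst_conv snd_conv
    by (simp add: pd_Pair[OF smooth_in_diff[OF s\<phi> sx] smooth_in_mult[OF snd_smooth s\<eta>] z']
      pd_diff[OF s\<phi> sx z'] pd_scaleR[OF sd smooth_in_cone_fst[OF smooth_\<xi>] z'] pd_mult[OF snd_smooth s\<eta> z']
      pd_inv pd_cone_fst[OF smooth_\<phi> p r] pd_cone_fst[OF smooth_\<xi> p r] pd_cone_fst[OF smooth_\<eta>[OF c] p r]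
      pd_cone_snd[OF chart(1) p r])
qed

text \<open>Of the Kaehler conditions on the cone this is the one that uses the Sasakian curvature
  condition, through the explicit formula for \<nabla>\<phi>.\<close>

lemma cone_nijenhuis:
  assumes c: "c \<in> A" and z: "z \<in> fst (cone_chart c)"
    and sas: "\<And>u v. curvature g c (fst z) u v (\<xi> c (fst z)) =
      g c (fst z) (\<xi> c (fst z)) v *\<^sub>R u - g c (fst z) (\<xi> c (fst z)) u *\<^sub>R v"
    and X: "smooth_in (cone_chart c) (fst (cone_chart c)) (X (cone_chart c))"
    and Y: "smooth_in (cone_chart c) (fst (cone_chart c)) (Y (cone_chart c))"
  shows "nijenhuis CJ X Y (cone_chart c) z = 0"
proof -
  let ?C = "cone_chart c"
  obtain p r where z_eq: "z = (p, r)" by (metis prod.exhaust)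
  have p: "p \<in> fst c" and r: "r > 0" using z by (auto simp: fst_cone_chart z_eq)
  interpret k_contact_point A g c m \<phi> \<xi> p by (rule point_locale[OF c p])
  have Ns: "N u v = G u v *\<^sub>R x - G x v *\<^sub>R u" for u v
    by (rule N_sasakian) (use sas in \<open>simp add: z_eq\<close>)
  \<comment> \<open>Ordinary derivatives of \<phi>, \<xi>, \<eta> are traded for \<nabla>\<phi>,
    \<phi> and \<Gamma>-terms, and \<open>v'\<close> is the base component of the image of (v, t)
    under \<open>CJ\<close>. In this form the \<Gamma>-terms of the Nijenhuis tensor cancel by
    symmetry.\<close>
  have P: "pd ?C (\<lambda>q. CJ ?C q (v, t)) (p, r) (u, s) =
      (N u v - \<Gamma> p u v' + F (\<Gamma> p u v) + (t / r) *\<^sub>R F u + (s * t / (r * r)) *\<^sub>R x,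
       s * G x v + r * (G u (F v) + G x (\<Gamma> p u v)))"
    if "v' = F v - (t / r) *\<^sub>R x" for u v v' s t
    unfolding pd_cone_J[OF c p r] pd_\<eta>[OF c p] \<eta>_eq[OF c p] pd_\<xi>[OF p] N_def that
    by (simp add: \<Gamma>_simps algebra_simps)
  obtain u s v t where V: "X ?C z = (u, s)" "Y ?C z = (v, t)" by (metis prod.exhaust)
  define u' where "u' = F u - (s / r) *\<^sub>R x"
  define v' where "v' = F v - (t / r) *\<^sub>R x"
  have J: "CJ ?C (p, r) (u, s) = (u', r * G x u)" "CJ ?C (p, r) (v, t) = (v', r * G x v)"
    by (simp_all add: cone_J_cone_chart u'_def v'_def \<eta>_eq[OF c p])
  note comm = christoffel_commute[OF p, of v u] christoffel_commute[OF p, of v' u'] christoffel_commute[OF p, of v' u]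
    christoffel_commute[OF p, of v u']
  have Fu': "F u' = - u + G x u *\<^sub>R x" "F v' = - v + G x v *\<^sub>R x"
    by (simp_all add: u'_def v'_def F_simps F_x FF)
  have G_uv: "G (F u) v = - G u (F v)" "G v (F u) = - G u (F v)" "G (F v) u = G u (F v)" "G v u = G u v"
    "G u x = G x u" "G v x = G x v"
    using F_skew[of u v] F_skew[of v u] sym by metis+
  have G_u'v': "G u' (F v) = - G x u * G x v + G u v" "G v' (F u) = - G x u * G x v + G u v"
    by (simp_all add: u'_def v'_def simps F_skew FF G_uv G_x_F)
  \<comment> \<open>The component tangent to the base.\<close>
  have 1: "N u' v - \<Gamma> p u' v' + F (\<Gamma> p u' v) + (t / r) *\<^sub>R F u' + (r * G x u * t / (r * r)) *\<^sub>R x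
     - (N v' u - \<Gamma> p v' u' + F (\<Gamma> p v' u) + (s / r) *\<^sub>R F v' + (r * G x v * s / (r * r)) *\<^sub>R x)
     + (F (N v u - \<Gamma> p v u' + F (\<Gamma> p v u) + (s / r) *\<^sub>R F v + (t * s / (r * r)) *\<^sub>R x)
         - ((t * G x u + r * (G v (F u) + G x (\<Gamma> p v u))) / r) *\<^sub>R x)
     - (F (N u v - \<Gamma> p u v' + F (\<Gamma> p u v) + (t / r) *\<^sub>R F u + (s * t / (r * r)) *\<^sub>R x)
         - ((s * G x v + r * (G u (F v) + G x (\<Gamma> p u v))) / r) *\<^sub>R x) = 0" (is "?L = 0")
  proof -
    have "?L = (N u' v - N v' u) + F (N v u - N u v)
      + (t / r) *\<^sub>R (F u' - F (F u)) - (s / r) *\<^sub>R (F v' - F (F v))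
      + (G x u * t / r - G x v * s / r) *\<^sub>R x
      - ((t * G x u + r * G v (F u)) / r - (s * G x v + r * G u (F v)) / r) *\<^sub>R x"
      unfolding comm using r by (simp add: F_simps F_x algebra_simps add_divide_distrib)
    also have "\<dots> = 0"
      unfolding Ns Fu' FF
      by (rule nondegenerate) (use r in \<open>simp add: simps F_simps F_x u'_def v'_def G_uv field_simps\<close>)
    finally show ?thesis .
  qed
  \<comment> \<open>The radial component; by \<open>G_u'v'\<close> its two \<phi>-terms agree, and
    \<nabla>\<phi> contributes symmetrically in u and v.\<close>
  have 2: "r * G x u * G x v + r * (G u' (F v) + G x (\<Gamma> p u' v))
     - (r * G x v * G x u + r * (G v' (F u) + G x (\<Gamma> p v' u)))
     + r * G x (N v u - \<Gamma> p v u' + F (\<Gamma> p v u) + (s / r) *\<^sub>R F v + (t * s / (r * r)) *\<^sub>R x)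
     - r * G x (N u v - \<Gamma> p u v' + F (\<Gamma> p u v) + (t / r) *\<^sub>R F u + (s * t / (r * r)) *\<^sub>R x) = 0"
    unfolding comm Ns G_u'v' by (simp add: simps G_x_F x_unit G_uv algebra_simps)
  have nij: "nijenhuis CJ X Y ?C z =
      pd ?C (\<lambda>q. CJ ?C q (v, t)) z (CJ ?C z (u, s)) - pd ?C (\<lambda>q. CJ ?C q (u, s)) z (CJ ?C z (v, t))
      + CJ ?C z (pd ?C (\<lambda>q. CJ ?C q (u, s)) z (v, t)) - CJ ?C z (pd ?C (\<lambda>q. CJ ?C q (v, t)) z (u, s))"
    unfolding V[symmetric]
    by (rule nijenhuis_tensorial[where J=CJ and C="?C" and X=X and Y=Y and z=z, OF is_chart_cone_chart[OF chart(1)] z linear_cone_J[OF c]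
      smooth_cone_J[OF c] cone_J_cone_J[OF c z] X Y])
  show ?thesis
    unfolding nij unfolding z_eq J P[OF u'_def] P[OF v'_def]
    by (simp only: cone_J_cone_chart \<eta>_eq[OF c p] fst_conv snd_conv diff_Pair add_Pair 1 2 zero_prod_def)
qed

lemma kaehler_cone:
  assumes sas: "\<And>c p u v. c \<in> A \<Longrightarrow> p \<in> fst c \<Longrightarrow>
    curvature g c p u v (\<xi> c p) = g c p (\<xi> c p) v *\<^sub>R u - g c p (\<xi> c p) u *\<^sub>R v"
  shows "kaehler (cone_atlas A) (cone_metric g) CJ"
proof -
  have s: "smooth_in (cone_chart c) (fst (cone_chart c)) (X (cone_chart c))"
    if "vector_field (cone_atlas A) X" "c \<in> A" for X c
    by (rule vector_fieldD(1)[OF smooth_atlas_cone[OF atlas] that(1)]) (simp add: cone_atlas_def that)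
  have "integrable_acs (cone_atlas A) CJ"
    unfolding integrable_acs_def vanishes_def
  proof (intro allI impI ballI)
    fix X Y C z
    assume X: "vector_field (cone_atlas A) X" and Y: "vector_field (cone_atlas A) Y"
      and C: "C \<in> cone_atlas A" and z: "z \<in> fst C"
    then obtain c where c: "c \<in> A" "C = cone_chart c" by (auto simp: cone_atlas_def)
    have "fst z \<in> fst c" using z by (auto simp: c fst_cone_chart)
    then show "nijenhuis CJ X Y C z = 0"
      using cone_nijenhuis[where X=X and Y=Y and c=c and z=z] sas s[OF X c(1)] s[OF Y c(1)] z c by simp
  qed
  moreover have "almost_kaehler (cone_atlas A) (cone_metric g) CJ"
    unfolding almost_kaehler_def
    using smooth_atlas_cone[OF atlas] riemannian_metric_cone endo_field_cone cone_J_cone_J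
      cone_metric_cone_J cone_form_closed s
    by (auto simp: cone_atlas_def)
  ultimately show ?thesis by (simp add: kaehler_def)
qed

end

section \<open>Weakly conformally flat K-contact manifolds\<close>

context k_contact_manifold
begin

lemma weyl_vector_fields:
  assumes "vector_field A X" "vector_field A Y" "c \<in> A" "p \<in> fst c"
  shows "weyl g X Y \<xi> c p = riem_point.weyl_tensor g c p (X c p) (Y c p) (\<xi> c p)"
  by (rule riem_point.weyl_eq_weyl_tensor[OF riem_point[OF assms(3,4)]])
    (intro vector_fieldD(1)[OF atlas] assms fields)+

lemma weyl_\<xi>_\<xi>_vanishes_iff:
  "(\<forall>X. vector_field A X \<longrightarrow> vanishes A (weyl g X \<xi> \<xi>)) \<longleftrightarrow>
    (\<forall>c\<in>A. \<forall>p\<in>fst c. \<forall>u. riem_point.weyl_tensor g c p u (\<xi> c p) (\<xi> c p) = 0)" (is "?L \<longleftrightarrow> ?R")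
proof
  assume L: ?L
  show ?R
  proof (intro ballI allI)
    fix c p u assume c: "c \<in> A" and p: "p \<in> fst c"
    obtain X where X: "vector_field A X" "X c p = u" using vector_field_extension[OF atlas c p] .
    then show "riem_point.weyl_tensor g c p u (\<xi> c p) (\<xi> c p) = 0"
      using L c p weyl_vector_fields[OF X(1) fields(3) c p] by (simp add: vanishes_def)
  qed
next
  assume ?R
  then show ?L by (simp add: vanishes_def weyl_vector_fields fields)
qed

lemma \<eta>_einstein_if_weyl_\<xi>_\<xi>:
  assumes m: "m \<ge> 2"
    and W: "\<And>c p u. c \<in> A \<Longrightarrow> p \<in> fst c \<Longrightarrow> riem_point.weyl_tensor g c p u (\<xi> c p) (\<xi> c p) = 0"
  shows "eta_einstein A g \<eta>"
  unfolding eta_einstein_def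
proof (intro exI conjI allI impI ballI)
  \<comment> \<open>The coefficients \<open>coeff_a\<close> and \<open>coeff_b\<close>, written with
    the chart-free scalar curvature so that they become functions on the manifold.\<close>
  let ?a = "\<lambda>p. scalar_curvature p / (2 * real m) - 1"
  let ?b = "\<lambda>p. (2 * real m + 1) - scalar_curvature p / (2 * real m)"
  have *: "chart_smooth c ?a" "chart_smooth c ?b" if c: "c \<in> A" for c
  proof -
    note chart = smooth_atlasD(1)[OF atlas c c]
    note const = smooth_in_const[OF chart open_chart_domain[OF chart] order_refl]
    note s = smooth_in_bounded_linear[OF bounded_linear_divide smooth_scalar_curvature[OF c]]
    show "chart_smooth c ?a" "chart_smooth c ?b"
      unfolding smooth_in_chart_smooth[OF chart, symmetric]
      by (rule smooth_in_diff[OF s const], rule smooth_in_diff[OF const s])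
  qed
  show "smooth_fun A ?a" "smooth_fun A ?b"
    using * by (simp_all add: smooth_fun_def)
  fix X Y c p
  assume X: "vector_field A X" and Y: "vector_field A Y" and c: "c \<in> A" and p: "p \<in> fst c"
  interpret k_contact_point A g c m \<phi> \<xi> p by (rule point_locale[OF c p])
  have "Q u = coeff_a *\<^sub>R u + (coeff_b * G x u) *\<^sub>R x" for u
    using weyl_\<xi>_\<xi>_eq_0_iff[OF m] W[OF c p] by blast
  note Ric = Ric_eq[OF this]
  have "ric g X Y c p = Ric (X c p) (Y c p)"
    by (intro ric_eq_ricci_form vector_fieldD(1)[OF atlas] X Y c)
  then show "ric g X Y c p = ?a p * g c p (X c p) (Y c p) + ?b p * \<eta> c p (X c p) * \<eta> c p (Y c p)"
    by (simp add: Ric coeff_a_def coeff_b_def scalar_curvature_eq[OF c p] \<eta>_eq[OF c p])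
qed

text \<open>The coefficient functions are arbitrary, but at each point
  \<open>\<eta>_einstein_coeffs\<close> forces their values to be those in the criterion for W(u,
  \<xi>)\<xi> = 0.\<close>

lemma weyl_\<xi>_\<xi>_if_\<eta>_einstein:
  assumes m: "m \<ge> 2" and E: "eta_einstein A g \<eta>" and c: "c \<in> A" and p: "p \<in> fst c"
  shows "riem_point.weyl_tensor g c p u (\<xi> c p) (\<xi> c p) = 0"
proof -
  interpret k_contact_point A g c m \<phi> \<xi> p by (rule point_locale[OF c p])
  obtain a b where ab: "\<And>X Y. vector_field A X \<Longrightarrow> vector_field A Y \<Longrightarrow>
      ric g X Y c p = a p * g c p (X c p) (Y c p) + b p * \<eta> c p (X c p) * \<eta> c p (Y c p)"
    using E c p unfolding eta_einstein_def by blast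
  have Ric: "Ric u v = a p * G u v + b p * G x u * G x v" for u v
  proof -
    obtain X where X: "vector_field A X" "X c p = u" using vector_field_extension[OF atlas c p] .
    obtain Y where Y: "vector_field A Y" "Y c p = v" using vector_field_extension[OF atlas c p] .
    have "ric g X Y c p = Ric (X c p) (Y c p)"
      by (intro ric_eq_ricci_form vector_fieldD(1)[OF atlas] X Y c)
    then show ?thesis using ab[OF X(1) Y(1)] by (simp add: X Y \<eta>_eq[OF c p])
  qed
  have "Q u = a p *\<^sub>R u + (b p * G x u) *\<^sub>R x"
    by (rule ricci_endo_eqI) (simp add: Ric simps)
  then show ?thesis
    using weyl_\<xi>_\<xi>_eq_0_iff[OF m] \<eta>_einstein_coeffs[OF m Ric] by simp
qed

lemma sasakian_if_weyl_\<xi>: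
  assumes m: "m \<ge> 2" and W: "\<forall>X Y. vector_field A X \<longrightarrow> vector_field A Y \<longrightarrow> vanishes A (weyl g X Y \<xi>)"
  shows "sasakian A m \<phi> \<eta> \<xi> g"
  unfolding sasakian_def
proof
  show "contact_riemannian A m \<phi> \<eta> \<xi> g" using k_contact by (simp add: k_contact_def)
  show "kaehler (cone_atlas A) (cone_metric g) CJ"
  proof (rule kaehler_cone)
    fix c p u v assume c: "c \<in> A" and p: "p \<in> fst c"
    interpret k_contact_point A g c m \<phi> \<xi> p by (rule point_locale[OF c p])
    have "weyl_tensor u v x = 0" for u v
    proof -
      obtain X where X: "vector_field A X" "X c p = u" using vector_field_extension[OF atlas c p] .
      obtain Y where Y: "vector_field A Y" "Y c p = v" using vector_field_extension[OF atlas c p] .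
      have "weyl g X Y \<xi> c p = 0" using W X Y c p by (simp add: vanishes_def)
      then show ?thesis using weyl_vector_fields[OF X(1) Y(1) c p] by (simp add: X Y)
    qed
    then show "R u v x = G x v *\<^sub>R u - G x u *\<^sub>R v" by (rule weyl_\<xi>_flat[OF m])
  qed
qed

text \<open>The 1-form metrically equivalent to \<xi> is \<eta>, and \<xi> has unit length.\<close>

lemma quasi_einstein_if_\<eta>_einstein:
  assumes "eta_einstein A g \<eta>" shows "quasi_einstein A g \<xi>"
proof -
  have "g c p (\<xi> c p) (\<xi> c p) = 1" if "c \<in> A" "p \<in> fst c" for c p
    using k_contact_chart.\<xi>_unit[OF chart_locale] that by blast
  with assms show ?thesis
    unfolding quasi_einstein_def eta_einstein_def using fields(3)
    by (simp add: \<eta>_eq cong: conj_cong)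
qed

end

theorem proposition1p1:
  fixes A :: "('p::{t2_space,second_countable_topology}, 'e::euclidean_space) chart set"
    and m :: nat
    and \<phi> :: "('p, 'e) endo" and \<eta> :: "('p, 'e) oneform"
    and \<xi> :: "('p, 'e) vfield" and g :: "('p, 'e) bform"
  assumes "k_contact A m \<phi> \<eta> \<xi> g" and "2 * m + 1 > 3"
  shows "((\<forall>X. vector_field A X \<longrightarrow> vanishes A (weyl g X \<xi> \<xi>)) \<longleftrightarrow> eta_einstein A g \<eta>) \<and>
    ((\<forall>X Y. vector_field A X \<longrightarrow> vector_field A Y \<longrightarrow> vanishes A (weyl g X Y \<xi>)) \<longrightarrow>
       sasakian A m \<phi> \<eta> \<xi> g \<and> eta_einstein A g \<eta> \<and> quasi_einstein A g \<xi>)"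
proof -
  interpret k_contact_manifold A m \<phi> \<eta> \<xi> g
    using assms(1) by unfold_locales
  have m: "m \<ge> 2" using assms(2) by simp
  have iff: "(\<forall>X. vector_field A X \<longrightarrow> vanishes A (weyl g X \<xi> \<xi>)) \<longleftrightarrow> eta_einstein A g \<eta>"
    unfolding weyl_\<xi>_\<xi>_vanishes_iff
    using \<eta>_einstein_if_weyl_\<xi>_\<xi>[OF m] weyl_\<xi>_\<xi>_if_\<eta>_einstein[OF m] by blast
  moreover have "sasakian A m \<phi> \<eta> \<xi> g \<and> eta_einstein A g \<eta> \<and> quasi_einstein A g \<xi>"
    if W: "\<forall>X Y. vector_field A X \<longrightarrow> vector_field A Y \<longrightarrow> vanishes A (weyl g X Y \<xi>)"
  proof -
    \<comment> \<open>Taking Y = \<xi> in the hypothesis reduces this to the first part.\<close>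
    have "eta_einstein A g \<eta>" using W fields(3) iff by blast
    then show ?thesis using sasakian_if_weyl_\<xi>[OF m W] quasi_einstein_if_\<eta>_einstein by blast
  qed
  ultimately show ?thesis by blast
qed

end
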